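(* Let $\mathcal{M}$ be a von Neumann algebra and let $M\subseteq\mathcal{M}_{sa}$ be a nonempty set bounded above in $(\mathcal{M}_{sa},\preceq)$. Let $\mathcal{F}=\{F\subseteq M : F \text{ finite and nonempty}\}$. For every $F\in\mathcal{F}$ put $\Delta_F=\min_{x\in F}\inf\{\lambda\in\mathbb{R} : E^x_\lambda\neq 0\}$. If $\delta_F\in(-\infty,\Delta_F]$ for every $F\in\mathcal{F}$, then $$\sup_{x\in M}x=\operatorname{s-lim}_{F\in\mathcal{F}}\left[\delta_F\mathbf{1}+\operatorname{s-lim}_{n\in\mathbb{N}}\left(\sum_{x\in F}(x-\delta_F\mathbf{1})^n\right)^{\frac1n}\right],$$ where the supremum is taken in $(\mathcal{M}_{sa},\preceq)$.
   Context: A von Neumann algebra $\mathcal{M}$ is a strongly operator closed C*-subalgebra of $\mathcal{B}(\mathcal{H})$, $\mathcal{H}$ a complex Hilbert space; $\mathbf{1}$ is its unit and $\mathcal{M}_{sa}$ its self-adjoint part. For $x\in\mathcal{M}_{sa}$, $(E^x_\lambda)_{\lambda\in\mathbb{R}}$ denotes its (right-continuous) spectral family: $E^x_\lambda$ is the spectral projection of $x$ for $(-\infty,\lambda]$. The spectral order $\preceq$ on $\mathcal{M}_{sa}$ is defined by: $x\preceq y$ iff $E^y_\lambda\le E^x_\lambda$ for every $\lambda\in\mathbb{R}$. In $(\mathcal{M}_{sa},\preceq)$ every nonempty set bounded above has a supremum. $\operatorname{s-lim}$ is the limit in the strong operator topology; $\mathcal{F}$ is directed by inclusion. *)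

theory Defs
  imports "HOL-Analysis.Analysis"
begin

text \<open>The inner product is linear in its first argument.\<close>

class chilbert_space = real_normed_vector + complete_space +
  fixes scaleC :: "complex \<Rightarrow> 'a \<Rightarrow> 'a" (infixr "*\<^sub>C" 75)
    and cinner :: "'a \<Rightarrow> 'a \<Rightarrow> complex"
  assumes scaleC_add_right: "c *\<^sub>C (x + y) = c *\<^sub>C x + c *\<^sub>C y"
    and scaleC_add_left: "(c + d) *\<^sub>C x = c *\<^sub>C x + d *\<^sub>C x"
    and scaleC_scaleC: "c *\<^sub>C d *\<^sub>C x = (c * d) *\<^sub>C x"
    and scaleC_one: "1 *\<^sub>C x = x"
    and scaleR_scaleC: "r *\<^sub>R x = complex_of_real r *\<^sub>C x"
    and cinner_commute: "cinner x y = cnj (cinner y x)"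
    and cinner_add_left: "cinner (x + y) z = cinner x z + cinner y z"
    and cinner_scaleC_left: "cinner (c *\<^sub>C x) y = c * cinner x y"
    and cinner_self_nonneg: "cinner x x \<in> \<real>\<^sub>\<ge>\<^sub>0"
    and cinner_self_eq_0_iff: "cinner x x = 0 \<longleftrightarrow> x = 0"
    and norm_eq_sqrt_cinner: "norm x = sqrt (cmod (cinner x x))"

lemma norm_scaleC: "norm (c *\<^sub>C x) = cmod c * norm (x :: 'h::chilbert_space)"
proof -
  have "cinner (c *\<^sub>C x) (c *\<^sub>C x) = c * cnj c * cinner x x"
    by (metis cinner_commute cinner_scaleC_left complex_cnj_mult mult.assoc)
  then have "cmod (cinner (c *\<^sub>C x) (c *\<^sub>C x)) = (cmod c)\<^sup>2 * cmod (cinner x x)"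
    by (simp add: norm_mult power2_eq_square)
  then show ?thesis
    by (simp add: norm_eq_sqrt_cinner real_sqrt_mult)
qed

lemma bounded_linear_scaleC: "bounded_linear (\<lambda>x :: 'h::chilbert_space. c *\<^sub>C x)"
proof (rule bounded_linear_intro)
  fix x y :: 'h and r :: real
  show "c *\<^sub>C (x + y) = c *\<^sub>C x + c *\<^sub>C y" by (rule scaleC_add_right)
  show "c *\<^sub>C (r *\<^sub>R x) = r *\<^sub>R (c *\<^sub>C x)"
    by (simp add: scaleR_scaleC scaleC_scaleC mult.commute)
  show "norm (c *\<^sub>C x) \<le> norm x * cmod c" by (simp add: norm_scaleC)
qed


text \<open>
  The library type \<open>'h \<Rightarrow>\<^sub>L 'h\<close> consists of the bounded real-linear operators, with the operator
  norm; the set \<open>bounded_ops\<close> of complex-linear ones is the algebra $B(H)$.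
\<close>

type_synonym 'h op = "'h \<Rightarrow>\<^sub>L 'h"

definition bounded_ops :: "'h::chilbert_space op set" where
  "bounded_ops = {T. \<forall>c \<xi>. blinfun_apply T (c *\<^sub>C \<xi>) = c *\<^sub>C blinfun_apply T \<xi>}"

lift_definition op_scaleC :: "complex \<Rightarrow> 'h::chilbert_space op \<Rightarrow> 'h op"
  is "\<lambda>c T \<xi>. c *\<^sub>C T \<xi>"
  by (rule bounded_linear_compose[OF bounded_linear_scaleC])

definition is_adjoint :: "'h::chilbert_space op \<Rightarrow> 'h op \<Rightarrow> bool" where
  "is_adjoint T S \<longleftrightarrow> (\<forall>\<xi> \<eta>. cinner (blinfun_apply T \<xi>) \<eta> = cinner \<xi> (blinfun_apply S \<eta>))"

definition self_adjoint :: "'h::chilbert_space op \<Rightarrow> bool" where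
  "self_adjoint T \<longleftrightarrow> is_adjoint T T"

definition positive_op :: "'h::chilbert_space op \<Rightarrow> bool" where
  "positive_op T \<longleftrightarrow> T \<in> bounded_ops \<and> (\<forall>\<xi>. cinner (blinfun_apply T \<xi>) \<xi> \<in> \<real>\<^sub>\<ge>\<^sub>0)"

definition op_le :: "'h::chilbert_space op \<Rightarrow> 'h op \<Rightarrow> bool" where
  "op_le S T \<longleftrightarrow> positive_op (T - S)"

definition is_projection :: "'h::chilbert_space op \<Rightarrow> bool" where
  "is_projection P \<longleftrightarrow> P \<in> bounded_ops \<and> self_adjoint P \<and> P o\<^sub>L P = P"

definition op_power :: "'h::chilbert_space op \<Rightarrow> nat \<Rightarrow> 'h op" where
  "op_power T n = (blinfun_compose T ^^ n) id_blinfun"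

text \<open>The positive \<open>n\<close>-th root of a positive operator, for \<open>n \<ge> 1\<close>.\<close>

definition op_root :: "nat \<Rightarrow> 'h::chilbert_space op \<Rightarrow> 'h op" where
  "op_root n T = (THE S. positive_op S \<and> op_power S n = T)"


definition cstar_subalgebra :: "'h::chilbert_space op set \<Rightarrow> bool" where
  "cstar_subalgebra \<M> \<longleftrightarrow>
     \<M> \<subseteq> bounded_ops \<and> 0 \<in> \<M> \<and>
     (\<forall>S\<in>\<M>. \<forall>T\<in>\<M>. S + T \<in> \<M>) \<and>
     (\<forall>c. \<forall>T\<in>\<M>. op_scaleC c T \<in> \<M>) \<and>
     (\<forall>S\<in>\<M>. \<forall>T\<in>\<M>. S o\<^sub>L T \<in> \<M>) \<and>
     (\<forall>T\<in>\<M>. \<exists>S\<in>\<M>. is_adjoint T S) \<and>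
     closed \<M>"

definition von_neumann_algebra :: "'h::chilbert_space op set \<Rightarrow> bool" where
  "von_neumann_algebra \<M> \<longleftrightarrow> cstar_subalgebra \<M> \<and> closedin strong_operator_topology \<M>"

text \<open>
  The unit of a strongly closed C*-subalgebra of $B(H)$ is a projection that may differ from
  the identity operator of $H$.
\<close>

definition algebra_unit :: "'h::chilbert_space op set \<Rightarrow> 'h op \<Rightarrow> bool" where
  "algebra_unit \<M> e \<longleftrightarrow> e \<in> \<M> \<and> (\<forall>T\<in>\<M>. e o\<^sub>L T = T \<and> T o\<^sub>L e = T)"

definition self_adjoint_part :: "'h::chilbert_space op set \<Rightarrow> 'h op set" where
  "self_adjoint_part \<M> = {T\<in>\<M>. self_adjoint T}"


text \<open>
  The spectral family of \<open>x\<close>, relative to the unit \<open>e\<close>: the right-continuous resolution \<open>E\<close> of \<open>e\<close>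
  with \<open>x = \<integral> t dE\<^sub>t\<close>. The integral is taken in the weak sense, against the Lebesgue-Stieltjes
  measures of the increasing right-continuous functions \<open>t \<mapsto> \<langle>E\<^sub>t \<xi>, \<xi>\<rangle>\<close>.
\<close>

definition is_spectral_family ::
    "'h::chilbert_space op \<Rightarrow> 'h op \<Rightarrow> (real \<Rightarrow> 'h op) \<Rightarrow> bool" where
  "is_spectral_family e x E \<longleftrightarrow>
     (\<forall>t. is_projection (E t)) \<and>
     (\<forall>s t. s \<le> t \<longrightarrow> op_le (E s) (E t)) \<and>
     (\<forall>t. limitin strong_operator_topology E (E t) (at_right t)) \<and>
     limitin strong_operator_topology E 0 at_bot \<and>
     limitin strong_operator_topology E e at_top \<and>
     (\<forall>\<xi>. has_bochner_integral
            (interval_measure (\<lambda>t. Re (cinner (blinfun_apply (E t) \<xi>) \<xi>)))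
            complex_of_real (cinner (blinfun_apply x \<xi>) \<xi>))"

definition spectral_family :: "'h::chilbert_space op \<Rightarrow> 'h op \<Rightarrow> real \<Rightarrow> 'h op" where
  "spectral_family e x = (THE E. is_spectral_family e x E)"

definition spectral_le :: "'h::chilbert_space op \<Rightarrow> 'h op \<Rightarrow> 'h op \<Rightarrow> bool" where
  "spectral_le e x y \<longleftrightarrow> (\<forall>t. op_le (spectral_family e y t) (spectral_family e x t))"

definition is_spectral_sup ::
    "'h::chilbert_space op set \<Rightarrow> 'h op \<Rightarrow> 'h op set \<Rightarrow> 'h op \<Rightarrow> bool" where
  "is_spectral_sup \<M> e X s \<longleftrightarrow>
     s \<in> self_adjoint_part \<M> \<and>
     (\<forall>x\<in>X. spectral_le e x s) \<and>
     (\<forall>y\<in>self_adjoint_part \<M>. (\<forall>x\<in>X. spectral_le e x y) \<longrightarrow> spectral_le e s y)"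

text \<open>Extended-real valued, so that the infimum is \<open>\<infinity>\<close> in the zero algebra.\<close>

definition spectral_lower :: "'h::chilbert_space op \<Rightarrow> 'h op \<Rightarrow> ereal" where
  "spectral_lower e x = Inf (ereal ` {t. spectral_family e x t \<noteq> 0})"

end

theory Submission
  imports Defs "HOL-Probability.Distribution_Functions"
begin

text \<open>
  The supremum of \<open>X\<close> in the spectral order is the operator whose spectral projection at \<open>t\<close> is the
  infimum of the spectral projections at \<open>t\<close> of the members of \<open>X\<close>. The theorem is therefore a
  statement about projections, once three facts are known: how an operator and its spectral family
  determine each other, that the infima stay in the algebra, and how strong convergence of operators
  follows from the behaviour of their spectral projections.

  Spectral projections are handled without integrals. The projection of \<open>x\<close> for \<open>(-\<infinity>, t]\<close> is the only
  projection that commutes with \<open>x\<close> and splits the quadratic form of \<open>x\<close> into a part \<open>\<le> t\<close> and a part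
  \<open>> t\<close> (\<open>cut\<close>). It exists because the kernel of \<open>\<bar>x - t\<bar> + (x - t)\<close> has the required property
  (\<open>cut_exists\<close>), and square root and kernel projection are limits of polynomials, so it lies in
  every strongly closed algebra that contains \<open>x\<close> and the identity. Conversely, Riemann--Stieltjes sums build an operator
  with given cuts (\<open>operator_of_resolution\<close>). The integral condition that defines a spectral
  family turns out to describe exactly the family of cuts (\<open>is_spectral_family_iff_cuts\<close>), and \<open>n\<close>-th
  roots of positive operators are obtained by substituting \<open>t ^ n\<close> into a resolution
  (\<open>psd_root_exists\<close>).

  For convergence, a norm-bounded net satisfies \<open>T i \<rightarrow> a\<close> strongly if, for all \<open>\<alpha> < \<beta>\<close>, the projections of \<open>T i\<close> at \<open>\<beta>\<close> tend to the
  identity on the range of the projection of \<open>a\<close> at \<open>\<alpha>\<close>, and those at \<open>\<alpha>\<close> tend to \<open>0\<close> on the complement of the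
  range of the projection of \<open>a\<close> at \<open>\<beta>\<close> (\<open>cut_convergence\<close>). Both limits of the theorem satisfy this. For the
  net of finite suprema, decreasing nets of projections converge to their infimum
  (\<open>inf_proj_tendsto\<close>). For the roots of power sums with \<open>k\<close> summands, put \<open>a x = x - \<delta>\<close>, which is positive.
  If \<open>\<xi>\<close> lies in all spectral subspaces of the \<open>a x\<close> at \<open>\<alpha>\<close>, then
  \<open>\<langle>\<Sum>\<^sub>x (a x)\<^sup>n \<xi>, \<xi>\<rangle> \<le> k \<alpha>\<^sup>n \<parallel>\<xi>\<parallel>\<^sup>2\<close>, so Chebyshev's inequality bounds the spectral mass of the root above
  \<open>\<beta>\<close> by \<open>k (\<alpha> / \<beta>)\<^sup>n \<parallel>\<xi>\<parallel>\<^sup>2\<close>. The other condition follows in the same way from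
  \<open>(a x)\<^sup>n \<le> \<Sum>\<^sub>x (a x)\<^sup>n\<close> (\<open>power_sum_root_tendsto\<close>).
\<close>

section \<open>The underlying real Hilbert space\<close>

text \<open>For complex-linear operators self-adjointness and positivity can be read off from the real part
  of the inner product. The operator theory below is therefore real; complex linearity of what it
  constructs comes from membership in the algebra \<open>bounded_ops\<close>.\<close>

definition ip :: "'h::chilbert_space \<Rightarrow> 'h \<Rightarrow> real" where
  "ip \<xi> \<eta> = Re (cinner \<xi> \<eta>)"

lemma cinner_self_real: "cinner \<xi> \<xi> = complex_of_real (Re (cinner \<xi> \<xi>))"
  using cinner_self_nonneg[of \<xi>] by (simp add: complex_nonneg_Reals_iff complex_eq_iff)

lemma ip_commute: "ip \<xi> \<eta> = ip \<eta> \<xi>"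
  unfolding ip_def by (subst cinner_commute) simp

lemma ip_add_left: "ip (\<xi> + \<xi>') \<eta> = ip \<xi> \<eta> + ip \<xi>' \<eta>"
  unfolding ip_def by (simp add: cinner_add_left)

lemma ip_scaleR_left: "ip (r *\<^sub>R \<xi>) \<eta> = r * ip \<xi> \<eta>"
  unfolding ip_def by (simp add: scaleR_scaleC cinner_scaleC_left)

lemma ip_add_right: "ip \<eta> (\<xi> + \<xi>') = ip \<eta> \<xi> + ip \<eta> \<xi>'"
  using ip_add_left ip_commute by metis

lemma ip_scaleR_right: "ip \<eta> (r *\<^sub>R \<xi>) = r * ip \<eta> \<xi>"
  using ip_scaleR_left ip_commute by metis

lemma ip_self_nonneg: "0 \<le> ip \<xi> \<xi>"
  using cinner_self_nonneg[of \<xi>] unfolding ip_def by (simp add: complex_nonneg_Reals_iff)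

lemma ip_self: "ip \<xi> \<xi> = (norm \<xi>)\<^sup>2"
proof -
  have "cmod (cinner \<xi> \<xi>) = ip \<xi> \<xi>"
    using ip_self_nonneg[of \<xi>] unfolding ip_def by (subst cinner_self_real) (simp only: norm_of_real abs_of_nonneg)
  thus ?thesis using ip_self_nonneg[of \<xi>] by (simp add: norm_eq_sqrt_cinner)
qed

lemma nonneg_quadratic_discriminant:
  fixes a b c :: real
  assumes "\<And>t. 0 \<le> a + 2 * t * b + t\<^sup>2 * c"
  shows "b\<^sup>2 \<le> a * c"
proof (cases "c = 0")
  case True
  have "b = 0"
  proof (rule ccontr)
    assume "b \<noteq> 0"
    thus False using assms[of "- (a + 1) / (2 * b)"] True by (simp add: field_simps)
  qed
  thus ?thesis using True by simp
next
  case False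
  have "c \<ge> 0"
  proof (rule ccontr)
    assume "\<not> c \<ge> 0"
    hence c: "c < 0" by simp
    \<comment> \<open>adding the values at \<open>t\<close> and \<open>- t\<close> removes the linear term\<close>
    have s: "0 \<le> a + t\<^sup>2 * c" for t
      using assms[of t] assms[of "- t"] by simp
    have "(\<bar>a\<bar> + 1) / (- c) \<ge> 0" using c by (intro divide_nonneg_pos) auto
    hence "(sqrt ((\<bar>a\<bar> + 1) / (- c)))\<^sup>2 * c = - (\<bar>a\<bar> + 1)" using c by simp
    thus False using s[of "sqrt ((\<bar>a\<bar> + 1) / (- c))"] by linarith
  qed
  hence c: "c > 0" using False by simp
  have "0 \<le> a + 2 * (- b / c) * b + (- b / c)\<^sup>2 * c" by (rule assms)
  also have "\<dots> = a - b\<^sup>2 / c" using c by (simp add: power2_eq_square field_simps)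
  finally show ?thesis using c by (simp add: field_simps)
qed

lemma ip_cauchy_schwarz: "\<bar>ip \<xi> \<eta>\<bar> \<le> norm \<xi> * norm \<eta>"
proof -
  have "0 \<le> ip (\<xi> + t *\<^sub>R \<eta>) (\<xi> + t *\<^sub>R \<eta>)" for t by (rule ip_self_nonneg)
  hence "0 \<le> ip \<xi> \<xi> + 2 * t * ip \<xi> \<eta> + t\<^sup>2 * ip \<eta> \<eta>" for t
    by (simp add: ip_add_left ip_add_right ip_scaleR_left ip_scaleR_right ip_commute[of \<eta> \<xi>]
        power2_eq_square algebra_simps)
  from nonneg_quadratic_discriminant[OF this]
  have "(ip \<xi> \<eta>)\<^sup>2 \<le> (norm \<xi> * norm \<eta>)\<^sup>2" by (simp add: ip_self power_mult_distrib)
  thus ?thesis by (simp add: abs_le_square_iff[symmetric])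
qed

lemma bounded_bilinear_ip: "bounded_bilinear (ip :: 'h::chilbert_space \<Rightarrow> 'h \<Rightarrow> real)"
proof
  show "\<exists>K. \<forall>a b :: 'h. norm (ip a b) \<le> norm a * norm b * K"
    by (rule exI[of _ 1]) (simp add: ip_cauchy_schwarz)
qed (simp_all add: ip_add_left ip_add_right ip_scaleR_left ip_scaleR_right)

interpretation ip: bounded_bilinear ip by (rule bounded_bilinear_ip)

lemmas ip_simps = ip_add_left ip_add_right ip.diff_left ip.diff_right ip_scaleR_left
  ip_scaleR_right ip.minus_left ip.minus_right ip.zero_left ip.zero_right

lemma ip_self_eq_0: "ip \<xi> \<xi> = 0 \<longleftrightarrow> \<xi> = 0"
  by (simp add: ip_self)

lemma ip_self_pos: "\<xi> \<noteq> 0 \<Longrightarrow> 0 < ip \<xi> \<xi>"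
  by (simp add: ip_self)

lemma norm_add_sq: "(norm (\<xi> + \<eta>))\<^sup>2 = (norm \<xi>)\<^sup>2 + 2 * ip \<xi> \<eta> + (norm \<eta>)\<^sup>2"
  by (simp add: ip_self[symmetric] ip_simps ip_commute[of \<eta> \<xi>])

lemma norm_diff_sq: "(norm (\<xi> - \<eta>))\<^sup>2 = (norm \<xi>)\<^sup>2 - 2 * ip \<xi> \<eta> + (norm \<eta>)\<^sup>2"
  by (simp add: ip_self[symmetric] ip_simps ip_commute[of \<eta> \<xi>])

section \<open>The projection theorem\<close>

definition closed_subspace :: "'h::chilbert_space set \<Rightarrow> bool" where
  "closed_subspace V \<longleftrightarrow> closed V \<and> subspace V"

text \<open>A sequence in \<open>V\<close> that minimizes the distance to \<open>\<xi>\<close> is Cauchy by the parallelogram law; the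
  minimality of its limit gives orthogonality of the residual.\<close>

lemma orthogonal_decomposition:
  fixes V :: "'h::chilbert_space set"
  assumes V: "closed_subspace V"
  shows "\<exists>v\<in>V. \<forall>w\<in>V. ip (\<xi> - v) w = 0"
proof -
  have sub: "subspace V" and cl: "closed V" using V by (auto simp: closed_subspace_def)
  define D where "D = (\<lambda>v. (norm (\<xi> - v))\<^sup>2) ` V"
  define d where "d = Inf D"
  have ne: "D \<noteq> {}" using subspace_0[OF sub] by (auto simp: D_def)
  have bd: "bdd_below D" by (rule bdd_belowI[of _ 0]) (auto simp: D_def)
  have lb: "d \<le> (norm (\<xi> - v))\<^sup>2" if "v \<in> V" for v
    unfolding d_def by (rule cInf_lower[OF _ bd]) (use that in \<open>auto simp: D_def\<close>)
  have "\<exists>v\<in>V. (norm (\<xi> - v))\<^sup>2 < d + inverse (real (Suc n))" for n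
  proof -
    have "\<exists>y\<in>D. y < d + inverse (real (Suc n))"
      by (rule cInf_lessD[OF ne]) (simp add: d_def)
    thus ?thesis by (auto simp: D_def)
  qed
  then obtain v where v: "\<And>n. v n \<in> V" "\<And>n. (norm (\<xi> - v n))\<^sup>2 < d + inverse (real (Suc n))"
    by metis
  have par: "(norm (v m - v n))\<^sup>2 \<le> 2 * inverse (real (Suc m)) + 2 * inverse (real (Suc n))" for m n
  proof -
    have mid: "(1/2) *\<^sub>R (v m + v n) \<in> V"
      using v(1) sub by (simp add: subspace_add subspace_scale)
    have eq: "\<xi> - (1/2) *\<^sub>R (v m + v n) = (1/2) *\<^sub>R ((\<xi> - v m) + (\<xi> - v n))"
      by (simp add: algebra_simps flip: scaleR_2)
    have "4 * d \<le> (norm ((\<xi> - v m) + (\<xi> - v n)))\<^sup>2"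
      using lb[OF mid] unfolding eq by (simp add: power_divide)
    moreover have "(norm (v m - v n))\<^sup>2 = (norm ((\<xi> - v n) - (\<xi> - v m)))\<^sup>2" by simp
    ultimately show ?thesis
      using v(2)[of m] v(2)[of n] by (simp only: norm_add_sq norm_diff_sq ip_commute)
  qed
  have "Cauchy v"
  proof (rule metric_CauchyI)
    fix e :: real assume e: "e > 0"
    obtain N where N: "inverse (real (Suc N)) < e\<^sup>2 / 4"
      using reals_Archimedean[of "e\<^sup>2 / 4"] zero_less_power[OF e] by (metis divide_pos_pos zero_less_numeral)
    show "\<exists>N. \<forall>m\<ge>N. \<forall>n\<ge>N. dist (v m) (v n) < e"
    proof (intro exI[of _ N] allI impI)
      fix m n assume "m \<ge> N" "n \<ge> N"
      hence "inverse (real (Suc m)) \<le> inverse (real (Suc N))" "inverse (real (Suc n)) \<le> inverse (real (Suc N))"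
        by (auto simp: field_simps)
      hence "(norm (v m - v n))\<^sup>2 < e\<^sup>2" using par[of m n] N by linarith
      thus "dist (v m) (v n) < e" using e by (simp add: dist_norm power2_less_imp_less)
    qed
  qed
  then obtain u where u: "v \<longlonglongrightarrow> u" using Cauchy_convergent_iff convergent_def by blast
  have uV: "u \<in> V" using cl v(1) u by (metis closed_sequentially)
  have "(norm (\<xi> - u))\<^sup>2 \<le> d"
  proof (rule LIMSEQ_le)
    show "(\<lambda>n. (norm (\<xi> - v n))\<^sup>2) \<longlonglongrightarrow> (norm (\<xi> - u))\<^sup>2" by (intro tendsto_intros u)
    show "(\<lambda>n. d + inverse (real (Suc n))) \<longlonglongrightarrow> d"
      using tendsto_add[OF tendsto_const LIMSEQ_inverse_real_of_nat, of d] by simp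
  qed (use v(2) less_imp_le in blast)
  hence min: "(norm (\<xi> - u))\<^sup>2 \<le> (norm (\<xi> - w))\<^sup>2" if "w \<in> V" for w
    using lb[OF that] by linarith
  have "ip (\<xi> - u) w = 0" if w: "w \<in> V" for w
  proof -
    have "0 \<le> 0 + 2 * t * (- ip (\<xi> - u) w) + t\<^sup>2 * (norm w)\<^sup>2" for t
    proof -
      have "u + t *\<^sub>R w \<in> V" using uV w sub by (simp add: subspace_add subspace_scale)
      from min[OF this] have "(norm (\<xi> - u))\<^sup>2 \<le> (norm ((\<xi> - u) - t *\<^sub>R w))\<^sup>2"
        by (simp add: diff_diff_add)
      thus ?thesis unfolding norm_diff_sq[of "\<xi> - u" "t *\<^sub>R w"]
        by (simp add: ip_scaleR_right power_mult_distrib)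
    qed
    from nonneg_quadratic_discriminant[OF this] show ?thesis by simp
  qed
  thus ?thesis using uV by blast
qed

lemma bipolar:
  fixes N :: "'h::chilbert_space set"
  assumes N: "closed_subspace N"
    and orth: "\<And>\<zeta>. (\<And>\<eta>. \<eta> \<in> N \<Longrightarrow> ip \<eta> \<zeta> = 0) \<Longrightarrow> ip \<xi> \<zeta> = 0"
  shows "\<xi> \<in> N"
proof -
  obtain v where v: "v \<in> N" "\<And>w. w \<in> N \<Longrightarrow> ip (\<xi> - v) w = 0"
    using orthogonal_decomposition[OF N] by blast
  have "ip \<xi> (\<xi> - v) = 0" by (rule orth) (metis v(2) ip_commute)
  moreover have "ip v (\<xi> - v) = 0" using v ip_commute by metis
  ultimately have "ip (\<xi> - v) (\<xi> - v) = 0" by (simp add: ip_simps)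
  thus ?thesis using v(1) by (simp add: ip_self_eq_0)
qed

section \<open>Self-adjoint operators and projections\<close>

definition sa :: "'h::chilbert_space op \<Rightarrow> bool" where
  "sa T \<longleftrightarrow> (\<forall>\<xi> \<eta>. ip (T \<xi>) \<eta> = ip \<xi> (T \<eta>))"

definition proj :: "'h::chilbert_space op \<Rightarrow> bool" where
  "proj P \<longleftrightarrow> sa P \<and> (\<forall>\<xi>. P (P \<xi>) = P \<xi>)"

definition psd :: "'h::chilbert_space op \<Rightarrow> bool" where
  "psd T \<longleftrightarrow> sa T \<and> (\<forall>\<xi>. 0 \<le> ip (T \<xi>) \<xi>)"

lemma saD: "sa T \<Longrightarrow> ip (T \<xi>) \<eta> = ip \<xi> (T \<eta>)"
  by (simp add: sa_def)

lemma sa_add: "sa S \<Longrightarrow> sa T \<Longrightarrow> sa (S + T)"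
  by (simp add: sa_def blinfun.bilinear_simps ip_simps)

lemma sa_diff: "sa S \<Longrightarrow> sa T \<Longrightarrow> sa (S - T)"
  by (simp add: sa_def blinfun.bilinear_simps ip_simps)

lemma sa_scaleR: "sa T \<Longrightarrow> sa (c *\<^sub>R T)"
  by (simp add: sa_def blinfun.bilinear_simps ip_simps)

lemma sa_id: "sa id_blinfun"
  by (simp add: sa_def)

lemma sa_zero: "sa 0"
  by (simp add: sa_def ip_simps)

lemma sa_sum: "(\<And>x. x \<in> F \<Longrightarrow> sa (f x)) \<Longrightarrow> sa (\<Sum>x\<in>F. f x)"
  by (induction F rule: infinite_finite_induct) (auto intro: sa_add sa_zero)

lemma sa_compose: "sa S \<Longrightarrow> sa T \<Longrightarrow> (\<And>\<xi>. S (T \<xi>) = T (S \<xi>)) \<Longrightarrow> sa (S o\<^sub>L T)"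
  by (simp add: sa_def)

lemma sa_strong_limit:
  assumes F: "F \<noteq> bot" and "\<And>i. sa (f i)" and lim: "\<And>\<xi>. ((\<lambda>i. blinfun_apply (f i) \<xi>) \<longlongrightarrow> blinfun_apply T \<xi>) F"
  shows "sa T"
  unfolding sa_def
proof (intro allI)
  fix \<xi> \<eta>
  have "((\<lambda>i. ip (f i \<xi>) \<eta>) \<longlongrightarrow> ip (T \<xi>) \<eta>) F"
    by (intro ip.tendsto tendsto_const lim)
  moreover have "((\<lambda>i. ip (f i \<xi>) \<eta>) \<longlongrightarrow> ip \<xi> (T \<eta>)) F"
    using ip.tendsto[OF tendsto_const lim, of \<xi> \<eta>] assms(2) by (simp add: saD)
  ultimately show "ip (T \<xi>) \<eta> = ip \<xi> (T \<eta>)"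
    by (rule tendsto_unique[OF F])
qed

lemma proj_ip: "proj P \<Longrightarrow> ip (P \<xi>) \<xi> = (norm (P \<xi>))\<^sup>2"
  by (metis proj_def sa_def ip_self)

lemma projD: "proj P \<Longrightarrow> sa P" "proj P \<Longrightarrow> P (P \<xi>) = P \<xi>"
  by (auto simp: proj_def)

lemma proj_psd: "proj P \<Longrightarrow> psd P"
  by (simp add: psd_def proj_ip projD)

lemma proj_id: "proj id_blinfun"
  by (simp add: proj_def sa_id)

lemma proj_complement: "proj P \<Longrightarrow> proj (id_blinfun - P)"
  by (simp add: proj_def sa_diff sa_id blinfun.bilinear_simps)

lemma proj_pythagoras: "proj P \<Longrightarrow> (norm \<xi>)\<^sup>2 = (norm (P \<xi>))\<^sup>2 + (norm (\<xi> - P \<xi>))\<^sup>2"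
  using norm_diff_sq[of \<xi> "P \<xi>"] proj_ip[of P \<xi>] by (simp add: ip_commute)

lemma proj_norm_le: "proj P \<Longrightarrow> norm (P \<xi>) \<le> norm \<xi>"
  by (rule power2_le_imp_le) (use proj_pythagoras[of P \<xi>] zero_le_power2[of "norm (\<xi> - P \<xi>)"] in linarith, rule norm_ge_zero)

lemma proj_eqI:
  assumes P: "proj P" and Q: "proj Q" and eq: "\<And>\<xi>. P \<xi> = \<xi> \<longleftrightarrow> Q \<xi> = \<xi>"
  shows "P = Q"
proof (rule blinfun_eqI)
  fix \<xi>
  have PQ: "P (Q \<xi>) = Q \<xi>" and QP: "Q (P \<xi>) = P \<xi>" for \<xi>
    using iffD2[OF eq projD(2)[OF Q]] iffD1[OF eq projD(2)[OF P]] by blast+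
  have "ip (P \<xi> - Q \<xi>) \<eta> = 0" for \<eta>
  proof -
    have "ip (P \<xi>) \<eta> = ip (Q (P \<xi>)) \<eta>" by (simp add: QP)
    also have "\<dots> = ip \<xi> (P (Q \<eta>))" using projD[OF P] projD[OF Q] by (simp add: saD)
    also have "\<dots> = ip (Q \<xi>) \<eta>" using projD[OF Q] by (simp add: PQ saD)
    finally show ?thesis by (simp add: ip_simps)
  qed
  from this[of "P \<xi> - Q \<xi>"] show "P \<xi> = Q \<xi>" by (simp add: ip_self_eq_0)
qed

lemma orthogonal_projection_exists:
  fixes V :: "'h::chilbert_space set"
  assumes V: "closed_subspace V"
  shows "\<exists>P :: 'h op. proj P \<and> (\<forall>\<xi>. P \<xi> = \<xi> \<longleftrightarrow> \<xi> \<in> V)"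
proof -
  have sub: "subspace V" using V by (auto simp: closed_subspace_def)
  obtain p where pV: "\<And>\<xi>. p \<xi> \<in> V" and po: "\<And>\<xi> w. w \<in> V \<Longrightarrow> ip (\<xi> - p \<xi>) w = 0"
    using orthogonal_decomposition[OF V] by metis
  have uniq: "p \<xi> = u" if "u \<in> V" "\<And>w. w \<in> V \<Longrightarrow> ip (\<xi> - u) w = 0" for \<xi> u
  proof -
    have d: "u - p \<xi> \<in> V" using pV that sub by (simp add: subspace_diff)
    from that(2)[OF d] po[OF d, of \<xi>] have "ip (u - p \<xi>) (u - p \<xi>) = 0" by (simp add: ip_simps)
    thus ?thesis by (simp add: ip_self_eq_0)
  qed
  have add: "p (\<xi> + \<eta>) = p \<xi> + p \<eta>" for \<xi> \<eta>
  proof (rule uniq)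
    fix w assume w: "w \<in> V"
    show "ip (\<xi> + \<eta> - (p \<xi> + p \<eta>)) w = 0"
      using po[OF w, of \<xi>] po[OF w, of \<eta>] by (simp add: ip.diff_left ip.add_left)
  qed (intro subspace_add sub pV)
  have scale: "p (r *\<^sub>R \<xi>) = r *\<^sub>R p \<xi>" for r \<xi>
  proof (rule uniq)
    fix w assume w: "w \<in> V"
    show "ip (r *\<^sub>R \<xi> - r *\<^sub>R p \<xi>) w = 0"
      using po[OF w, of \<xi>] by (simp add: ip.diff_left ip_scaleR_left)
  qed (intro subspace_scale sub pV)
  have nrm: "norm (p \<xi>) \<le> norm \<xi>" for \<xi>
  proof -
    have "(norm (\<xi> - p \<xi> + p \<xi>))\<^sup>2 = (norm (\<xi> - p \<xi>))\<^sup>2 + (norm (p \<xi>))\<^sup>2"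
      by (subst norm_add_sq) (simp add: po pV)
    hence "(norm (p \<xi>))\<^sup>2 \<le> (norm \<xi>)\<^sup>2" by simp
    thus ?thesis by (rule power2_le_imp_le) simp
  qed
  have "bounded_linear p"
    by (rule bounded_linear_intro[of _ 1]) (use add scale nrm in auto)
  then obtain P :: "'h op" where P: "\<And>\<xi>. P \<xi> = p \<xi>" by (metis bounded_linear_Blinfun_apply)
  have inV: "p \<xi> = \<xi> \<longleftrightarrow> \<xi> \<in> V" for \<xi>
    using pV[of \<xi>] uniq[of \<xi> \<xi>] by (auto simp: ip_simps)
  have "ip (p \<xi>) \<eta> = ip \<xi> (p \<eta>)" for \<xi> \<eta>
    using po[OF pV[of \<eta>], of \<xi>] po[OF pV[of \<xi>], of \<eta>] by (simp add: ip_simps ip_commute)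
  hence "proj P" using inV pV by (simp add: proj_def sa_def P)
  thus ?thesis using inV P by auto
qed

lemma psd_cauchy_schwarz:
  assumes "psd T" shows "(ip (T \<xi>) \<eta>)\<^sup>2 \<le> ip (T \<xi>) \<xi> * ip (T \<eta>) \<eta>"
proof -
  have c: "ip (T \<eta>) \<xi> = ip (T \<xi>) \<eta>" using assms by (metis psd_def saD ip_commute)
  have "0 \<le> ip (T (\<xi> + t *\<^sub>R \<eta>)) (\<xi> + t *\<^sub>R \<eta>)" for t using assms by (simp add: psd_def)
  hence "0 \<le> ip (T \<xi>) \<xi> + 2 * t * ip (T \<xi>) \<eta> + t\<^sup>2 * ip (T \<eta>) \<eta>" for t
    by (simp add: blinfun.bilinear_simps ip_simps c power2_eq_square algebra_simps)
  from nonneg_quadratic_discriminant[OF this] show ?thesis .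
qed

lemma psd_kernel: "psd T \<Longrightarrow> ip (T \<xi>) \<xi> = 0 \<Longrightarrow> T \<xi> = 0"
  using psd_cauchy_schwarz[of T \<xi> "T \<xi>"] by (simp add: ip_self)

lemma sa_norm_le:
  assumes T: "sa T" and c: "\<And>\<xi>. \<bar>ip (T \<xi>) \<xi>\<bar> \<le> c * ip \<xi> \<xi>"
  shows "norm (T \<xi>) \<le> c * norm \<xi>"
proof (cases "T \<xi> = 0")
  case True
  have "0 \<le> c * (norm \<xi>)\<^sup>2" using c[of \<xi>] by (simp add: ip_self)
  thus ?thesis using True by (cases "norm \<xi> = 0") (auto simp: zero_le_mult_iff)
next
  case False
  hence nz: "norm (T \<xi>) > 0" "norm \<xi> > 0" by (auto simp: blinfun.zero_right)
  have pol: "2 * ip (T \<xi>) \<eta> \<le> c * ((norm \<xi>)\<^sup>2 + (norm \<eta>)\<^sup>2)" for \<eta>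
  proof -
    have s: "ip (T \<eta>) \<xi> = ip (T \<xi>) \<eta>" using T by (metis saD ip_commute)
    have "4 * ip (T \<xi>) \<eta> = ip (T (\<xi> + \<eta>)) (\<xi> + \<eta>) - ip (T (\<xi> - \<eta>)) (\<xi> - \<eta>)"
      by (simp add: blinfun.bilinear_simps ip_simps s)
    also have "\<dots> \<le> c * ip (\<xi> + \<eta>) (\<xi> + \<eta>) + c * ip (\<xi> - \<eta>) (\<xi> - \<eta>)"
      using c[of "\<xi> + \<eta>"] c[of "\<xi> - \<eta>"] by linarith
    also have "\<dots> = c * (2 * (norm \<xi>)\<^sup>2 + 2 * (norm \<eta>)\<^sup>2)"
      by (simp add: ip_self norm_add_sq norm_diff_sq ip_commute[of \<eta> \<xi>] algebra_simps)
    finally show ?thesis by (simp add: algebra_simps)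
  qed
  \<comment> \<open>\<open>r T \<xi>\<close> has the norm of \<open>\<xi>\<close>, which makes the bound \<open>pol\<close> sharp\<close>
  define r where "r = norm \<xi> / norm (T \<xi>)"
  have "2 * (norm \<xi> * norm (T \<xi>)) = 2 * ip (T \<xi>) (r *\<^sub>R T \<xi>)"
    using nz by (simp add: ip_simps ip_self r_def power2_eq_square)
  also have "\<dots> \<le> c * ((norm \<xi>)\<^sup>2 + (norm (r *\<^sub>R T \<xi>))\<^sup>2)" by (rule pol)
  also have "norm (r *\<^sub>R T \<xi>) = norm \<xi>" using nz by (simp add: r_def)
  finally have "norm \<xi> * norm (T \<xi>) \<le> norm \<xi> * (c * norm \<xi>)" by (simp add: power2_eq_square algebra_simps)
  thus ?thesis using nz by (simp only: mult_le_cancel_left_pos)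
qed

lemma sa_norm_le_on_range:
  assumes x: "sa x" and R: "proj R" and comm: "\<And>\<xi>. R (x \<xi>) = x (R \<xi>)"
    and c: "\<And>\<xi>. R \<xi> = \<xi> \<Longrightarrow> \<bar>ip (x \<xi>) \<xi> - \<alpha> * ip \<xi> \<xi>\<bar> \<le> c * ip \<xi> \<xi>" and "c \<ge> 0"
    and "R \<xi> = \<xi>"
  shows "norm (x \<xi> - \<alpha> *\<^sub>R \<xi>) \<le> c * norm \<xi>"
proof -
  \<comment> \<open>compression of \<open>x - \<alpha>\<close> to the range of \<open>R\<close>\<close>
  define T where "T = (x - \<alpha> *\<^sub>R id_blinfun) o\<^sub>L R"
  have T: "T \<eta> = x (R \<eta>) - \<alpha> *\<^sub>R R \<eta>" for \<eta> by (simp add: T_def blinfun.bilinear_simps)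
  have "sa T" unfolding T_def
    by (rule sa_compose) (use x R comm in \<open>auto simp: sa_diff sa_scaleR sa_id projD blinfun.bilinear_simps\<close>)
  moreover have "\<bar>ip (T \<eta>) \<eta>\<bar> \<le> c * ip \<eta> \<eta>" for \<eta>
  proof -
    have "ip (T \<eta>) \<eta> = ip (R (T \<eta>)) \<eta>"
      using R comm by (simp add: T blinfun.bilinear_simps projD)
    hence "ip (T \<eta>) \<eta> = ip (x (R \<eta>)) (R \<eta>) - \<alpha> * ip (R \<eta>) (R \<eta>)"
      using R by (simp add: T projD saD ip_simps)
    also have "\<bar>\<dots>\<bar> \<le> c * ip (R \<eta>) (R \<eta>)" by (rule c) (simp add: projD R)
    also have "\<dots> \<le> c * ip \<eta> \<eta>"
      using proj_norm_le[OF R, of \<eta>] \<open>c \<ge> 0\<close> by (simp add: ip_self mult_left_mono power_mono)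
    finally show ?thesis .
  qed
  ultimately have "norm (T \<xi>) \<le> c * norm \<xi>" by (rule sa_norm_le)
  thus ?thesis using \<open>R \<xi> = \<xi>\<close> by (simp add: T)
qed

lemma sa_eqI:
  assumes "sa S" "sa T" "\<And>\<xi>. ip (S \<xi>) \<xi> = ip (T \<xi>) \<xi>"
  shows "S = T"
proof (rule blinfun_eqI)
  fix \<xi>
  have "\<bar>ip ((S - T) \<eta>) \<eta>\<bar> \<le> 0 * ip \<eta> \<eta>" for \<eta>
    using assms(3)[of \<eta>] by (simp add: blinfun.diff_left ip.diff_left)
  from sa_norm_le[OF sa_diff[OF assms(1,2)] this] have "norm ((S - T) \<xi>) \<le> 0 * norm \<xi>" .
  thus "S \<xi> = T \<xi>" by (simp add: blinfun.diff_left)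
qed

instance chilbert_space \<subseteq> banach ..

section \<open>Strongly closed operator algebras, square roots and kernel projections\<close>

text \<open>The closure properties that the construction of spectral projections uses. Commutants,
  \<open>bounded_ops\<close>, the extension of a von Neumann algebra by the identity and intersections of these are
  instances. So one construction shows at once that the result is complex linear, commutes with
  everything that commutes with the data, and belongs to the von Neumann algebra.\<close>

definition sot_algebra :: "'h::chilbert_space op set \<Rightarrow> bool" where
  "sot_algebra A \<longleftrightarrow> id_blinfun \<in> A \<and> (\<forall>S\<in>A. \<forall>T\<in>A. S + T \<in> A) \<and>
     (\<forall>c. \<forall>T\<in>A. c *\<^sub>R T \<in> A) \<and> (\<forall>S\<in>A. \<forall>T\<in>A. S o\<^sub>L T \<in> A) \<and>
     (\<forall>(f :: nat \<Rightarrow> 'h op) T. (\<forall>n. f n \<in> A) \<longrightarrow> (\<forall>\<xi>. (\<lambda>n. blinfun_apply (f n) \<xi>) \<longlonglongrightarrow> blinfun_apply T \<xi>) \<longrightarrow> T \<in> A)"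

lemma sot_algebraD:
  assumes "sot_algebra A"
  shows "id_blinfun \<in> A" "S \<in> A \<Longrightarrow> T \<in> A \<Longrightarrow> S + T \<in> A" "T \<in> A \<Longrightarrow> c *\<^sub>R T \<in> A"
    "S \<in> A \<Longrightarrow> T \<in> A \<Longrightarrow> S o\<^sub>L T \<in> A"
  using assms unfolding sot_algebra_def by blast+

lemma sot_algebra_limit:
  assumes "sot_algebra A"
    and "\<And>n. f n \<in> A" "\<And>\<xi>. (\<lambda>n::nat. blinfun_apply (f n) \<xi>) \<longlonglongrightarrow> blinfun_apply T \<xi>"
  shows "T \<in> A"
  using assms unfolding sot_algebra_def by blast

lemma sot_algebra_diff:
  assumes "sot_algebra A" "S \<in> A" "T \<in> A" shows "S - T \<in> A"
  using sot_algebraD(2)[OF assms(1,2) sot_algebraD(3)[OF assms(1,3), of "-1"]] by simp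

lemma sot_algebra_zero: "sot_algebra A \<Longrightarrow> 0 \<in> A"
  using sot_algebraD(3)[OF _ sot_algebraD(1), of A 0] by simp

lemma sot_algebra_sum:
  "sot_algebra A \<Longrightarrow> (\<And>x. x \<in> F \<Longrightarrow> f x \<in> A) \<Longrightarrow> (\<Sum>x\<in>F. f x) \<in> A"
  by (induction F rule: infinite_finite_induct) (auto intro: sot_algebraD sot_algebra_zero)

lemma sot_algebra_norm_limit:
  assumes "sot_algebra A" "\<And>n. f n \<in> A" "f \<longlonglongrightarrow> T"
  shows "T \<in> A"
  by (rule sot_algebra_limit[OF assms(1), of f]) (intro assms(2), rule blinfun.tendsto[OF assms(3) tendsto_const])

lemma sot_algebra_Int: "sot_algebra A \<Longrightarrow> sot_algebra B \<Longrightarrow> sot_algebra (A \<inter> B)"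
  unfolding sot_algebra_def by blast

definition commutant :: "'h::chilbert_space op \<Rightarrow> 'h op set" where
  "commutant S = {T :: 'h op. \<forall>\<xi>. S (T \<xi>) = T (S \<xi>)}"

lemma sot_algebra_commutant: "sot_algebra (commutant S)"
proof -
  have "S (T \<xi>) = T (S \<xi>)"
    if f: "\<forall>n. f n \<in> commutant S" and lim: "\<forall>\<xi>. (\<lambda>n::nat. blinfun_apply (f n) \<xi>) \<longlonglongrightarrow> blinfun_apply T \<xi>" for f T \<xi>
  proof (rule LIMSEQ_unique)
    show "(\<lambda>n. S (f n \<xi>)) \<longlonglongrightarrow> S (T \<xi>)" by (intro blinfun.tendsto tendsto_const lim[rule_format])
    show "(\<lambda>n. S (f n \<xi>)) \<longlonglongrightarrow> T (S \<xi>)"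
      using lim[rule_format, of "S \<xi>"] f by (simp add: commutant_def)
  qed
  hence "T \<in> commutant S" if "\<forall>n. f n \<in> commutant S" "\<forall>\<xi>. (\<lambda>n::nat. blinfun_apply (f n) \<xi>) \<longlonglongrightarrow> blinfun_apply T \<xi>" for f T
    using that unfolding commutant_def by blast
  thus ?thesis
    unfolding sot_algebra_def by (simp add: commutant_def blinfun.bilinear_simps)
qed

lemma sot_algebra_bounded_ops: "sot_algebra (bounded_ops :: 'h::chilbert_space op set)"
proof -
  have s: "r *\<^sub>R (c *\<^sub>C \<xi>) = c *\<^sub>C (r *\<^sub>R \<xi>)" for r c and \<xi> :: 'h
    by (simp add: scaleR_scaleC scaleC_scaleC mult.commute)
  have "T (c *\<^sub>C \<xi>) = c *\<^sub>C T \<xi>"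
    if f: "\<forall>n. f n \<in> bounded_ops" and lim: "\<forall>\<xi>. (\<lambda>n::nat. blinfun_apply (f n) \<xi>) \<longlonglongrightarrow> blinfun_apply T \<xi>"
    for f T c and \<xi> :: 'h
  proof (rule LIMSEQ_unique)
    show "(\<lambda>n. f n (c *\<^sub>C \<xi>)) \<longlonglongrightarrow> T (c *\<^sub>C \<xi>)" by (rule lim[rule_format])
    show "(\<lambda>n. f n (c *\<^sub>C \<xi>)) \<longlonglongrightarrow> c *\<^sub>C T \<xi>"
      using bounded_linear.tendsto[OF bounded_linear_scaleC lim[rule_format, of \<xi>], of c] f
      by (simp add: bounded_ops_def)
  qed
  hence "T \<in> bounded_ops"
    if "\<forall>n. f n \<in> bounded_ops" "\<forall>\<xi>. (\<lambda>n::nat. blinfun_apply (f n) \<xi>) \<longlonglongrightarrow> blinfun_apply T \<xi>" for f and T :: "'h op"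
    using that unfolding bounded_ops_def by blast
  thus ?thesis
    unfolding sot_algebra_def
    by (simp add: bounded_ops_def blinfun.bilinear_simps scaleC_add_right s)
qed

lemma op_power_0 [simp]: "op_power T 0 = id_blinfun"
  and op_power_Suc [simp]: "op_power T (Suc n) = T o\<^sub>L op_power T n"
  by (simp_all add: op_power_def)

lemma op_power_commutes:
  fixes S T :: "'h::chilbert_space op"
  assumes "\<And>\<xi>. S (T \<xi>) = T (S \<xi>)"
  shows "S (op_power T n \<xi>) = op_power T n (S \<xi>)"
  using assms by (induction n arbitrary: \<xi>) auto

lemma op_power_add: "blinfun_apply (op_power T (m + n)) \<xi> = op_power T m (op_power T n \<xi>)"
  by (induction m) auto

lemma sot_algebra_power: "sot_algebra A \<Longrightarrow> T \<in> A \<Longrightarrow> op_power T n \<in> A"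
  by (induction n) (auto intro: sot_algebraD)

lemma sa_power: "sa T \<Longrightarrow> sa (op_power T n)"
proof (induction n)
  case (Suc n)
  thus ?case using op_power_commutes[of T T] by (auto intro!: sa_compose)
qed (simp add: sa_id)

lemma norm_id_minus_square_le:
  fixes y :: "'h::chilbert_space op"
  assumes y: "sa y" and c: "c > 0" "norm y \<le> c"
  defines "u \<equiv> id_blinfun - (1 / c\<^sup>2) *\<^sub>R (y o\<^sub>L y)"
  shows "psd u" "norm (u \<xi>) \<le> norm \<xi>"
proof -
  have q: "ip (u \<xi>) \<xi> = (norm \<xi>)\<^sup>2 - (norm (y \<xi>))\<^sup>2 / c\<^sup>2" for \<xi>
    using saD[OF y, of "y \<xi>" \<xi>] by (simp add: u_def blinfun.bilinear_simps ip_simps ip_self)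
  have "norm (y \<xi>) \<le> c * norm \<xi>" for \<xi>
    using norm_blinfun[of y \<xi>] c by (meson mult_right_mono norm_ge_zero order_trans)
  hence "(norm (y \<xi>))\<^sup>2 \<le> c\<^sup>2 * (norm \<xi>)\<^sup>2" for \<xi>
    by (metis norm_ge_zero power_mono power_mult_distrib)
  hence "(norm (y \<xi>))\<^sup>2 / c\<^sup>2 \<le> (norm \<xi>)\<^sup>2" for \<xi>
    using c by (simp add: field_simps)
  hence b: "0 \<le> ip (u \<xi>) \<xi>" "ip (u \<xi>) \<xi> \<le> ip \<xi> \<xi>" for \<xi> by (simp_all add: q ip_self)
  have s: "sa u" unfolding u_def by (intro sa_diff sa_id sa_scaleR sa_compose y refl)
  thus "psd u" using b by (simp add: psd_def)
  have "\<bar>ip (u \<eta>) \<eta>\<bar> \<le> 1 * ip \<eta> \<eta>" for \<eta> using b[of \<eta>] by simp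
  from sa_norm_le[OF s this] have "norm (u \<xi>) \<le> 1 * norm \<xi>" .
  thus "norm (u \<xi>) \<le> norm \<xi>" by simp
qed

text \<open>With \<open>u = 1 - y\<^sup>2 / c\<^sup>2\<close> a square root of \<open>1 - u\<close> is \<open>1 - b\<close> where \<open>b = (u + b\<^sup>2) / 2\<close>.
  The iteration for \<open>b\<close> converges in norm: its steps are dominated by those of the scalar iteration
  \<open>\<beta> \<mapsto> (1 + \<beta>\<^sup>2) / 2\<close>, which increases and is bounded by \<open>1\<close>.\<close>

lemma psd_sqrt_of_square:
  fixes y :: "'h::chilbert_space op"
  assumes A: "sot_algebra A" and yA: "y \<in> A" and y: "sa y"
  shows "\<exists>a\<in>A. psd a \<and> (\<forall>\<xi>. a (a \<xi>) = y (y \<xi>))"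
proof -
  define c where "c = norm y + 1"
  have c: "c > 0" "norm y \<le> c" by (auto simp: c_def add_nonneg_pos)
  define u where "u = id_blinfun - (1 / c\<^sup>2) *\<^sub>R (y o\<^sub>L y)"
  have u: "psd u" "norm (u \<xi>) \<le> norm \<xi>" for \<xi>
    unfolding u_def by (rule norm_id_minus_square_le[OF y c])+
  have nu: "norm u \<le> 1" using u(2) by (intro norm_blinfun_bound) auto
  have uA: "u \<in> A"
    unfolding u_def by (intro sot_algebra_diff[OF A] sot_algebraD[OF A] yA)
  define b where "b = rec_nat 0 (\<lambda>_ b. (1/2) *\<^sub>R (u + (b o\<^sub>L b)))"
  have b0: "b 0 = 0" and bS: "b (Suc n) = (1/2) *\<^sub>R (u + (b n o\<^sub>L b n))" for n
    by (simp_all add: b_def)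
  define \<beta> where "\<beta> = rec_nat 0 (\<lambda>_ t::real. (1/2) * (1 + t\<^sup>2))"
  have \<beta>0: "\<beta> 0 = 0" and \<beta>S: "\<beta> (Suc n) = (1/2) * (1 + (\<beta> n)\<^sup>2)" for n
    by (simp_all add: \<beta>_def)
  have \<beta>r: "0 \<le> \<beta> n \<and> \<beta> n \<le> 1" for n
    by (induction n) (auto simp: \<beta>0 \<beta>S abs_square_le_1)
  have \<beta>inc: "\<beta> n \<le> \<beta> (Suc n)" for n
    using sum_squares_ge_zero[of "1 - \<beta> n" 0] by (simp add: \<beta>S power2_eq_square algebra_simps)
  have bA: "b n \<in> A" for n
    by (induction n) (auto simp: b0 bS intro: sot_algebraD[OF A] sot_algebra_zero[OF A] uA)
  have cu: "u (b n \<xi>) = b n (u \<xi>)" for n \<xi>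
    by (induction n arbitrary: \<xi>) (auto simp: b0 bS blinfun.bilinear_simps)
  have sb: "sa (b n)" for n
    by (induction n) (use u(1) in \<open>auto simp: b0 bS psd_def intro!: sa_zero sa_scaleR sa_add sa_compose\<close>)
  have nb: "norm (b n) \<le> \<beta> n" for n
  proof (induction n)
    case (Suc n)
    have "norm (b n o\<^sub>L b n) \<le> (\<beta> n)\<^sup>2"
      using norm_blinfun_compose[of "b n" "b n"] mult_mono[OF Suc Suc] \<beta>r[of n]
      by (simp add: power2_eq_square)
    hence "norm (u + (b n o\<^sub>L b n)) \<le> 1 + (\<beta> n)\<^sup>2"
      using norm_triangle_ineq[of u "b n o\<^sub>L b n"] nu by linarith
    thus ?case by (simp add: bS \<beta>S)
  qed (simp add: b0 \<beta>0)
  have step: "b (Suc (Suc n)) - b (Suc n) = (1/2) *\<^sub>R ((b (Suc n) - b n) o\<^sub>L (b (Suc n) + b n))" for n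
  proof (rule blinfun_eqI)
    fix \<xi>
    have "b n (b (Suc n) \<xi>) = b (Suc n) (b n \<xi>)"
      by (simp add: bS blinfun.bilinear_simps cu)
    thus "(b (Suc (Suc n)) - b (Suc n)) \<xi> = ((1/2) *\<^sub>R ((b (Suc n) - b n) o\<^sub>L (b (Suc n) + b n))) \<xi>"
      by (subst bS, subst (2) bS) (simp add: blinfun.bilinear_simps algebra_simps)
  qed
  have nd: "norm (b (Suc n) - b n) \<le> \<beta> (Suc n) - \<beta> n" for n
  proof (induction n)
    case 0 show ?case using nb[of 1] by (simp add: b0 \<beta>0)
  next
    case (Suc n)
    have "norm ((b (Suc n) - b n) o\<^sub>L (b (Suc n) + b n)) \<le> norm (b (Suc n) - b n) * norm (b (Suc n) + b n)"
      by (rule norm_blinfun_compose)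
    also have "\<dots> \<le> (\<beta> (Suc n) - \<beta> n) * (\<beta> (Suc n) + \<beta> n)"
      using Suc norm_triangle_ineq[of "b (Suc n)" "b n"] nb[of n] nb[of "Suc n"] \<beta>inc[of n]
      by (intro mult_mono) auto
    also have "\<dots> = 2 * (\<beta> (Suc (Suc n)) - \<beta> (Suc n))"
      using \<beta>S[of n] by (simp add: \<beta>S[of "Suc n"] power2_eq_square algebra_simps)
    finally show ?case unfolding step by simp
  qed
  have nd': "norm (b (n + k) - b n) \<le> \<beta> (n + k) - \<beta> n" for n k
  proof (induction k)
    case (Suc k)
    have "norm (b (n + Suc k) - b n) \<le> norm (b (Suc (n + k)) - b (n + k)) + norm (b (n + k) - b n)"
      using norm_triangle_ineq[of "b (Suc (n + k)) - b (n + k)" "b (n + k) - b n"] by simp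
    thus ?case using Suc nd[of "n + k"] by simp
  qed simp
  have "incseq \<beta>" using \<beta>inc by (rule incseq_SucI)
  then obtain L where "\<beta> \<longlonglongrightarrow> L"
    using incseq_convergent[of \<beta> 1] \<beta>r by metis
  hence C\<beta>: "Cauchy \<beta>" by (simp add: LIMSEQ_imp_Cauchy)
  have "Cauchy b"
  proof (rule CauchyI')
    fix e :: real assume "e > 0"
    then obtain M where M: "\<And>m n. m \<ge> M \<Longrightarrow> n \<ge> M \<Longrightarrow> norm (\<beta> m - \<beta> n) < e"
      using CauchyD[OF C\<beta>] by metis
    show "\<exists>M. \<forall>m\<ge>M. \<forall>n>m. dist (b m) (b n) < e"
    proof (intro exI[of _ M] allI impI)
      fix m n assume mn: "m \<ge> M" "n > m"
      have "norm (b n - b m) \<le> \<beta> n - \<beta> m" using nd'[of m "n - m"] mn by simp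
      also have "\<dots> < e" using M[of n m] mn by simp
      finally show "dist (b m) (b n) < e" by (simp add: dist_norm norm_minus_commute)
    qed
  qed
  then obtain B where B: "b \<longlonglongrightarrow> B" using Cauchy_convergent_iff convergent_def by blast
  have "(\<lambda>n. b (Suc n)) \<longlonglongrightarrow> (1/2) *\<^sub>R (u + (B o\<^sub>L B))"
    unfolding bS by (intro tendsto_intros bounded_bilinear.tendsto[OF bounded_bilinear_blinfun_compose] B)
  with LIMSEQ_Suc[OF B] have B_eq: "B = (1/2) *\<^sub>R (u + (B o\<^sub>L B))" by (rule LIMSEQ_unique)
  have BA: "B \<in> A" by (rule sot_algebra_norm_limit[OF A bA B])
  have sB: "sa B"
    by (rule sa_strong_limit[OF sequentially_bot, of b]) (auto intro!: sb blinfun.tendsto B)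
  have nB: "norm B \<le> 1"
    by (rule Lim_bounded[OF tendsto_norm[OF B], of 0]) (use nb \<beta>r order_trans in blast)
  define a where "a = c *\<^sub>R (id_blinfun - B)"
  have "a \<in> A" unfolding a_def by (intro sot_algebra_diff[OF A] sot_algebraD[OF A] BA)
  moreover have "psd a"
  proof -
    have "ip (B \<xi>) \<xi> \<le> ip \<xi> \<xi>" for \<xi>
    proof -
      have "ip (B \<xi>) \<xi> \<le> norm (B \<xi>) * norm \<xi>" using ip_cauchy_schwarz[of "B \<xi>" \<xi>] by linarith
      also have "\<dots> \<le> (1 * norm \<xi>) * norm \<xi>"
        using norm_blinfun[of B \<xi>] mult_right_mono[OF nB norm_ge_zero[of \<xi>]]
        by (intro mult_right_mono) auto
      finally show ?thesis by (simp add: ip_self power2_eq_square)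
    qed
    thus ?thesis using c unfolding psd_def a_def
      by (auto intro!: sa_scaleR sa_diff sa_id sB simp: blinfun.bilinear_simps ip_simps)
  qed
  moreover have "a (a \<xi>) = y (y \<xi>)" for \<xi>
  proof -
    have "B \<xi> = (1/2) *\<^sub>R (u \<xi> + B (B \<xi>))"
      by (subst B_eq) (simp add: blinfun.bilinear_simps)
    hence "2 *\<^sub>R B \<xi> = 2 *\<^sub>R (1/2) *\<^sub>R (u \<xi> + B (B \<xi>))" by (rule arg_cong)
    hence "2 *\<^sub>R B \<xi> = u \<xi> + B (B \<xi>)" unfolding scaleR_scaleR by simp
    hence e: "\<xi> - 2 *\<^sub>R B \<xi> + B (B \<xi>) = \<xi> - u \<xi>" by simp
    have "a (a \<xi>) = c\<^sup>2 *\<^sub>R (\<xi> - 2 *\<^sub>R B \<xi> + B (B \<xi>))"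
      by (simp add: a_def blinfun.bilinear_simps power2_eq_square algebra_simps scaleR_2)
    also have "\<dots> = y (y \<xi>)" using c by (simp add: e u_def blinfun.bilinear_simps)
    finally show ?thesis .
  qed
  ultimately show ?thesis by blast
qed

lemma closed_subspace_null_net:
  fixes Q :: "'i \<Rightarrow> 'h::chilbert_space op"
  assumes Q: "eventually (\<lambda>i. \<forall>\<xi>. norm (Q i \<xi>) \<le> norm \<xi>) F"
  shows "closed_subspace {\<eta>. ((\<lambda>i. Q i \<eta>) \<longlongrightarrow> 0) F}"
  unfolding closed_subspace_def
proof
  show "subspace {\<eta>. ((\<lambda>i. Q i \<eta>) \<longlongrightarrow> 0) F}"
    unfolding subspace_def blinfun.bilinear_simps mem_Collect_eq
    using tendsto_add[where a = 0 and b = 0] tendsto_scaleR[OF tendsto_const, where b = 0]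
    by (auto simp: blinfun.bilinear_simps)
  show "closed {\<eta>. ((\<lambda>i. Q i \<eta>) \<longlongrightarrow> 0) F}"
    unfolding closed_sequential_limits mem_Collect_eq
  proof (intro allI impI, elim conjE)
    fix f and l :: 'h assume f: "\<forall>n. ((\<lambda>i. Q i (f n)) \<longlongrightarrow> 0) F" and l: "f \<longlonglongrightarrow> l"
    show "((\<lambda>i. Q i l) \<longlongrightarrow> 0) F"
    proof (rule tendstoI)
      fix e :: real assume e: "e > 0"
      then obtain n where n: "norm (f n - l) < e / 2"
        using LIMSEQ_D[OF l, of "e/2"] by auto
      have "eventually (\<lambda>i. dist (Q i (f n)) 0 < e / 2) F"
        using tendstoD[OF f[rule_format], of "e/2"] e by simp
      with Q show "eventually (\<lambda>i. dist (Q i l) 0 < e) F"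
      proof eventually_elim
        case (elim i)
        have "norm (Q i l) \<le> norm (Q i (f n)) + norm (Q i (l - f n))"
          using norm_triangle_ineq[of "Q i (f n)" "Q i (l - f n)"] by (simp add: blinfun.diff_right)
        also have "\<dots> < e / 2 + e / 2"
          using elim(2) elim(1)[rule_format, of "l - f n"] n by (simp add: norm_minus_commute)
        finally show ?case by simp
      qed
    qed
  qed
qed

text \<open>For \<open>z = 1 - w\<^sup>2 / c\<^sup>2\<close> the powers \<open>z\<^sup>n\<close> fix the kernel of \<open>w\<close> pointwise and tend strongly
  to \<open>0\<close> on the range of \<open>w\<^sup>2\<close>, because \<open>\<parallel>z\<^sup>n\<xi> - z\<^sup>n\<^sup>+\<^sup>1\<xi>\<parallel>\<^sup>2 \<le> \<parallel>z\<^sup>n\<xi>\<parallel>\<^sup>2 - \<parallel>z\<^sup>n\<^sup>+\<^sup>1\<xi>\<parallel>\<^sup>2\<close>. So their strong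
  limit is the projection onto the kernel, which therefore stays in the algebra.\<close>

lemma kernel_projection:
  fixes w :: "'h::chilbert_space op"
  assumes A: "sot_algebra A" and wA: "w \<in> A" and w: "sa w"
  shows "\<exists>P\<in>A. proj P \<and> (\<forall>\<xi>. P \<xi> = \<xi> \<longleftrightarrow> w \<xi> = 0)"
proof -
  define c where "c = norm w + 1"
  have c: "c > 0" "norm w \<le> c" by (auto simp: c_def add_nonneg_pos)
  define y where "y = (1 / c\<^sup>2) *\<^sub>R (w o\<^sub>L w)"
  define z where "z = id_blinfun - y"
  have z: "psd z" "norm (z \<xi>) \<le> norm \<xi>" for \<xi>
    unfolding z_def y_def by (rule norm_id_minus_square_le[OF w c])+
  have y\<xi>: "y \<xi> = \<xi> - z \<xi>" for \<xi> by (simp add: z_def blinfun.bilinear_simps)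
  have sy: "sa y" unfolding y_def by (intro sa_scaleR sa_compose w refl)
  have zA: "z \<in> A" unfolding z_def y_def by (intro sot_algebra_diff[OF A] sot_algebraD[OF A] wA)
  have "closed_subspace {\<xi>. w \<xi> = 0}"
    unfolding closed_subspace_def
    by (auto simp: subspace_def blinfun.bilinear_simps intro!: closed_Collect_eq continuous_intros)
  then obtain P :: "'h op" where P: "proj P" "\<And>\<xi>. P \<xi> = \<xi> \<longleftrightarrow> w \<xi> = 0"
    using orthogonal_projection_exists by force
  have contr: "norm (op_power z n \<xi>) \<le> norm \<xi>" for n \<xi>
    by (induction n) (use z(2) order_trans in auto)
  define N where "N = {\<eta>. (\<lambda>n. op_power z n \<eta>) \<longlonglongrightarrow> 0}"
  have N: "closed_subspace N"
    unfolding N_def by (rule closed_subspace_null_net) (simp add: contr)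
  have yN: "y \<eta> \<in> N" for \<eta>
  proof -
    define v where "v = (\<lambda>n. op_power z n \<eta>)"
    have vS: "v (Suc n) = z (v n)" for n by (simp add: v_def)
    have zz: "(norm (z \<zeta>))\<^sup>2 \<le> ip (z \<zeta>) \<zeta>" for \<zeta>
    proof (cases "z \<zeta> = 0")
      case False
      have "((norm (z \<zeta>))\<^sup>2)\<^sup>2 \<le> ip (z \<zeta>) \<zeta> * ip (z (z \<zeta>)) (z \<zeta>)"
        using psd_cauchy_schwarz[OF z(1), of \<zeta> "z \<zeta>"] by (simp add: ip_self)
      also have "ip (z (z \<zeta>)) (z \<zeta>) \<le> (norm (z \<zeta>))\<^sup>2"
        using ip_cauchy_schwarz[of "z (z \<zeta>)" "z \<zeta>"] mult_right_mono[OF z(2)[of "z \<zeta>"] norm_ge_zero[of "z \<zeta>"]]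
        by (simp add: power2_eq_square)
      finally have "(norm (z \<zeta>))\<^sup>2 * (norm (z \<zeta>))\<^sup>2 \<le> ip (z \<zeta>) \<zeta> * (norm (z \<zeta>))\<^sup>2"
        using z(1) by (simp add: psd_def power2_eq_square mult_left_mono)
      thus ?thesis by (rule mult_right_le_imp_le) (use False in simp)
    qed (simp add: ip_simps)
    have d: "(norm (y (v n)))\<^sup>2 \<le> (norm (v n))\<^sup>2 - (norm (v (Suc n)))\<^sup>2" for n
      using zz[of "v n"] by (simp add: y\<xi> norm_diff_sq vS ip_commute)
    have "decseq (\<lambda>n. (norm (v n))\<^sup>2)"
      by (rule decseq_SucI) (simp add: vS z(2) power_mono)
    then obtain L where L: "(\<lambda>n. (norm (v n))\<^sup>2) \<longlonglongrightarrow> L"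
      using decseq_convergent[of "\<lambda>n. (norm (v n))\<^sup>2" 0] by auto
    have up: "(\<lambda>n. (norm (v n))\<^sup>2 - (norm (v (Suc n)))\<^sup>2) \<longlonglongrightarrow> 0"
      using tendsto_diff[OF L LIMSEQ_Suc[OF L]] by simp
    have "(\<lambda>n. (norm (y (v n)))\<^sup>2) \<longlonglongrightarrow> 0"
      by (rule tendsto_sandwich[OF _ _ tendsto_const up])
        (intro always_eventually allI zero_le_power2 d)+
    from tendsto_real_sqrt[OF this] have "(\<lambda>n. norm (y (v n))) \<longlonglongrightarrow> 0" by simp
    hence "(\<lambda>n. y (v n)) \<longlonglongrightarrow> 0" by (rule tendsto_norm_zero_cancel)
    moreover have "y (v n) = op_power z n (y \<eta>)" for n
      unfolding v_def by (rule op_power_commutes) (simp add: y\<xi> blinfun.bilinear_simps)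
    ultimately show ?thesis by (simp add: N_def)
  qed
  have "\<xi> - P \<xi> \<in> N" for \<xi>
  proof (rule bipolar[OF N])
    fix \<zeta> assume "\<And>\<eta>. \<eta> \<in> N \<Longrightarrow> ip \<eta> \<zeta> = 0"
    hence "ip (y (y \<zeta>)) \<zeta> = 0" "ip (y \<zeta>) \<zeta> = 0" using yN by blast+
    hence "ip (w \<zeta>) (w \<zeta>) = 0"
      using c saD[OF w, of "w \<zeta>" \<zeta>] by (simp add: y_def blinfun.bilinear_simps ip_simps)
    hence "P \<zeta> = \<zeta>" using P(2) by (simp add: ip_self_eq_0)
    hence "ip (\<xi> - P \<xi>) \<zeta> = ip (P (\<xi> - P \<xi>)) \<zeta>" using projD(1)[OF P(1)] by (simp add: saD)
    thus "ip (\<xi> - P \<xi>) \<zeta> = 0" using P(1) by (simp add: blinfun.bilinear_simps projD ip_simps)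
  qed
  hence lim0: "(\<lambda>n. op_power z n (\<xi> - P \<xi>)) \<longlonglongrightarrow> 0" for \<xi> by (simp add: N_def)
  have fixP: "op_power z n (P \<xi>) = P \<xi>" for n \<xi>
  proof (induction n)
    case (Suc n)
    have "w (P \<xi>) = 0" using P projD(2) by blast
    thus ?case using Suc by (simp add: z_def y_def blinfun.bilinear_simps)
  qed simp
  have "(\<lambda>n. op_power z n \<xi>) \<longlonglongrightarrow> P \<xi>" for \<xi>
    using tendsto_add[OF tendsto_const lim0, of "P \<xi>" \<xi>] by (simp add: blinfun.diff_right fixP)
  hence "P \<in> A" by (intro sot_algebra_limit[OF A sot_algebra_power[OF A zA]])
  thus ?thesis using P by blast
qed

section \<open>Spectral cuts\<close>

definition corner :: "'h::chilbert_space op \<Rightarrow> 'h op \<Rightarrow> bool" where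
  "corner e x \<longleftrightarrow> (\<forall>\<xi>. e (x \<xi>) = x \<xi> \<and> x (e \<xi>) = x \<xi>)"

definition hermitian_in :: "'h::chilbert_space op \<Rightarrow> 'h op \<Rightarrow> bool" where
  "hermitian_in e x \<longleftrightarrow> proj e \<and> sa x \<and> corner e x"

text \<open>The spectral projection of \<open>x\<close> for \<open>(-\<infinity>, t]\<close> in the corner with unit \<open>e\<close>. The inequality on the
  complement has to be strict: with a weak one an eigenspace for \<open>t\<close> could be put on either side.\<close>

definition cut :: "'h::chilbert_space op \<Rightarrow> 'h op \<Rightarrow> real \<Rightarrow> 'h op \<Rightarrow> bool" where
  "cut e x t P \<longleftrightarrow> proj P \<and> corner e P \<and> (\<forall>\<xi>. P (x \<xi>) = x (P \<xi>)) \<and>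
     (\<forall>\<xi>. P \<xi> = \<xi> \<longrightarrow> ip (x \<xi>) \<xi> \<le> t * ip \<xi> \<xi>) \<and>
     (\<forall>\<xi>. e \<xi> = \<xi> \<longrightarrow> P \<xi> = 0 \<longrightarrow> \<xi> \<noteq> 0 \<longrightarrow> t * ip \<xi> \<xi> < ip (x \<xi>) \<xi>)"

lemma cornerD: "corner e x \<Longrightarrow> e (x \<xi>) = x \<xi>" "corner e x \<Longrightarrow> x (e \<xi>) = x \<xi>"
  by (auto simp: corner_def)

lemma cutD:
  assumes "cut e x t P"
  shows "proj P" "corner e P" "P (x \<xi>) = x (P \<xi>)" "P \<xi> = \<xi> \<Longrightarrow> ip (x \<xi>) \<xi> \<le> t * ip \<xi> \<xi>"
    "e \<xi> = \<xi> \<Longrightarrow> P \<xi> = 0 \<Longrightarrow> \<xi> \<noteq> 0 \<Longrightarrow> t * ip \<xi> \<xi> < ip (x \<xi>) \<xi>"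
  using assms by (auto simp: cut_def)

text \<open>With \<open>y = x - t e\<close> and \<open>a = \<bar>y\<bar>\<close>, the operator \<open>w = a + y\<close> is twice the positive part of \<open>y\<close>. On its
  kernel \<open>y = - a \<le> 0\<close>. The range of \<open>a - y\<close> lies in that kernel, since \<open>(a + y) (a - y) = a\<^sup>2 - y\<^sup>2 = 0\<close>; so \<open>a - y\<close>
  vanishes on the orthogonal complement, where \<open>y = a \<ge> 0\<close>, and equality would force \<open>w \<xi> = 0\<close>.\<close>

lemma cut_exists:
  assumes A: "sot_algebra A" and eA: "e \<in> A" and xA: "x \<in> A" and h: "hermitian_in e x"
  shows "\<exists>P\<in>A. cut e x t P"
proof -
  have e: "proj e" and sx: "sa x" and ex: "\<And>\<xi>. e (x \<xi>) = x \<xi>" and xe: "\<And>\<xi>. x (e \<xi>) = x \<xi>"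
    using h by (auto simp: hermitian_in_def corner_def)
  define y where "y = x - t *\<^sub>R e"
  have y\<xi>: "y \<xi> = x \<xi> - t *\<^sub>R e \<xi>" for \<xi> by (simp add: y_def blinfun.bilinear_simps)
  have sy: "sa y" unfolding y_def by (intro sa_diff sa_scaleR sx projD e)
  have yA: "y \<in> A" unfolding y_def by (intro sot_algebra_diff[OF A] sot_algebraD[OF A] eA xA)
  have ye: "e (y \<xi>) = y \<xi>" "y (e \<xi>) = y \<xi>" for \<xi>
    by (simp_all add: y\<xi> blinfun.bilinear_simps ex xe projD[OF e])
  have yx: "x (y \<xi>) = y (x \<xi>)" for \<xi> by (simp add: y\<xi> blinfun.bilinear_simps ex xe)
  define B where "B = A \<inter> (commutant y \<inter> (commutant x \<inter> commutant e))"
  have B: "sot_algebra B" unfolding B_def by (intro sot_algebra_Int A sot_algebra_commutant)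
  have yB: "y \<in> B" using yA by (simp add: B_def commutant_def ye yx)
  obtain a where a: "a \<in> B" "psd a" "\<And>\<xi>. a (a \<xi>) = y (y \<xi>)"
    using psd_sqrt_of_square[OF B yB sy] by blast
  have sa_a: "sa a" using a(2) by (simp add: psd_def)
  have ya: "y (a \<xi>) = a (y \<xi>)" for \<xi> using a(1) by (simp add: B_def commutant_def)
  define w where "w = a + y"
  have sw: "sa w" unfolding w_def by (intro sa_add sa_a sy)
  have wB: "w \<in> B" unfolding w_def by (intro sot_algebraD[OF B] a yB)
  have wz: "w (a \<xi> - y \<xi>) = 0" for \<xi>
    by (simp add: w_def blinfun.bilinear_simps a(3) ya)
  obtain K where K: "K \<in> B" "proj K" "\<And>\<xi>. K \<xi> = \<xi> \<longleftrightarrow> w \<xi> = 0"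
    using kernel_projection[OF B wB sw] by blast
  have Ke: "e (K \<xi>) = K (e \<xi>)" and Kx: "x (K \<xi>) = K (x \<xi>)" for \<xi>
    using K(1) by (auto simp: B_def commutant_def)
  define P where "P = K o\<^sub>L e"
  have P\<xi>: "P \<xi> = K (e \<xi>)" for \<xi> by (simp add: P_def)
  have "P \<in> A" unfolding P_def using K(1) eA by (auto simp: B_def intro: sot_algebraD[OF A])
  moreover have "cut e x t P"
    unfolding cut_def
  proof (intro conjI allI impI)
    show "proj P" unfolding proj_def
      using K(2) e Ke by (auto simp: P_def projD intro!: sa_compose)
    show "corner e P" by (simp add: corner_def P\<xi> Ke projD[OF e])
    show "P (x \<xi>) = x (P \<xi>)" for \<xi> by (simp add: P\<xi> ex Kx xe)
  next
    fix \<xi> assume P: "P \<xi> = \<xi>"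
    have e\<xi>: "e \<xi> = \<xi>" by (metis P P\<xi> Ke projD(2)[OF e])
    have "K \<xi> = \<xi>" using P by (simp add: P\<xi> e\<xi>)
    hence "a \<xi> + y \<xi> = 0" using K(3) by (simp add: w_def blinfun.bilinear_simps)
    hence "y \<xi> = - a \<xi>" by (simp add: eq_neg_iff_add_eq_0 add.commute)
    hence "ip (y \<xi>) \<xi> \<le> 0" using a(2) by (simp add: psd_def ip_simps)
    thus "ip (x \<xi>) \<xi> \<le> t * ip \<xi> \<xi>" by (simp add: y\<xi> e\<xi> ip_simps)
  next
    fix \<xi> assume e\<xi>: "e \<xi> = \<xi>" and "P \<xi> = 0" and nz: "\<xi> \<noteq> 0"
    hence K0: "K \<xi> = 0" by (simp add: P\<xi>)
    have "ip (a \<xi> - y \<xi>) \<eta> = 0" for \<eta>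
    proof -
      have "ip (a \<xi> - y \<xi>) \<eta> = ip \<xi> (a \<eta> - y \<eta>)" by (simp add: ip_simps saD[OF sa_a] saD[OF sy])
      also have "\<dots> = ip \<xi> (K (a \<eta> - y \<eta>))" by (simp only: iffD2[OF K(3) wz])
      also have "\<dots> = 0" using saD[OF projD(1)[OF K(2)], of \<xi>] K0 by (simp add: ip_simps)
      finally show ?thesis .
    qed
    from this[of "a \<xi> - y \<xi>"] have ay: "y \<xi> = a \<xi>" by (simp add: ip_self_eq_0)
    have "ip (a \<xi>) \<xi> \<noteq> 0"
    proof
      assume "ip (a \<xi>) \<xi> = 0"
      hence "a \<xi> = 0" by (rule psd_kernel[OF a(2)])
      hence "w \<xi> = 0" using ay by (simp add: w_def blinfun.bilinear_simps)
      hence "K \<xi> = \<xi>" by (rule iffD2[OF K(3)])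
      thus False using K0 nz by simp
    qed
    hence "ip (y \<xi>) \<xi> > 0" using a(2) ay by (simp add: psd_def less_le)
    thus "t * ip \<xi> \<xi> < ip (x \<xi>) \<xi>" by (simp add: y\<xi> e\<xi> ip_simps)
  qed
  ultimately show ?thesis by blast
qed

lemma some_cut_exists: "hermitian_in e x \<Longrightarrow> \<exists>P. cut e x t P"
  using cut_exists[of UNIV e x t] by (simp add: sot_algebra_def)

lemma hermitian_inD:
  assumes "hermitian_in e x"
  shows "proj e" "sa x" "corner e x" "e (x \<xi>) = x \<xi>" "x (e \<xi>) = x \<xi>"
  using assms by (auto simp: hermitian_in_def corner_def)

lemma corner_range: "corner e P \<Longrightarrow> P \<xi> = \<xi> \<Longrightarrow> e \<xi> = \<xi>"
  by (metis cornerD(1))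

lemma cut_order:
  assumes h: "hermitian_in e x" and P: "cut e x s P" and Q: "cut e x t Q"
    and comm: "\<And>\<xi>. P (Q \<xi>) = Q (P \<xi>)" and "s \<le> t" and "P \<xi> = \<xi>"
  shows "Q \<xi> = \<xi>"
proof (rule ccontr)
  assume ne: "Q \<xi> \<noteq> \<xi>"
  define \<eta> where "\<eta> = \<xi> - Q \<xi>"
  have nz: "\<eta> \<noteq> 0" using ne by (simp add: \<eta>_def)
  have P\<eta>: "P \<eta> = \<eta>" by (simp add: \<eta>_def blinfun.bilinear_simps comm \<open>P \<xi> = \<xi>\<close>)
  have "Q \<eta> = 0" by (simp add: \<eta>_def blinfun.bilinear_simps projD[OF cutD(1)[OF Q]])
  hence "t * ip \<eta> \<eta> < ip (x \<eta>) \<eta>" using cutD(5)[OF Q corner_range[OF cutD(2)[OF P] P\<eta>]] nz by blast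
  also have "\<dots> \<le> s * ip \<eta> \<eta>" by (rule cutD(4)[OF P P\<eta>])
  finally have "(t - s) * ip \<eta> \<eta> < 0" by (simp add: algebra_simps)
  thus False using \<open>s \<le> t\<close> ip_self_nonneg[of \<eta>] by (simp add: mult_less_0_iff)
qed

text \<open>A cut \<open>P0\<close> constructed inside \<open>A \<inter> commutant P\<close> commutes with \<open>P\<close>, and two commuting cuts at the same \<open>t\<close>
  agree by \<open>cut_order\<close>. This yields uniqueness and membership together.\<close>

lemma cut_in_algebra:
  assumes h: "hermitian_in e x" and P: "cut e x t P"
    and A: "sot_algebra A" "e \<in> A" "x \<in> A"
  shows "P \<in> A"
proof -
  have c: "e (P \<xi>) = P (e \<xi>)" for \<xi> using cutD(2)[OF P] by (simp add: cornerD)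
  have "e \<in> A \<inter> commutant P" "x \<in> A \<inter> commutant P"
    using A cutD(3)[OF P] c by (auto simp: commutant_def)
  then obtain P0 where P0: "P0 \<in> A \<inter> commutant P" "cut e x t P0"
    using cut_exists[OF sot_algebra_Int[OF A(1) sot_algebra_commutant] _ _ h] by blast
  hence comm: "P (P0 \<xi>) = P0 (P \<xi>)" for \<xi> by (simp add: commutant_def)
  have "P = P0"
  proof (rule proj_eqI[OF cutD(1)[OF P] cutD(1)[OF P0(2)]])
    show "P \<xi> = \<xi> \<longleftrightarrow> P0 \<xi> = \<xi>" for \<xi>
      using cut_order[OF h P P0(2) comm order_refl] cut_order[OF h P0(2) P comm[symmetric] order_refl]
      by blast
  qed
  thus ?thesis using P0 by simp
qed

lemma cut_commutes:
  assumes h: "hermitian_in e x" and P: "cut e x s P" and Q: "cut e x t Q"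
  shows "P (Q \<xi>) = Q (P \<xi>)"
proof -
  have c: "Q (e \<xi>) = e (Q \<xi>)" for \<xi> using cutD(2)[OF Q] by (simp add: cornerD)
  have "P \<in> commutant Q"
    by (rule cut_in_algebra[OF h P sot_algebra_commutant]) (simp_all add: commutant_def c cutD(3)[OF Q])
  thus ?thesis by (simp add: commutant_def)
qed

lemma cut_mono:
  assumes "hermitian_in e x" "cut e x s P" "cut e x t Q" "s \<le> t" "P \<xi> = \<xi>"
  shows "Q \<xi> = \<xi>"
  using cut_order[OF assms(1-3) cut_commutes[OF assms(1-3)] assms(4,5)] .

lemma cut_unique:
  assumes "hermitian_in e x" "cut e x t P" "cut e x t Q"
  shows "P = Q"
proof (rule proj_eqI[OF cutD(1)[OF assms(2)] cutD(1)[OF assms(3)]])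
  show "P \<xi> = \<xi> \<longleftrightarrow> Q \<xi> = \<xi>" for \<xi>
    using cut_mono[OF assms order_refl] cut_mono[OF assms(1,3,2) order_refl] by blast
qed

lemma cut_right_continuous:
  assumes h: "hermitian_in e x" and P: "cut e x t P"
    and Q: "\<And>u. t < u \<Longrightarrow> cut e x u (Q u)" and "\<And>u. t < u \<Longrightarrow> Q u \<xi> = \<xi>"
  shows "P \<xi> = \<xi>"
proof (rule ccontr)
  assume ne: "P \<xi> \<noteq> \<xi>"
  define \<eta> where "\<eta> = \<xi> - P \<xi>"
  have nz: "\<eta> \<noteq> 0" using ne by (simp add: \<eta>_def)
  have Q\<eta>: "Q u \<eta> = \<eta>" if "t < u" for u
    by (simp add: \<eta>_def blinfun.bilinear_simps cut_commutes[OF h Q[OF that] P] assms(4)[OF that])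
  have e\<eta>: "e \<eta> = \<eta>"
    using corner_range[OF cutD(2)[OF Q] Q\<eta>, of "t + 1"] by simp
  have P\<eta>: "P \<eta> = 0" by (simp add: \<eta>_def blinfun.bilinear_simps projD[OF cutD(1)[OF P]])
  have "t * ip \<eta> \<eta> < ip (x \<eta>) \<eta>" by (rule cutD(5)[OF P e\<eta> P\<eta> nz])
  moreover have "ip (x \<eta>) \<eta> / ip \<eta> \<eta> \<le> t"
  proof (rule field_le_epsilon)
    fix d :: real assume "0 < d"
    hence "t < t + d" by simp
    from cutD(4)[OF Q[OF this] Q\<eta>[OF this]] show "ip (x \<eta>) \<eta> / ip \<eta> \<eta> \<le> t + d"
      using ip_self_pos[OF nz] by (simp add: divide_le_eq)
  qed
  ultimately show False using ip_self_pos[OF nz] by (simp add: divide_le_eq)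
qed

lemma ip_apply_bound:
  fixes x :: "'h::chilbert_space op"
  shows "\<bar>ip (x \<xi>) \<xi>\<bar> \<le> norm x * ip \<xi> \<xi>"
proof -
  have "\<bar>ip (x \<xi>) \<xi>\<bar> \<le> norm (x \<xi>) * norm \<xi>" by (rule ip_cauchy_schwarz)
  also have "\<dots> \<le> norm x * norm \<xi> * norm \<xi>" by (intro mult_right_mono norm_blinfun norm_ge_zero)
  finally show ?thesis by (simp add: ip_self power2_eq_square)
qed

lemma cut_bot:
  assumes P: "cut e x t P" and "t < - norm x"
  shows "P = 0"
proof (rule blinfun_eqI)
  fix \<xi>
  have "P (P \<xi>) = P \<xi>" by (rule projD[OF cutD(1)[OF P]])
  from cutD(4)[OF P this] have "- norm x * ip (P \<xi>) (P \<xi>) \<le> t * ip (P \<xi>) (P \<xi>)"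
    using ip_apply_bound[of x "P \<xi>"] by linarith
  hence "(- norm x - t) * ip (P \<xi>) (P \<xi>) \<le> 0" by (simp add: algebra_simps)
  hence "ip (P \<xi>) (P \<xi>) \<le> 0" using assms(2) by (simp add: mult_le_0_iff)
  thus "P \<xi> = blinfun_apply 0 \<xi>" using ip_self_pos[of "P \<xi>"] by force
qed

lemma cut_top:
  assumes e: "proj e" and P: "cut e x t P" and "\<And>\<xi>. e \<xi> = \<xi> \<Longrightarrow> ip (x \<xi>) \<xi> \<le> t * ip \<xi> \<xi>"
  shows "P = e"
proof (rule blinfun_eqI)
  fix \<xi>
  define \<eta> where "\<eta> = e \<xi> - P \<xi>"
  have "e \<eta> = \<eta>" "P \<eta> = 0"
    using cutD(1,2)[OF P] e by (simp_all add: \<eta>_def blinfun.bilinear_simps projD cornerD)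
  hence "\<eta> = 0" using cutD(5)[OF P, of \<eta>] assms(3)[of \<eta>] by fastforce
  thus "P \<xi> = e \<xi>" by (simp add: \<eta>_def)
qed

lemma cut_top_norm: "proj e \<Longrightarrow> cut e x t P \<Longrightarrow> norm x \<le> t \<Longrightarrow> P = e"
  by (erule cut_top, assumption)
    (meson abs_le_D1 ip_apply_bound ip_self_nonneg mult_right_mono order_trans)

lemma proj_order:
  assumes P: "proj P" and Q: "proj Q" and le: "\<And>\<xi>. P \<xi> = \<xi> \<Longrightarrow> Q \<xi> = \<xi>"
  shows "Q (P \<xi>) = P \<xi>" "P (Q \<xi>) = P \<xi>"
proof -
  show QP: "Q (P \<xi>) = P \<xi>" for \<xi> by (rule le) (rule projD[OF P])
  have "ip (P (Q \<xi>) - P \<xi>) \<eta> = 0" for \<eta>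
    using projD[OF P] projD[OF Q] by (simp add: saD ip_simps QP)
  from this[of "P (Q \<xi>) - P \<xi>"] show "P (Q \<xi>) = P \<xi>" by (simp add: ip_self_eq_0)
qed

lemma proj_diff:
  assumes P: "proj P" and Q: "proj Q" and le: "\<And>\<xi>. P \<xi> = \<xi> \<Longrightarrow> Q \<xi> = \<xi>"
  shows "proj (Q - P)"
  using proj_order[OF assms] projD[OF P] projD[OF Q]
  by (simp add: proj_def sa_diff blinfun.bilinear_simps)

section \<open>The operator with a given spectral resolution\<close>

text \<open>Right continuity is expressed through the ranges; \<open>resolution_right_limit\<close> shows that it amounts to
  strong right continuity.\<close>

definition resolution :: "'h::chilbert_space op \<Rightarrow> (real \<Rightarrow> 'h op) \<Rightarrow> bool" where
  "resolution e G \<longleftrightarrow> proj e \<and> (\<forall>t. proj (G t) \<and> corner e (G t)) \<and>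
     (\<forall>s t \<xi>. s \<le> t \<longrightarrow> G s \<xi> = \<xi> \<longrightarrow> G t \<xi> = \<xi>) \<and>
     (\<forall>t \<xi>. (\<forall>u>t. G u \<xi> = \<xi>) \<longrightarrow> G t \<xi> = \<xi>)"

lemma resolutionD:
  assumes "resolution e G"
  shows "proj e" "proj (G t)" "corner e (G t)" "s \<le> t \<Longrightarrow> G s \<xi> = \<xi> \<Longrightarrow> G t \<xi> = \<xi>"
    "(\<And>u. t < u \<Longrightarrow> G u \<xi> = \<xi>) \<Longrightarrow> G t \<xi> = \<xi>"
  using assms unfolding resolution_def by blast+

lemma resolution_cuts:
  assumes h: "hermitian_in e x" and G: "\<And>t. cut e x t (G t)"
  shows "resolution e G"
  unfolding resolution_def
proof (intro conjI allI impI)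
  show "G t \<xi> = \<xi>" if "s \<le> t" "G s \<xi> = \<xi>" for s t \<xi> using cut_mono[OF h G G that] .
  show "G t \<xi> = \<xi>" if "\<forall>u>t. G u \<xi> = \<xi>" for t \<xi> using cut_right_continuous[OF h G G] that by blast
qed (use cutD[OF G] hermitian_inD[OF h] in auto)

lemma resolution_compose:
  assumes R: "resolution e G" and "s \<le> t"
  shows "G t (G s \<xi>) = G s \<xi>" "G s (G t \<xi>) = G s \<xi>"
  using proj_order[OF resolutionD(2)[OF R] resolutionD(2)[OF R] resolutionD(4)[OF R \<open>s \<le> t\<close>]] by auto

lemma resolution_commutes:
  assumes R: "resolution e G" shows "G t (G s \<xi>) = G s (G t \<xi>)"
  using resolution_compose[OF R, of s t \<xi>] resolution_compose[OF R, of t s \<xi>] by (cases "s \<le> t") auto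

text \<open>The lower Riemann--Stieltjes sum of \<open>\<integral>\<^sub>(\<^sub>a\<^sub>,\<^sub>b\<^sub>] t dG\<^sub>t\<close> over \<open>2\<^sup>n\<close> subintervals of equal length. Its
  recursive form turns every estimate below into an induction whose step is an addition.\<close>

primrec riemann_sum :: "(real \<Rightarrow> 'h::chilbert_space op) \<Rightarrow> nat \<Rightarrow> real \<Rightarrow> real \<Rightarrow> 'h op" where
  "riemann_sum G 0 a b = a *\<^sub>R (G b - G a)"
| "riemann_sum G (Suc n) a b = riemann_sum G n a ((a + b) / 2) + riemann_sum G n ((a + b) / 2) b"

definition increment :: "(real \<Rightarrow> 'h::chilbert_space op) \<Rightarrow> real \<Rightarrow> real \<Rightarrow> 'h \<Rightarrow> real" where
  "increment G a b \<xi> = ip (G b \<xi>) \<xi> - ip (G a \<xi>) \<xi>"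

lemma increment_nonneg:
  assumes R: "resolution e G" and "a \<le> b"
  shows "0 \<le> increment G a b \<xi>"
proof -
  have "norm (G a \<xi>) = norm (G a (G b \<xi>))" using resolution_compose[OF assms] by simp
  also have "\<dots> \<le> norm (G b \<xi>)" by (rule proj_norm_le[OF resolutionD(2)[OF R]])
  finally have "(norm (G a \<xi>))\<^sup>2 \<le> (norm (G b \<xi>))\<^sup>2" by (simp add: power_mono)
  thus ?thesis by (simp add: increment_def proj_ip resolutionD(2)[OF R])
qed

lemma increment_le:
  assumes R: "resolution e G"
  shows "increment G a b \<xi> \<le> ip \<xi> \<xi>"
proof -
  have "(norm (G b \<xi>))\<^sup>2 \<le> (norm \<xi>)\<^sup>2"
    by (rule power_mono[OF proj_norm_le[OF resolutionD(2)[OF R]] norm_ge_zero])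
  moreover have "0 \<le> (norm (G a \<xi>))\<^sup>2" by (rule zero_le_power2)
  ultimately show ?thesis
    by (simp only: increment_def proj_ip[OF resolutionD(2)[OF R]] ip_self)
qed

lemma riemann_sum_in_algebra:
  "sot_algebra A \<Longrightarrow> (\<And>t. G t \<in> A) \<Longrightarrow> riemann_sum G n a b \<in> A"
  by (induction n arbitrary: a b) (auto intro: sot_algebraD sot_algebra_diff)

lemma sa_riemann_sum: "(\<And>t. sa (G t)) \<Longrightarrow> sa (riemann_sum G n a b)"
  by (induction n arbitrary: a b) (auto intro: sa_add sa_scaleR sa_diff)

lemma corner_riemann_sum:
  "(\<And>t. corner e (G t)) \<Longrightarrow> corner e (riemann_sum G n a b)"
  by (induction n arbitrary: a b) (auto simp: corner_def blinfun.bilinear_simps)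

lemma riemann_sum_refine:
  assumes R: "resolution e G" and "a \<le> b"
  shows "0 \<le> ip ((riemann_sum G (Suc n) a b - riemann_sum G n a b) \<xi>) \<xi> \<and>
    ip ((riemann_sum G (Suc n) a b - riemann_sum G n a b) \<xi>) \<xi> \<le> (b - a) / 2 ^ Suc n * increment G a b \<xi>"
  using \<open>a \<le> b\<close>
proof (induction n arbitrary: a b)
  case 0
  define m where "m = (a + b) / 2"
  have m: "a \<le> m" "m \<le> b" "m - a = (b - a) / 2" using 0 by (auto simp: m_def field_simps)
  have D: "ip ((riemann_sum G (Suc 0) a b - riemann_sum G 0 a b) \<xi>) \<xi> = (m - a) * increment G m b \<xi>"
    by (simp add: m_def[symmetric] increment_def blinfun.bilinear_simps ip_simps algebra_simps)
  have "increment G m b \<xi> \<le> increment G a b \<xi>"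
    using increment_nonneg[OF R m(1), of \<xi>] by (simp add: increment_def)
  moreover have "(b - a) / 2 ^ Suc 0 = m - a" using m(3) by simp
  ultimately show ?case
    unfolding D using increment_nonneg[OF R m(2), of \<xi>] m(1) by (simp only: mult_left_mono mult_nonneg_nonneg diff_ge_0_iff_ge simp_thms)
next
  case (Suc n)
  define m where "m = (a + b) / 2"
  have m: "a \<le> m" "m \<le> b" using Suc.prems by (auto simp: m_def field_simps)
  have l: "m - a = (b - a) / 2" "b - m = (b - a) / 2" by (auto simp: m_def field_simps)
  define D where "D = (\<lambda>n a b. ip ((riemann_sum G (Suc n) a b - riemann_sum G n a b) \<xi>) \<xi>)"
  have "D (Suc n) a b = D n a m + D n m b"
    by (simp add: D_def m_def blinfun.bilinear_simps ip_simps)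
  moreover have "increment G a b \<xi> = increment G a m \<xi> + increment G m b \<xi>" by (simp add: increment_def)
  moreover have "0 \<le> D n a m \<and> D n a m \<le> (b - a) / 2 / 2 ^ Suc n * increment G a m \<xi>"
    using Suc.IH[OF m(1)] unfolding D_def l .
  moreover have "0 \<le> D n m b \<and> D n m b \<le> (b - a) / 2 / 2 ^ Suc n * increment G m b \<xi>"
    using Suc.IH[OF m(2)] unfolding D_def l .
  ultimately have "0 \<le> D (Suc n) a b \<and> D (Suc n) a b \<le> (b - a) / 2 / 2 ^ Suc n * increment G a b \<xi>"
    by (simp only: distrib_left) linarith
  thus ?case by (simp add: D_def)
qed

lemma riemann_sum_upper:
  assumes R: "resolution e G" and \<xi>: "G t \<xi> = \<xi>" and "a \<le> b"
  shows "ip (riemann_sum G n a b \<xi>) \<xi> \<le> t * increment G a b \<xi>"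
  using \<open>a \<le> b\<close>
proof (induction n arbitrary: a b)
  case 0
  show ?case
  proof (cases "a \<le> t")
    case True
    thus ?thesis using increment_nonneg[OF R 0, of \<xi>]
      by (simp add: increment_def blinfun.bilinear_simps ip_simps mult_right_mono flip: right_diff_distrib)
  next
    case False
    hence "G a \<xi> = \<xi>" "G b \<xi> = \<xi>" using resolutionD(4)[OF R _ \<xi>] 0 by auto
    thus ?thesis by (simp add: increment_def blinfun.bilinear_simps ip_simps)
  qed
next
  case (Suc n)
  have "a \<le> (a + b) / 2" "(a + b) / 2 \<le> b" using Suc.prems by auto
  from Suc.IH[OF this(1)] Suc.IH[OF this(2)] show ?case
    by (simp add: increment_def blinfun.bilinear_simps ip_simps algebra_simps)
qed

lemma riemann_sum_lower:
  assumes R: "resolution e G" and \<xi>: "G t \<xi> = 0" and "a \<le> b"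
  shows "(t - (b - a) / 2 ^ n) * increment G a b \<xi> \<le> ip (riemann_sum G n a b \<xi>) \<xi>"
  using \<open>a \<le> b\<close>
proof (induction n arbitrary: a b)
  case 0
  show ?case
  proof (cases "t \<le> b")
    case True
    thus ?thesis using increment_nonneg[OF R 0, of \<xi>]
      by (simp add: increment_def blinfun.bilinear_simps ip_simps mult_right_mono flip: right_diff_distrib)
  next
    case False
    have "G s \<xi> = 0" if "s \<le> t" for s
      using resolution_compose(2)[OF R that, of \<xi>] by (simp add: \<xi> blinfun.zero_right)
    hence "G a \<xi> = 0" "G b \<xi> = 0" using False 0 by auto
    thus ?thesis by (simp add: increment_def blinfun.bilinear_simps ip_simps)
  qed
next
  case (Suc n)
  define m where "m = (a + b) / 2"
  have m: "a \<le> m" "m \<le> b" using Suc.prems by (auto simp: m_def field_simps)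
  have l: "m - a = (b - a) / 2" "b - m = (b - a) / 2" by (auto simp: m_def field_simps)
  have "(t - (b - a) / 2 / 2 ^ n) * increment G a m \<xi> + (t - (b - a) / 2 / 2 ^ n) * increment G m b \<xi>
      \<le> ip (riemann_sum G n a m \<xi>) \<xi> + ip (riemann_sum G n m b \<xi>) \<xi>"
    using Suc.IH[OF m(1)] Suc.IH[OF m(2)] unfolding l by (rule add_mono)
  thus ?case
    by (simp add: m_def[symmetric] increment_def blinfun.bilinear_simps ip_simps flip: distrib_left)
qed

text \<open>The lower sums converge in norm by \<open>riemann_sum_refine\<close>. Their bounds on the ranges of
  \<open>G t\<close> and \<open>e - G t\<close> survive in the limit as weak inequalities; right continuity of \<open>G\<close> makes the
  second one strict.\<close>

lemma operator_of_resolution: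
  fixes G :: "real \<Rightarrow> 'h::chilbert_space op"
  assumes R: "resolution e G" and a: "G a = 0" and b: "G b = e" and "a \<le> b"
  shows "\<exists>s. hermitian_in e s \<and> (\<forall>t. cut e s t (G t)) \<and>
    (\<forall>A. sot_algebra A \<longrightarrow> (\<forall>t. G t \<in> A) \<longrightarrow> s \<in> A)"
proof -
  define S where "S = (\<lambda>n. riemann_sum G n a b)"
  have saS: "sa (S n)" for n unfolding S_def by (rule sa_riemann_sum) (intro projD resolutionD(2)[OF R])
  have inc1: "increment G a b \<xi> \<le> ip \<xi> \<xi>" for \<xi> by (rule increment_le[OF R])
  have nS: "norm (S (Suc n) - S n) \<le> (b - a) * (1/2) ^ n" for n
  proof (rule norm_blinfun_bound)
    fix \<xi>
    have "\<bar>ip ((S (Suc n) - S n) \<eta>) \<eta>\<bar> \<le> (b - a) * (1/2) ^ n * ip \<eta> \<eta>" for \<eta>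
    proof -
      have "\<bar>ip ((S (Suc n) - S n) \<eta>) \<eta>\<bar> \<le> (b - a) / 2 ^ Suc n * increment G a b \<eta>"
        using riemann_sum_refine[OF R \<open>a \<le> b\<close>, of n \<eta>] unfolding S_def by linarith
      also have "\<dots> \<le> (b - a) / 2 ^ n * ip \<eta> \<eta>"
        using \<open>a \<le> b\<close> increment_nonneg[OF R \<open>a \<le> b\<close>] inc1
        by (intro mult_mono divide_left_mono) (auto simp: ip_self_nonneg)
      finally show ?thesis by (simp add: power_divide)
    qed
    from sa_norm_le[OF sa_diff[OF saS saS] this]
    show "norm ((S (Suc n) - S n) \<xi>) \<le> (b - a) * (1/2) ^ n * norm \<xi>" .
  qed (use \<open>a \<le> b\<close> in simp)
  have "summable (\<lambda>n. S (Suc n) - S n)"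
    by (rule summable_comparison_test'[where g = "\<lambda>n. (b - a) * (1/2) ^ n" and N = 0])
      (use nS in \<open>auto intro!: summable_mult summable_geometric\<close>)
  then obtain d where "(\<lambda>n. \<Sum>k<n. S (Suc k) - S k) \<longlonglongrightarrow> d"
    using summable_def sums_def by blast
  hence "(\<lambda>n. S n - S 0) \<longlonglongrightarrow> d" by (simp only: sum_lessThan_telescope)
  from tendsto_add[OF this tendsto_const[of "S 0"]] obtain s where s: "S \<longlonglongrightarrow> s" by auto
  have lim: "(\<lambda>n. S n \<xi>) \<longlonglongrightarrow> s \<xi>" for \<xi> by (intro blinfun.tendsto s tendsto_const)
  have sA: "s \<in> A" if "sot_algebra A" "\<And>t. G t \<in> A" for A
    by (rule sot_algebra_norm_limit[OF that(1) _ s])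
      (unfold S_def, rule riemann_sum_in_algebra[OF that])
  have sas: "sa s" by (rule sa_strong_limit[OF sequentially_bot saS lim])
  have cS: "corner e (S n)" for n unfolding S_def by (rule corner_riemann_sum[OF resolutionD(3)[OF R]])
  have "corner e s" unfolding corner_def
  proof (intro allI conjI)
    fix \<xi>
    have "(\<lambda>n. e (S n \<xi>)) \<longlonglongrightarrow> e (s \<xi>)" by (intro blinfun.tendsto lim tendsto_const)
    hence "(\<lambda>n. S n \<xi>) \<longlonglongrightarrow> e (s \<xi>)" by (simp add: cornerD[OF cS])
    thus "e (s \<xi>) = s \<xi>" using lim LIMSEQ_unique by blast
    have "(\<lambda>n. S n \<xi>) \<longlonglongrightarrow> s (e \<xi>)" using lim[of "e \<xi>"] by (simp add: cornerD[OF cS])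
    thus "s (e \<xi>) = s \<xi>" using lim LIMSEQ_unique by blast
  qed
  hence h: "hermitian_in e s" using sas resolutionD(1)[OF R] by (simp add: hermitian_in_def)
  have inc_e: "increment G a b \<xi> = ip \<xi> \<xi>" if "e \<xi> = \<xi>" for \<xi>
    using that by (simp add: increment_def a b ip_simps)
  have up: "ip (s \<xi>) \<xi> \<le> t * ip \<xi> \<xi>" if "G t \<xi> = \<xi>" for t \<xi>
  proof (rule LIMSEQ_le_const2)
    show "(\<lambda>n. ip (S n \<xi>) \<xi>) \<longlonglongrightarrow> ip (s \<xi>) \<xi>" by (intro ip.tendsto lim tendsto_const)
    show "\<exists>N. \<forall>n\<ge>N. ip (S n \<xi>) \<xi> \<le> t * ip \<xi> \<xi>"
      using riemann_sum_upper[OF R that \<open>a \<le> b\<close>] inc_e[OF corner_range[OF resolutionD(3)[OF R] that]]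
      by (simp add: S_def)
  qed
  have low: "t * ip \<xi> \<xi> \<le> ip (s \<xi>) \<xi>" if "e \<xi> = \<xi>" "G t \<xi> = 0" for t \<xi>
  proof (rule LIMSEQ_le)
    show "(\<lambda>n. ip (S n \<xi>) \<xi>) \<longlonglongrightarrow> ip (s \<xi>) \<xi>" by (intro ip.tendsto lim tendsto_const)
    have "(\<lambda>n. (t - (b - a) * (1/2) ^ n) * ip \<xi> \<xi>) \<longlonglongrightarrow> (t - (b - a) * 0) * ip \<xi> \<xi>"
      by (intro tendsto_intros LIMSEQ_realpow_zero) auto
    thus "(\<lambda>n. (t - (b - a) / 2 ^ n) * ip \<xi> \<xi>) \<longlonglongrightarrow> t * ip \<xi> \<xi>" by (simp add: power_divide)
    show "\<exists>N. \<forall>n\<ge>N. (t - (b - a) / 2 ^ n) * ip \<xi> \<xi> \<le> ip (S n \<xi>) \<xi>"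
      using riemann_sum_lower[OF R that(2) \<open>a \<le> b\<close>] inc_e[OF that(1)] by (simp add: S_def)
  qed
  have comm: "G t (s \<xi>) = s (G t \<xi>)" for t \<xi>
  proof -
    have "s \<in> commutant (G t)"
      by (rule sA[OF sot_algebra_commutant]) (simp add: commutant_def resolution_commutes[OF R])
    thus ?thesis by (simp add: commutant_def)
  qed
  have strict: "t * ip \<xi> \<xi> < ip (s \<xi>) \<xi>" if \<xi>: "e \<xi> = \<xi>" "G t \<xi> = 0" "\<xi> \<noteq> 0" for t \<xi>
  proof -
    \<comment> \<open>some mass of \<open>\<xi>\<close> lies above a point \<open>u > t\<close>, and there the weak bound gives \<open>u\<close> instead of \<open>t\<close>\<close>
    obtain u where u: "t < u" "G u \<xi> \<noteq> \<xi>" using resolutionD(5)[OF R, of t \<xi>] \<xi> by auto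
    define \<eta> \<zeta> where "\<eta> = \<xi> - G u \<xi>" and "\<zeta> = G u \<xi>"
    have \<eta>: "e \<eta> = \<eta>" "G u \<eta> = 0" "\<eta> \<noteq> 0"
      using \<xi> u projD[OF resolutionD(2)[OF R]] by (simp_all add: \<eta>_def blinfun.bilinear_simps cornerD[OF resolutionD(3)[OF R]])
    have \<zeta>: "e \<zeta> = \<zeta>" "G t \<zeta> = 0"
      using \<xi> u by (simp_all add: \<zeta>_def cornerD[OF resolutionD(3)[OF R]] resolution_compose[OF R])
    have x: "ip (s \<zeta>) \<eta> = 0" "ip \<zeta> \<eta> = 0"
      using saD[OF projD(1)[OF resolutionD(2)[OF R, of u]], of _ \<eta>] \<eta>(2)
      by (simp_all add: \<zeta>_def comm[symmetric] ip_simps)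
    hence x': "ip (s \<eta>) \<zeta> = 0" "ip \<eta> \<zeta> = 0" using saD[OF sas] ip_commute by metis+
    have \<xi>eq: "\<xi> = \<eta> + \<zeta>" by (simp add: \<eta>_def \<zeta>_def)
    have "t * ip \<xi> \<xi> = t * ip \<eta> \<eta> + t * ip \<zeta> \<zeta>"
      unfolding \<xi>eq using x x' by (simp add: ip_simps algebra_simps)
    also have "\<dots> < u * ip \<eta> \<eta> + t * ip \<zeta> \<zeta>" using u ip_self_pos[OF \<eta>(3)] by simp
    also have "\<dots> \<le> ip (s \<eta>) \<eta> + ip (s \<zeta>) \<zeta>" using low[OF \<eta>(1,2)] low[OF \<zeta>] by simp
    also have "\<dots> = ip (s \<xi>) \<xi>"
      unfolding \<xi>eq using x x' by (simp add: ip_simps blinfun.bilinear_simps)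
    finally show ?thesis .
  qed
  have "cut e s t (G t)" for t
    unfolding cut_def by (intro conjI allI impI resolutionD(2,3)[OF R] comm up strict)
  thus ?thesis using h sA by blast
qed

section \<open>Strong convergence from convergence of cuts\<close>

lemma cut_band_norm:
  assumes h: "hermitian_in e x" and P: "cut e x \<alpha> P" and Q: "cut e x \<beta> Q" and "\<alpha> \<le> \<beta>"
    and \<xi>: "Q \<xi> = \<xi>" "P \<xi> = 0"
  shows "norm (x \<xi> - \<alpha> *\<^sub>R \<xi>) \<le> (\<beta> - \<alpha>) * norm \<xi>"
proof (rule sa_norm_le_on_range)
  have le: "\<And>\<eta>. P \<eta> = \<eta> \<Longrightarrow> Q \<eta> = \<eta>" by (rule cut_mono[OF h P Q \<open>\<alpha> \<le> \<beta>\<close>])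
  note PQ = proj_order[OF cutD(1)[OF P] cutD(1)[OF Q] le]
  show "sa x" by (rule hermitian_inD(2)[OF h])
  show "proj (Q - P)" by (rule proj_diff[OF cutD(1)[OF P] cutD(1)[OF Q] le])
  show "(Q - P) (x \<eta>) = x ((Q - P) \<eta>)" for \<eta>
    by (simp add: blinfun.bilinear_simps cutD(3)[OF P] cutD(3)[OF Q])
  show "(Q - P) \<xi> = \<xi>" using \<xi> by (simp add: blinfun.bilinear_simps)
  show "\<bar>ip (x \<eta>) \<eta> - \<alpha> * ip \<eta> \<eta>\<bar> \<le> (\<beta> - \<alpha>) * ip \<eta> \<eta>" if "(Q - P) \<eta> = \<eta>" for \<eta>
  proof -
    have eq: "Q \<eta> - P \<eta> = \<eta>" using that by (simp add: blinfun.bilinear_simps)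
    have "Q (Q \<eta> - P \<eta>) = Q \<eta> - P \<eta>"
      by (simp add: blinfun.diff_right projD(2)[OF cutD(1)[OF Q]] PQ)
    hence Q\<eta>: "Q \<eta> = \<eta>" unfolding eq .
    have P\<eta>: "P \<eta> = 0" using eq Q\<eta> by simp
    have e\<eta>: "e \<eta> = \<eta>" by (rule corner_range[OF cutD(2)[OF Q] Q\<eta>])
    have "\<alpha> * ip \<eta> \<eta> \<le> ip (x \<eta>) \<eta>"
      using cutD(5)[OF P e\<eta> P\<eta>] by (cases "\<eta> = 0") (auto simp: blinfun.bilinear_simps ip_simps)
    moreover have "ip (x \<eta>) \<eta> \<le> \<beta> * ip \<eta> \<eta>" by (rule cutD(4)[OF Q Q\<eta>])
    ultimately show ?thesis by (simp add: left_diff_distrib)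
  qed
qed (use \<open>\<alpha> \<le> \<beta>\<close> in simp)

text \<open>On the spectral band of \<open>a\<close> for \<open>(\<alpha>, \<beta>]\<close> both \<open>a\<close> and, asymptotically, \<open>T i\<close> act like
  multiplication by \<open>\<alpha>\<close> up to a multiple of the band width. Bisecting the band halves the width,
  while the norms of the two orthogonal parts of a vector add up to at most \<open>\<surd>2\<close> times its norm. So the
  bound improves by a factor \<open>\<surd>2\<close> with each bisection.\<close>

lemma cut_convergence:
  fixes T :: "'i \<Rightarrow> 'h::chilbert_space op"
  assumes a: "hermitian_in e a" and P: "\<And>t. cut e a t (P t)"
    and T: "eventually (\<lambda>i. hermitian_in e (T i) \<and> (\<forall>t. cut e (T i) t (Q i t)) \<and>
      (\<forall>\<xi>. norm (T i \<xi>) \<le> K * norm \<xi>)) F"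
    and stable: "\<And>\<alpha> \<beta> \<xi>. \<alpha> < \<beta> \<Longrightarrow> P \<alpha> \<xi> = \<xi> \<Longrightarrow> ((\<lambda>i. Q i \<beta> \<xi>) \<longlongrightarrow> \<xi>) F"
    and vanish: "\<And>\<alpha> \<beta> \<xi>. \<alpha> < \<beta> \<Longrightarrow> e \<xi> = \<xi> \<Longrightarrow> P \<beta> \<xi> = 0 \<Longrightarrow> ((\<lambda>i. Q i \<alpha> \<xi>) \<longlongrightarrow> 0) F"
  shows "((\<lambda>i. T i \<xi>) \<longlongrightarrow> a \<xi>) F"
proof -
  note pP = cutD(1)[OF P] and eP = cutD(2)[OF P]
  have R: "resolution e P" by (rule resolution_cuts[OF a P])
  have base: "eventually (\<lambda>i. norm (T i \<xi> - a \<xi>) \<le> 5 * (\<beta> - \<alpha>) * norm \<xi> + \<epsilon>) F"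
    if ab: "\<alpha> < \<beta>" and \<xi>: "P \<beta> \<xi> = \<xi>" "P \<alpha> \<xi> = 0" and "\<epsilon> > 0" for \<alpha> \<beta> \<xi> \<epsilon>
  proof -
    define h where "h = \<beta> - \<alpha>"
    have h: "h > 0" using ab by (simp add: h_def)
    define z where "z = (\<lambda>i. Q i (\<beta> + h) \<xi> - Q i (\<alpha> - h) \<xi>)"
    have "((\<lambda>i. z i) \<longlongrightarrow> \<xi> - 0) F"
      unfolding z_def
      by (intro tendsto_diff stable[of \<beta>] vanish[of _ \<alpha>] \<xi> corner_range[OF eP \<xi>(1)]) (use h in auto)
    hence z: "(z \<longlongrightarrow> \<xi>) F" by simp
    define g where "g = (\<lambda>i. 3 * h * norm (z i) + (K + \<bar>\<alpha> - h\<bar>) * norm (\<xi> - z i) + 2 * h * norm \<xi>)"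
    have "(g \<longlongrightarrow> 3 * h * norm \<xi> + (K + \<bar>\<alpha> - h\<bar>) * norm (\<xi> - \<xi>) + 2 * h * norm \<xi>) F"
      unfolding g_def by (intro tendsto_intros z)
    hence "(g \<longlongrightarrow> 5 * h * norm \<xi>) F" by (simp add: algebra_simps)
    from order_tendstoD(2)[OF this, of "5 * h * norm \<xi> + \<epsilon>"] \<open>\<epsilon> > 0\<close>
    have "eventually (\<lambda>i. g i < 5 * h * norm \<xi> + \<epsilon>) F" by simp
    with T show ?thesis
    proof eventually_elim
      case (elim i)
      hence hi: "hermitian_in e (T i)" and Qi: "\<And>t. cut e (T i) t (Q i t)"
        and K: "\<And>\<xi>. norm (T i \<xi>) \<le> K * norm \<xi>" by auto
      have Ri: "resolution e (Q i)" by (rule resolution_cuts[OF hi Qi])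
      have le: "\<alpha> - h \<le> \<beta> + h" using h ab by simp
      have z1: "Q i (\<beta> + h) (z i) = z i" "Q i (\<alpha> - h) (z i) = 0"
        using resolution_compose[OF Ri le] projD(2)[OF resolutionD(2)[OF Ri]]
        by (simp_all add: z_def blinfun.diff_right)
      have "norm (T i (z i) - (\<alpha> - h) *\<^sub>R z i) \<le> ((\<beta> + h) - (\<alpha> - h)) * norm (z i)"
        by (rule cut_band_norm[OF hi Qi Qi le z1])
      hence 1: "norm (T i (z i) - (\<alpha> - h) *\<^sub>R z i) \<le> 3 * h * norm (z i)"
        by (simp add: h_def)
      have 2: "norm (T i (\<xi> - z i)) \<le> K * norm (\<xi> - z i)" by (rule K)
      have "norm (a \<xi> - \<alpha> *\<^sub>R \<xi>) \<le> (\<beta> - \<alpha>) * norm \<xi>"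
        by (rule cut_band_norm[OF a P P _ \<xi>]) (use ab in simp)
      hence 3: "norm (a \<xi> - \<alpha> *\<^sub>R \<xi>) \<le> h * norm \<xi>" by (simp add: h_def)
      have "T i \<xi> - a \<xi> = (T i (z i) - (\<alpha> - h) *\<^sub>R z i) + T i (\<xi> - z i)
          - (\<alpha> - h) *\<^sub>R (\<xi> - z i) - (a \<xi> - \<alpha> *\<^sub>R \<xi>) - h *\<^sub>R \<xi>"
        by (simp add: blinfun.diff_right algebra_simps)
      also have "norm \<dots> \<le> norm (T i (z i) - (\<alpha> - h) *\<^sub>R z i) + norm (T i (\<xi> - z i))
          + norm ((\<alpha> - h) *\<^sub>R (\<xi> - z i)) + norm (a \<xi> - \<alpha> *\<^sub>R \<xi>) + norm (h *\<^sub>R \<xi>)"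
        by (intro order_trans[OF norm_triangle_ineq4] add_mono norm_triangle_ineq order_refl)
      also have "\<dots> \<le> g i"
        using 1 2 3 h unfolding g_def distrib_right norm_scaleR by simp
      finally show ?case using elim(2) by (simp add: h_def)
    qed
  qed
  have bisect: "eventually (\<lambda>i. norm (T i \<xi> - a \<xi>) \<le> 5 * (\<beta> - \<alpha>) / sqrt 2 ^ n * norm \<xi> + \<epsilon>) F"
    if "\<alpha> < \<beta>" "P \<beta> \<xi> = \<xi>" "P \<alpha> \<xi> = 0" "\<epsilon> > 0" for \<alpha> \<beta> \<xi> \<epsilon> n
    using that
  proof (induction n arbitrary: \<alpha> \<beta> \<xi> \<epsilon>)
    case 0
    thus ?case using base[OF 0] by simp
  next
    case (Suc n)
    define m where "m = (\<alpha> + \<beta>) / 2"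
    have m: "\<alpha> < m" "m < \<beta>" using Suc.prems(1) by (auto simp: m_def)
    have l: "m - \<alpha> = (\<beta> - \<alpha>) / 2" "\<beta> - m = (\<beta> - \<alpha>) / 2" by (auto simp: m_def field_simps)
    define \<eta> \<zeta> where "\<eta> = P m \<xi>" and "\<zeta> = \<xi> - P m \<xi>"
    have \<eta>: "P m \<eta> = \<eta>" "P \<alpha> \<eta> = 0"
      using m projD(2)[OF pP] resolution_compose(2)[OF R, of \<alpha> m] Suc.prems(3) by (auto simp: \<eta>_def)
    have \<zeta>: "P \<beta> \<zeta> = \<zeta>" "P m \<zeta> = 0"
      using m projD(2)[OF pP] resolution_compose(1)[OF R, of m \<beta>] Suc.prems(2)
      by (auto simp: \<zeta>_def blinfun.diff_right)
    have sum: "norm \<eta> + norm \<zeta> \<le> sqrt 2 * norm \<xi>"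
    proof (rule power2_le_imp_le)
      have "(norm \<xi>)\<^sup>2 = (norm \<eta>)\<^sup>2 + (norm \<zeta>)\<^sup>2"
        unfolding \<eta>_def \<zeta>_def by (rule proj_pythagoras[OF pP])
      moreover have "0 \<le> (norm \<eta> - norm \<zeta>)\<^sup>2" by (rule zero_le_power2)
      ultimately show "(norm \<eta> + norm \<zeta>)\<^sup>2 \<le> (sqrt 2 * norm \<xi>)\<^sup>2"
        by (simp add: power_mult_distrib power2_sum power2_diff)
    qed simp
    have e: "\<epsilon> / 2 > 0" using Suc.prems(4) by simp
    define C where "C = 5 * ((\<beta> - \<alpha>) / 2) / sqrt 2 ^ n"
    have C: "C \<ge> 0" using Suc.prems(1) by (simp add: C_def)
    have "eventually (\<lambda>i. norm (T i \<eta> - a \<eta>) \<le> C * norm \<eta> + \<epsilon> / 2) F"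
      using Suc.IH[OF m(1) \<eta> e] unfolding l C_def .
    moreover have "eventually (\<lambda>i. norm (T i \<zeta> - a \<zeta>) \<le> C * norm \<zeta> + \<epsilon> / 2) F"
      using Suc.IH[OF m(2) \<zeta> e] unfolding l C_def .
    ultimately show ?case
    proof eventually_elim
      case (elim i)
      have "T i \<xi> - a \<xi> = (T i \<eta> - a \<eta>) + (T i \<zeta> - a \<zeta>)"
        by (simp add: \<eta>_def \<zeta>_def blinfun.diff_right)
      hence "norm (T i \<xi> - a \<xi>) \<le> norm (T i \<eta> - a \<eta>) + norm (T i \<zeta> - a \<zeta>)"
        by (simp only: norm_triangle_ineq)
      also have "\<dots> \<le> C * (norm \<eta> + norm \<zeta>) + \<epsilon>" using elim by (simp add: algebra_simps)
      also have "\<dots> \<le> C * (sqrt 2 * norm \<xi>) + \<epsilon>" using sum C by (simp add: mult_left_mono)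
      also have "C * sqrt 2 = C * (2 / sqrt 2)" by (simp add: real_div_sqrt)
      hence "C * sqrt 2 = 5 * (\<beta> - \<alpha>) / sqrt 2 ^ Suc n" by (simp add: C_def field_simps)
      hence "C * (sqrt 2 * norm \<xi>) = 5 * (\<beta> - \<alpha>) / sqrt 2 ^ Suc n * norm \<xi>"
        by (simp only: mult.assoc[symmetric])
      finally show ?case .
    qed
  qed
  define \<alpha> \<beta> where "\<alpha> = - norm a - 1" and "\<beta> = norm a"
  have ab: "\<alpha> < \<beta>" using norm_ge_zero[of a] by (simp add: \<alpha>_def \<beta>_def del: norm_ge_zero)
  have P0: "P \<alpha> = 0" by (rule cut_bot[OF P]) (simp add: \<alpha>_def)
  have P1: "P \<beta> = e" by (rule cut_top_norm[OF hermitian_inD(1)[OF a] P]) (simp add: \<beta>_def)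
  have "((\<lambda>i. T i \<eta>) \<longlongrightarrow> a \<eta>) F" if "e \<eta> = \<eta>" for \<eta>
  proof (rule tendstoI)
    fix \<epsilon> :: real assume \<epsilon>: "\<epsilon> > 0"
    have "(\<lambda>n. 5 * (\<beta> - \<alpha>) * norm \<eta> * (1 / sqrt 2) ^ n) \<longlonglongrightarrow> 5 * (\<beta> - \<alpha>) * norm \<eta> * 0"
      by (intro tendsto_mult tendsto_const LIMSEQ_realpow_zero) auto
    hence "eventually (\<lambda>n. 5 * (\<beta> - \<alpha>) * norm \<eta> * (1 / sqrt 2) ^ n < \<epsilon> / 2) sequentially"
      by (rule order_tendstoD(2)) (use \<epsilon> in simp)
    then obtain n where n: "5 * (\<beta> - \<alpha>) * norm \<eta> * (1 / sqrt 2) ^ n < \<epsilon> / 2"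
      using eventually_happens'[OF sequentially_bot] by blast
    have "eventually (\<lambda>i. norm (T i \<eta> - a \<eta>) \<le> 5 * (\<beta> - \<alpha>) / sqrt 2 ^ n * norm \<eta> + \<epsilon> / 2) F"
      by (rule bisect[OF ab]) (use that \<epsilon> in \<open>simp_all add: P0 P1\<close>)
    thus "eventually (\<lambda>i. dist (T i \<eta>) (a \<eta>) < \<epsilon>) F"
    proof eventually_elim
      case (elim i)
      have "5 * (\<beta> - \<alpha>) / sqrt 2 ^ n * norm \<eta> = 5 * (\<beta> - \<alpha>) * norm \<eta> * (1 / sqrt 2) ^ n"
        by (simp add: power_divide)
      thus ?case using elim n by (simp add: dist_norm)
    qed
  qed
  from this[of "e \<xi>"] have "((\<lambda>i. T i (e \<xi>)) \<longlongrightarrow> a \<xi>) F"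
    by (simp add: projD[OF hermitian_inD(1)[OF a]] hermitian_inD[OF a])
  thus ?thesis
    by (rule Lim_transform_eventually)
      (use T in \<open>auto elim!: eventually_mono simp: hermitian_inD\<close>)
qed

text \<open>The convergence criterion, applied to the constant sequence \<open>y\<close>.\<close>

lemma cut_eqI:
  fixes x y :: "'h::chilbert_space op"
  assumes x: "hermitian_in e x" "\<And>t. cut e x t (P t)"
    and y: "hermitian_in e y" "\<And>t. cut e y t (P t)"
  shows "x = y"
proof (rule blinfun_eqI)
  fix \<xi>
  have R: "resolution e P" by (rule resolution_cuts[OF x])
  have "((\<lambda>i::nat. y \<xi>) \<longlongrightarrow> x \<xi>) sequentially"
  proof (rule cut_convergence[OF x, where Q = "\<lambda>_. P" and K = "norm y"])
    show "eventually (\<lambda>i. hermitian_in e y \<and> (\<forall>t. cut e y t (P t)) \<and>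
      (\<forall>\<xi>. norm (y \<xi>) \<le> norm y * norm \<xi>)) sequentially"
      using y norm_blinfun by auto
    fix \<alpha> \<beta> :: real and \<xi> :: 'h assume ab: "\<alpha> < \<beta>"
    show "((\<lambda>i. P \<beta> \<xi>) \<longlongrightarrow> \<xi>) sequentially" if "P \<alpha> \<xi> = \<xi>"
      using resolutionD(4)[OF R _ that, of \<beta>] ab by simp
    show "((\<lambda>i. P \<alpha> \<xi>) \<longlongrightarrow> 0) sequentially" if "P \<beta> \<xi> = 0"
      using resolution_compose(2)[OF R, of \<alpha> \<beta> \<xi>] ab that by (simp add: blinfun.zero_right)
  qed
  thus "x \<xi> = y \<xi>" by (simp add: tendsto_const_iff)
qed

section \<open>Powers and roots of positive operators\<close>

lemma psd_power: "psd T \<Longrightarrow> psd (op_power T n)"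
proof -
  assume T: "psd T"
  hence s: "sa (op_power T k)" for k by (intro sa_power) (simp add: psd_def)
  have "0 \<le> ip (op_power T n \<xi>) \<xi>" for \<xi>
  proof (cases "even n")
    case True
    then obtain k where "n = k + k" by (auto elim!: evenE simp: mult_2)
    thus ?thesis using saD[OF s, of k "op_power T k \<xi>" \<xi>] by (simp add: op_power_add ip_self_nonneg)
  next
    case False
    then obtain k where "n = Suc (k + k)" by (auto elim!: oddE simp: mult_2)
    hence "op_power T n \<xi> = op_power T k (T (op_power T k \<xi>))"
      using op_power_commutes[of T T k "op_power T k \<xi>"] by (simp add: op_power_add)
    thus ?thesis using T saD[OF s, of k "T (op_power T k \<xi>)" \<xi>] by (simp add: psd_def)
  qed
  thus ?thesis using s by (simp add: psd_def)
qed

lemma corner_power: "corner e T \<Longrightarrow> n > 0 \<Longrightarrow> corner e (op_power T n)"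
proof (induction n)
  case (Suc n)
  thus ?case by (cases "n = 0") (auto simp: corner_def)
qed simp

lemma cut_power_upper:
  assumes h: "hermitian_in e T" and T: "psd T" and P: "cut e T t P" and "0 \<le> t" and "P \<xi> = \<xi>"
  shows "ip (op_power T n \<xi>) \<xi> \<le> t ^ n * ip \<xi> \<xi>"
proof -
  have n: "norm (T \<eta>) \<le> t * norm \<eta>" if "P \<eta> = \<eta>" for \<eta>
  proof -
    have "norm (T \<eta> - 0 *\<^sub>R \<eta>) \<le> t * norm \<eta>"
    proof (rule sa_norm_le_on_range[OF hermitian_inD(2)[OF h] cutD(1)[OF P] cutD(3)[OF P] _ \<open>0 \<le> t\<close> that])
      show "\<bar>ip (T \<zeta>) \<zeta> - 0 * ip \<zeta> \<zeta>\<bar> \<le> t * ip \<zeta> \<zeta>" if "P \<zeta> = \<zeta>" for \<zeta>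
        using T cutD(4)[OF P that] by (simp add: psd_def)
    qed
    thus ?thesis by simp
  qed
  have "P (op_power T k \<xi>) = op_power T k \<xi> \<and> norm (op_power T k \<xi>) \<le> t ^ k * norm \<xi>" for k
  proof (induction k)
    case (Suc k)
    have "norm (T (op_power T k \<xi>)) \<le> t * (t ^ k * norm \<xi>)"
      using n[of "op_power T k \<xi>"] Suc mult_left_mono[OF _ \<open>0 \<le> t\<close>] order_trans by blast
    thus ?case using Suc cutD(3)[OF P] by (simp add: mult.assoc)
  qed (simp add: assms)
  hence "norm (op_power T n \<xi>) * norm \<xi> \<le> t ^ n * norm \<xi> * norm \<xi>" by (simp add: mult_right_mono)
  thus ?thesis using ip_cauchy_schwarz[of "op_power T n \<xi>" \<xi>] by (simp add: ip_self power2_eq_square)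
qed

text \<open>On the invariant subspace where \<open>T > t\<close>, every application of \<open>T\<close> stretches a nonzero vector by more
  than \<open>t\<close>. Half of the factors are moved to the other side of the inner product, so an odd power leaves one
  factor \<open>T\<close> in the middle.\<close>

lemma cut_power_lower:
  assumes h: "hermitian_in e T" and T: "psd T" and P: "cut e T t P" and "0 \<le> t"
    and \<xi>: "e \<xi> = \<xi>" "P \<xi> = 0" "\<xi> \<noteq> 0" and "n > 0"
  shows "t ^ n * ip \<xi> \<xi> < ip (op_power T n \<xi>) \<xi>"
proof -
  define v where "v = (\<lambda>k. op_power T k \<xi>)"
  have s: "sa (op_power T k)" for k using T by (intro sa_power) (simp add: psd_def)
  have step: "t * norm \<eta> < norm (T \<eta>)" if "e \<eta> = \<eta>" "P \<eta> = 0" "\<eta> \<noteq> 0" for \<eta>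
  proof -
    have "t * norm \<eta> * norm \<eta> < ip (T \<eta>) \<eta>"
      using cutD(5)[OF P that] by (simp add: ip_self power2_eq_square mult.assoc)
    also have "\<dots> \<le> norm (T \<eta>) * norm \<eta>" using ip_cauchy_schwarz[of "T \<eta>" \<eta>] by linarith
    finally show ?thesis by (rule mult_right_less_imp_less) simp
  qed
  have inv: "e (v k) = v k \<and> P (v k) = 0 \<and> v k \<noteq> 0 \<and> t ^ k * norm \<xi> \<le> norm (v k)" for k
  proof (induction k)
    case 0 show ?case using \<xi> by (simp add: v_def)
  next
    case (Suc k)
    hence st: "t * norm (v k) < norm (T (v k))" using step by blast
    have vS: "v (Suc k) = T (v k)" by (simp add: v_def)
    have "0 < norm (T (v k))"
      using st mult_nonneg_nonneg[OF \<open>0 \<le> t\<close> norm_ge_zero[of "v k"]] by linarith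
    hence "T (v k) \<noteq> 0" by simp
    moreover have "t * (t ^ k * norm \<xi>) \<le> norm (T (v k))"
      using Suc mult_left_mono[OF _ \<open>0 \<le> t\<close>, of "t ^ k * norm \<xi>" "norm (v k)"] st by linarith
    ultimately show ?case
      using Suc unfolding vS by (simp add: cutD(3)[OF P] hermitian_inD[OF h] blinfun.zero_right mult.assoc)
  qed
  show ?thesis
  proof (cases "even n")
    case True
    then obtain k where n: "n = Suc k + Suc k"
      using \<open>n > 0\<close> by (metis evenE gr0_implies_Suc mult_2 nat_0_less_mult_iff)
    have "t * norm (v k) < norm (v (Suc k))" using step[of "v k"] inv[of k] by (simp add: v_def)
    moreover have "t * (t ^ k * norm \<xi>) \<le> t * norm (v k)"
      using inv[of k] \<open>0 \<le> t\<close> by (simp add: mult_left_mono)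
    ultimately have "t ^ Suc k * norm \<xi> < norm (v (Suc k))" by (simp add: mult.assoc)
    hence "(t ^ Suc k * norm \<xi>)\<^sup>2 < (norm (v (Suc k)))\<^sup>2"
      using \<open>0 \<le> t\<close> by (intro power_strict_mono) auto
    moreover have "ip (op_power T n \<xi>) \<xi> = (norm (v (Suc k)))\<^sup>2"
      unfolding n op_power_add using saD[OF s, of "Suc k" "v (Suc k)" \<xi>] unfolding v_def by (simp only: ip_self)
    moreover have "t ^ n * ip \<xi> \<xi> = (t ^ Suc k * norm \<xi>)\<^sup>2"
      by (simp only: n power_add power2_eq_square ip_self mult_ac)
    ultimately show ?thesis by simp
  next
    case False
    then obtain k where n: "n = Suc (k + k)" by (auto elim!: oddE simp: mult_2)
    have "op_power T n \<xi> = op_power T k (T (v k))"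
      using op_power_commutes[of T T k "v k"] by (simp add: n op_power_add v_def)
    hence eq: "ip (op_power T n \<xi>) \<xi> = ip (T (v k)) (v k)"
      using saD[OF s, of k "T (v k)" \<xi>] by (simp add: v_def)
    have "(t ^ k * norm \<xi>)\<^sup>2 \<le> (norm (v k))\<^sup>2"
      using inv[of k] \<open>0 \<le> t\<close> by (intro power_mono) auto
    hence "t * (t ^ k * norm \<xi>)\<^sup>2 \<le> t * ip (v k) (v k)"
      using \<open>0 \<le> t\<close> by (simp add: ip_self mult_left_mono)
    also have "\<dots> < ip (T (v k)) (v k)" using inv[of k] by (intro cutD(5)[OF P]) auto
    finally show ?thesis
      unfolding eq by (simp add: n power_add power2_eq_square ip_self mult_ac)
  qed
qed

lemma cut_power:
  assumes h: "hermitian_in e T" and T: "psd T" and P: "cut e T t P" and "0 \<le> t" and "n > 0"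
  shows "cut e (op_power T n) (t ^ n) P"
  unfolding cut_def
proof (intro conjI allI impI)
  show "P (op_power T n \<xi>) = op_power T n (P \<xi>)" for \<xi>
    by (rule op_power_commutes) (rule cutD(3)[OF P])
  show "t ^ n * ip \<xi> \<xi> < ip (op_power T n \<xi>) \<xi>" if "e \<xi> = \<xi>" "P \<xi> = 0" "\<xi> \<noteq> 0" for \<xi>
    by (rule cut_power_lower[OF h T P \<open>0 \<le> t\<close> that \<open>n > 0\<close>])
qed (intro cutD(1,2)[OF P] cut_power_upper[OF h T P \<open>0 \<le> t\<close>] | assumption)+

lemma hermitian_in_power:
  "hermitian_in e T \<Longrightarrow> n > 0 \<Longrightarrow> hermitian_in e (op_power T n)"
  by (auto simp: hermitian_in_def intro: sa_power corner_power)

lemma hermitian_in_id: "sa x \<Longrightarrow> hermitian_in id_blinfun x"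
  by (simp add: hermitian_in_def proj_id corner_def)

lemma hermitian_in_form:
  assumes h: "hermitian_in e x"
  shows "ip (x \<xi>) \<xi> = ip (x (e \<xi>)) (e \<xi>)"
  using saD[OF projD(1)[OF hermitian_inD(1)[OF h]], of "x \<xi>" \<xi>] by (simp add: hermitian_inD[OF h])

lemma hermitian_in_norm_le:
  assumes h: "hermitian_in e x" and "0 \<le> K"
    and b: "\<And>\<eta>. e \<eta> = \<eta> \<Longrightarrow> \<bar>ip (x \<eta>) \<eta>\<bar> \<le> K * ip \<eta> \<eta>"
  shows "norm (x \<xi>) \<le> K * norm \<xi>"
proof (rule sa_norm_le[OF hermitian_inD(2)[OF h]])
  fix \<xi>
  note e = hermitian_inD(1)[OF h]
  have "\<bar>ip (x \<xi>) \<xi>\<bar> \<le> K * ip (e \<xi>) (e \<xi>)"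
    unfolding hermitian_in_form[OF h, of \<xi>] by (rule b[OF projD(2)[OF e]])
  also have "\<dots> \<le> K * ip \<xi> \<xi>"
    using \<open>0 \<le> K\<close> proj_norm_le[OF e, of \<xi>] unfolding ip_self by (intro mult_left_mono power_mono) auto
  finally show "\<bar>ip (x \<xi>) \<xi>\<bar> \<le> K * ip \<xi> \<xi>" .
qed

lemma psd_cut_negative:
  assumes x: "psd x" and P: "cut e x t P" and "t < 0"
  shows "P = 0"
proof (rule blinfun_eqI)
  fix \<xi>
  have "0 \<le> ip (x (P \<xi>)) (P \<xi>)" using x by (simp add: psd_def)
  also have "\<dots> \<le> t * ip (P \<xi>) (P \<xi>)" by (rule cutD(4)[OF P projD(2)[OF cutD(1)[OF P]]])
  finally show "P \<xi> = blinfun_apply 0 \<xi>"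
    using \<open>t < 0\<close> ip_self_pos[of "P \<xi>"] by (auto simp: zero_le_mult_iff)
qed

lemma psd_if_cuts_vanish:
  assumes h: "hermitian_in e x" and cuts: "\<And>t. t < 0 \<Longrightarrow> cut e x t 0"
  shows "psd x"
proof -
  have "0 \<le> ip (x \<xi>) \<xi>" for \<xi>
  proof -
    define \<eta> where "\<eta> = e \<xi>"
    have e\<eta>: "e \<eta> = \<eta>" using hermitian_inD(1)[OF h] by (simp add: \<eta>_def projD)
    have "ip (x \<xi>) \<xi> = ip (x \<eta>) \<eta>" unfolding \<eta>_def by (rule hermitian_in_form[OF h])
    moreover have "0 \<le> ip (x \<eta>) \<eta>"
    proof (rule ccontr)
      assume "\<not> 0 \<le> ip (x \<eta>) \<eta>"
      hence neg: "ip (x \<eta>) \<eta> < 0" by simp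
      hence nz: "\<eta> \<noteq> 0" by (auto simp: ip_simps)
      define t where "t = ip (x \<eta>) \<eta> / ip \<eta> \<eta>"
      have "t < 0" using neg ip_self_pos[OF nz] by (simp add: t_def divide_neg_pos)
      from cutD(5)[OF cuts[OF this] e\<eta> _ nz] have "t * ip \<eta> \<eta> < ip (x \<eta>) \<eta>" by simp
      thus False using ip_self_pos[OF nz] by (simp add: t_def)
    qed
    ultimately show ?thesis by simp
  qed
  thus ?thesis using hermitian_inD(2)[OF h] by (simp add: psd_def)
qed

text \<open>If \<open>E\<close> is the family of cuts of \<open>S\<close>, the root has the cut \<open>E (t ^ n)\<close> at \<open>t \<ge> 0\<close>: its \<open>n\<close>-th power then
  has the same cuts as \<open>S\<close>.\<close>

lemma psd_root_exists:
  fixes S :: "'h::chilbert_space op"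
  assumes A: "sot_algebra A" and SA: "S \<in> A" and S: "psd S" and n: "n > 0"
  shows "\<exists>T\<in>A. psd T \<and> op_power T n = S"
proof -
  have h: "hermitian_in id_blinfun S" using S by (simp add: psd_def hermitian_in_id)
  obtain E where EA: "\<And>t. E t \<in> A" and E: "\<And>t. cut id_blinfun S t (E t)"
    using cut_exists[OF A sot_algebraD(1)[OF A] SA h] by metis
  have R: "resolution id_blinfun E" by (rule resolution_cuts[OF h E])
  define G where "G = (\<lambda>t. if t < 0 then 0 else E (t ^ n))"
  have z: "proj (0 :: 'h op)" "corner id_blinfun (0 :: 'h op)"
    by (simp_all add: proj_def sa_zero corner_def)
  have RG: "resolution id_blinfun G"
    unfolding resolution_def
  proof (intro conjI allI impI)
    show "G t \<xi> = \<xi>" if "s \<le> t" "G s \<xi> = \<xi>" for s t \<xi>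
    proof (cases "s < 0")
      case True
      thus ?thesis using that(2) by (auto simp: G_def blinfun.zero_right)
    next
      case False
      hence "s ^ n \<le> t ^ n" using that(1) by (simp add: power_mono)
      thus ?thesis using resolutionD(4)[OF R, of "s ^ n" "t ^ n"] that False by (simp add: G_def)
    qed
    show "G t \<xi> = \<xi>" if *: "\<forall>u>t. G u \<xi> = \<xi>" for t \<xi>
    proof (cases "t < 0")
      case True
      have "G (t / 2) \<xi> = \<xi>" using * True by simp
      thus ?thesis using True by (simp add: G_def)
    next
      case False
      have "E (t ^ n) \<xi> = \<xi>"
      proof (rule resolutionD(5)[OF R])
        fix u assume u: "t ^ n < u"
        have "0 \<le> t ^ n" using False by simp
        hence u0: "0 \<le> u" using u by linarith
        have "root n (t ^ n) < root n u" using u n by simp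
        hence "t < root n u" using False n by (simp add: real_root_power_cancel)
        hence "G (root n u) \<xi> = \<xi>" using * by blast
        thus "E u \<xi> = \<xi>" using u0 n by (simp add: G_def)
      qed
      thus ?thesis using False by (simp add: G_def)
    qed
  qed (use z proj_id resolutionD(2,3)[OF R] in \<open>auto simp: G_def\<close>)
  define b where "b = norm S + 1"
  have b1: "1 \<le> b" by (simp add: b_def)
  have "norm S \<le> b" by (simp add: b_def)
  also have "b \<le> b ^ n" using self_le_power[OF b1 n] .
  finally have top: "G b = id_blinfun"
    using cut_top_norm[OF proj_id E, of "b ^ n"] b1 by (simp add: G_def)
  have bot: "G (-1) = 0" by (simp add: G_def)
  obtain T where T: "hermitian_in id_blinfun T" "\<And>t. cut id_blinfun T t (G t)"
      "\<And>A. sot_algebra A \<Longrightarrow> \<forall>t. G t \<in> A \<Longrightarrow> T \<in> A"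
    using operator_of_resolution[OF RG bot top] b1 by auto
  have TA: "T \<in> A" by (rule T(3)[OF A]) (simp add: G_def EA sot_algebra_zero[OF A])
  have pT: "psd T"
  proof (rule psd_if_cuts_vanish[OF T(1)])
    show "cut id_blinfun T t 0" if "t < 0" for t using T(2)[of t] that by (simp add: G_def)
  qed
  have "cut id_blinfun (op_power T n) t (E t)" for t
  proof (cases "t < 0")
    case True
    obtain P where P: "cut id_blinfun (op_power T n) t P"
      using some_cut_exists[OF hermitian_in_power[OF T(1) n]] by blast
    have "P = 0" by (rule psd_cut_negative[OF psd_power[OF pT] P True])
    moreover have "E t = 0" by (rule psd_cut_negative[OF S E True])
    ultimately show ?thesis using P by simp
  next
    case False
    have "cut id_blinfun (op_power T n) (root n t ^ n) (G (root n t))"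
      by (rule cut_power[OF T(1) pT T(2) _ n]) (use False n in \<open>simp add: real_root_ge_zero\<close>)
    thus ?thesis using False n by (simp add: G_def)
  qed
  hence "op_power T n = S"
    by (intro cut_eqI[OF hermitian_in_power[OF T(1) n] _ h E])
  thus ?thesis using TA pT by blast
qed

lemma psd_root_unique:
  fixes S T :: "'h::chilbert_space op"
  assumes S: "psd S" and T: "psd T" and n: "n > 0" and eq: "op_power S n = op_power T n"
  shows "S = T"
proof -
  have hS: "hermitian_in id_blinfun S" and hT: "hermitian_in id_blinfun T"
    using S T by (simp_all add: psd_def hermitian_in_id)
  obtain P where P: "\<And>t. cut id_blinfun S t (P t)" using some_cut_exists[OF hS] by metis
  have "cut id_blinfun T t (P t)" for t
  proof -
    obtain Q where Q: "cut id_blinfun T t Q" using some_cut_exists[OF hT] by blast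
    have "Q = P t"
    proof (cases "t < 0")
      case True
      thus ?thesis using psd_cut_negative[OF S P] psd_cut_negative[OF T Q] by simp
    next
      case False
      hence t: "0 \<le> t" by simp
      have "cut id_blinfun (op_power T n) (t ^ n) Q" by (rule cut_power[OF hT T Q t n])
      moreover have "cut id_blinfun (op_power T n) (t ^ n) (P t)"
        unfolding eq[symmetric] by (rule cut_power[OF hS S P t n])
      ultimately show ?thesis by (rule cut_unique[OF hermitian_in_power[OF hT n]])
    qed
    thus ?thesis using Q by simp
  qed
  thus ?thesis by (rule cut_eqI[OF hS P hT])
qed

section \<open>Complex and real notions of positivity\<close>

lemma bounded_opsD: "T \<in> bounded_ops \<Longrightarrow> blinfun_apply T (c *\<^sub>C \<xi>) = c *\<^sub>C blinfun_apply T \<xi>"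
  by (simp add: bounded_ops_def)

lemma cinner_scaleC_right: "cinner \<xi> (c *\<^sub>C \<eta>) = cnj c * cinner \<xi> \<eta>"
  by (metis cinner_commute cinner_scaleC_left complex_cnj_mult)

lemma cinner_add_right: "cinner \<xi> (\<eta> + \<zeta>) = cinner \<xi> \<eta> + cinner \<xi> \<zeta>"
  by (metis cinner_commute cinner_add_left complex_cnj_add)

lemma Im_cinner: "Im (cinner \<xi> \<eta>) = - ip (\<i> *\<^sub>C \<xi>) \<eta>"
  by (simp add: ip_def cinner_scaleC_left)

lemma ip_imaginary: "ip (\<i> *\<^sub>C \<xi>) \<eta> = - ip \<xi> (\<i> *\<^sub>C \<eta>)"
  by (simp add: ip_def cinner_scaleC_left cinner_scaleC_right)

lemma self_adjoint_iff_sa: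
  assumes T: "T \<in> bounded_ops"
  shows "self_adjoint T \<longleftrightarrow> sa T"
proof
  show "sa T" if "self_adjoint T"
    using that by (simp add: self_adjoint_def is_adjoint_def sa_def ip_def)
next
  assume s: "sa T"
  have "Im (cinner (T \<xi>) \<eta>) = Im (cinner \<xi> (T \<eta>))" for \<xi> \<eta>
    using saD[OF s, of "\<i> *\<^sub>C \<xi>" \<eta>] by (simp add: Im_cinner bounded_opsD[OF T])
  moreover have "Re (cinner (T \<xi>) \<eta>) = Re (cinner \<xi> (T \<eta>))" for \<xi> \<eta>
    using saD[OF s] by (simp add: ip_def)
  ultimately show "self_adjoint T"
    by (simp add: self_adjoint_def is_adjoint_def complex_eq_iff)
qed

lemma cinner_sa:
  assumes T: "T \<in> bounded_ops" "sa T"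
  shows "cinner (T \<xi>) \<xi> = complex_of_real (ip (T \<xi>) \<xi>)"
proof -
  have "ip (\<i> *\<^sub>C T \<xi>) \<xi> = - ip (\<i> *\<^sub>C T \<xi>) \<xi>"
    using saD[OF T(2), of "\<i> *\<^sub>C \<xi>" \<xi>] ip_imaginary[of \<xi> "T \<xi>"] ip_commute[of \<xi> "\<i> *\<^sub>C T \<xi>"]
    by (simp add: bounded_opsD[OF T(1)])
  thus ?thesis by (simp add: complex_eq_iff Im_cinner) (simp add: ip_def)
qed

text \<open>A complex-linear operator with real quadratic form is self-adjoint: polarize with \<open>\<eta>\<close> and with
  \<open>\<i> \<eta>\<close>.\<close>

lemma positive_op_iff_psd: "positive_op T \<longleftrightarrow> T \<in> bounded_ops \<and> psd T"
proof
  assume pos: "positive_op T"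
  hence T: "T \<in> bounded_ops" and re: "\<And>\<xi>. cinner (T \<xi>) \<xi> \<in> \<real>\<^sub>\<ge>\<^sub>0"
    by (auto simp: positive_op_def)
  have im: "Im (cinner (T \<xi>) \<xi>) = 0" for \<xi> using re[of \<xi>] by (simp add: complex_nonneg_Reals_iff)
  have pol: "Im (cinner (T \<xi>) \<eta>) = - Im (cinner (T \<eta>) \<xi>)" for \<xi> \<eta>
    using im[of "\<xi> + \<eta>"] im[of \<xi>] im[of \<eta>] by (simp add: blinfun.add_right cinner_add_left cinner_add_right)
  have "ip (T \<xi>) \<eta> = ip \<xi> (T \<eta>)" for \<xi> \<eta>
    using pol[of "\<i> *\<^sub>C \<xi>" \<eta>] ip_commute[of \<xi> "T \<eta>"]
    by (simp add: bounded_opsD[OF T] cinner_scaleC_left cinner_scaleC_right ip_def)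
  moreover have "0 \<le> ip (T \<xi>) \<xi>" for \<xi> using re[of \<xi>] by (simp add: complex_nonneg_Reals_iff ip_def)
  ultimately show "T \<in> bounded_ops \<and> psd T" using T by (simp add: psd_def sa_def)
next
  assume "T \<in> bounded_ops \<and> psd T"
  thus "positive_op T" by (simp add: positive_op_def psd_def cinner_sa)
qed

lemma is_projection_iff: "is_projection P \<longleftrightarrow> P \<in> bounded_ops \<and> proj P"
proof -
  have "P o\<^sub>L P = P \<longleftrightarrow> (\<forall>\<xi>. P (P \<xi>) = P \<xi>)"
    by (metis blinfun_apply_blinfun_compose blinfun_eqI)
  thus ?thesis using self_adjoint_iff_sa[of P] by (auto simp: is_projection_def proj_def)
qed

lemma op_le_proj_iff:
  assumes P: "P \<in> bounded_ops" "proj P" and Q: "Q \<in> bounded_ops" "proj Q"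
  shows "op_le P Q \<longleftrightarrow> (\<forall>\<xi>. P \<xi> = \<xi> \<longrightarrow> Q \<xi> = \<xi>)"
proof
  assume "op_le P Q"
  hence psd: "psd (Q - P)" by (simp add: op_le_def positive_op_iff_psd)
  show "\<forall>\<xi>. P \<xi> = \<xi> \<longrightarrow> Q \<xi> = \<xi>"
  proof (intro allI impI)
    fix \<xi> assume \<xi>: "P \<xi> = \<xi>"
    have "0 \<le> ip ((Q - P) \<xi>) \<xi>" using psd by (simp add: psd_def)
    hence "(norm \<xi>)\<^sup>2 \<le> (norm (Q \<xi>))\<^sup>2"
      using proj_ip[OF Q(2), of \<xi>] by (simp add: blinfun.diff_left ip_simps \<xi> ip_self)
    hence "(norm (\<xi> - Q \<xi>))\<^sup>2 \<le> 0" using proj_pythagoras[OF Q(2), of \<xi>] by linarith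
    thus "Q \<xi> = \<xi>" by simp
  qed
next
  assume "\<forall>\<xi>. P \<xi> = \<xi> \<longrightarrow> Q \<xi> = \<xi>"
  hence "psd (Q - P)" by (intro proj_psd proj_diff P Q) auto
  thus "op_le P Q"
    using sot_algebra_diff[OF sot_algebra_bounded_ops Q(1) P(1)] by (simp add: op_le_def positive_op_iff_psd)
qed

lemma op_root_psd:
  fixes S :: "'h::chilbert_space op"
  assumes S: "psd S" "S \<in> bounded_ops" and n: "n > 0"
  shows "psd (op_root n S)" "op_power (op_root n S) n = S"
    "sot_algebra A \<Longrightarrow> S \<in> A \<Longrightarrow> op_root n S \<in> A"
proof -
  have eq: "op_root n S = T" if T: "psd T" "T \<in> bounded_ops" "op_power T n = S" for T
    unfolding op_root_def
  proof (rule the_equality)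
    show "positive_op T \<and> op_power T n = S" using T by (simp add: positive_op_iff_psd)
    show "T' = T" if "positive_op T' \<and> op_power T' n = S" for T'
      using that T psd_root_unique[OF _ T(1) n, of T'] by (simp add: positive_op_iff_psd)
  qed
  have ex: "\<exists>T\<in>A \<inter> bounded_ops. psd T \<and> op_power T n = S" if "sot_algebra A" "S \<in> A" for A
    using psd_root_exists[OF sot_algebra_Int[OF that(1) sot_algebra_bounded_ops] _ S(1) n] that S by blast
  show "psd (op_root n S)" "op_power (op_root n S) n = S"
    using ex[OF sot_algebra_bounded_ops S(2)] eq by auto
  show "op_root n S \<in> A" if A: "sot_algebra A" "S \<in> A"
  proof -
    obtain T where T: "T \<in> A" "T \<in> bounded_ops" "psd T" "op_power T n = S" using ex[OF A] by blast
    show ?thesis using eq[OF T(3,2,4)] T(1) by simp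
  qed
qed

section \<open>Strong limits of projections\<close>

lemma limitin_sot_iff:
  "limitin strong_operator_topology f l F \<longleftrightarrow> (\<forall>\<xi>. ((\<lambda>i. blinfun_apply (f i) \<xi>) \<longlongrightarrow> blinfun_apply l \<xi>) F)"
proof
  assume l: "limitin strong_operator_topology f l F"
  show "\<forall>\<xi>. ((\<lambda>i. blinfun_apply (f i) \<xi>) \<longlongrightarrow> blinfun_apply l \<xi>) F"
  proof
    fix \<xi>
    have "limitin euclidean ((\<lambda>g. blinfun_apply g \<xi>) \<circ> f) (blinfun_apply l \<xi>) F"
      by (rule continuous_map_limit[OF strong_operator_topology_continuous_evaluation l])
    thus "((\<lambda>i. blinfun_apply (f i) \<xi>) \<longlongrightarrow> blinfun_apply l \<xi>) F" by (simp add: o_def)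
  qed
next
  assume l: "\<forall>\<xi>. ((\<lambda>i. blinfun_apply (f i) \<xi>) \<longlongrightarrow> blinfun_apply l \<xi>) F"
  have "limitin (product_topology (\<lambda>i. euclidean) UNIV) (\<lambda>i. blinfun_apply (f i)) (blinfun_apply l) F"
    using l by (simp add: limitin_componentwise)
  hence "limitin euclidean (\<lambda>i. blinfun_apply (f i)) (blinfun_apply l) F"
    by (simp add: euclidean_product_topology)
  hence lim: "((\<lambda>i. blinfun_apply (f i)) \<longlongrightarrow> blinfun_apply l) F" by simp
  show "limitin strong_operator_topology f l F"
    unfolding limitin_def
  proof (intro conjI allI impI)
    show "l \<in> topspace strong_operator_topology" by (simp add: strong_operator_topology_topspace)
    fix U assume U: "openin strong_operator_topology U \<and> l \<in> U"
    then obtain V where V: "open V" "U = blinfun_apply -` V"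
      by (auto simp: strong_operator_topology_def openin_pullback_topology)
    have "eventually (\<lambda>i. blinfun_apply (f i) \<in> V) F" using topological_tendstoD[OF lim V(1)] U V(2) by simp
    thus "eventually (\<lambda>i. f i \<in> U) F" by (simp add: V(2))
  qed
qed

text \<open>If \<open>Pinf\<close> is the infimum of the projections \<open>P j\<close>, the range of \<open>e - Pinf\<close> is the closed span of the
  ranges of the \<open>e - P j\<close>. So contractions that tend strongly to \<open>0\<close> on each of the latter do so on the
  former.\<close>

lemma null_net_complement_Inf:
  fixes P :: "'j \<Rightarrow> 'h::chilbert_space op" and Q :: "'i \<Rightarrow> 'h op"
  assumes e: "proj e" and Pinf: "proj Pinf" "corner e Pinf"
    and P: "\<And>j. j \<in> J \<Longrightarrow> proj (P j)" "\<And>j. j \<in> J \<Longrightarrow> corner e (P j)"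
    and inf: "\<And>\<zeta>. e \<zeta> = \<zeta> \<Longrightarrow> (\<And>j. j \<in> J \<Longrightarrow> P j \<zeta> = \<zeta>) \<Longrightarrow> Pinf \<zeta> = \<zeta>"
    and contr: "eventually (\<lambda>i. \<forall>\<xi>. norm (Q i \<xi>) \<le> norm \<xi>) F"
    and null: "\<And>j \<eta>. j \<in> J \<Longrightarrow> e \<eta> = \<eta> \<Longrightarrow> P j \<eta> = 0 \<Longrightarrow> ((\<lambda>i. Q i \<eta>) \<longlongrightarrow> 0) F"
    and \<xi>: "e \<xi> = \<xi>" "Pinf \<xi> = 0"
  shows "((\<lambda>i. Q i \<xi>) \<longlongrightarrow> 0) F"
proof -
  define N where "N = {\<eta>. ((\<lambda>i. Q i \<eta>) \<longlongrightarrow> 0) F}"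
  have "\<xi> \<in> N"
  proof (rule bipolar)
    show "closed_subspace N" unfolding N_def by (rule closed_subspace_null_net[OF contr])
    fix \<zeta> assume orth: "\<And>\<eta>. \<eta> \<in> N \<Longrightarrow> ip \<eta> \<zeta> = 0"
    have "P j (e \<zeta>) = e \<zeta>" if j: "j \<in> J" for j
    proof -
      have "ip (e \<zeta> - P j \<zeta>) \<eta> = 0" for \<eta>
      proof -
        have "e \<eta> - P j \<eta> \<in> N"
          unfolding N_def using projD[OF e] projD[OF P(1)[OF j]] cornerD[OF P(2)[OF j]]
          by (intro CollectI null[OF j]) (simp_all add: blinfun.diff_right)
        from orth[OF this] show ?thesis
          using saD[OF projD(1)[OF e]] saD[OF projD(1)[OF P(1)[OF j]]] by (simp add: ip_simps ip_commute[of \<zeta>])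
      qed
      from this[of "e \<zeta> - P j \<zeta>"] show ?thesis by (simp add: ip_self_eq_0 cornerD[OF P(2)[OF j]] projD[OF P(1)[OF j]])
    qed
    hence "Pinf (e \<zeta>) = e \<zeta>" by (intro inf) (simp_all add: projD[OF e])
    hence "ip \<xi> \<zeta> = ip \<xi> (Pinf (e \<zeta>))" using saD[OF projD(1)[OF e], of \<xi> \<zeta>] \<xi>(1) by simp
    also have "\<dots> = 0" using saD[OF projD(1)[OF Pinf(1)], of \<xi> "e \<zeta>"] \<xi>(2) by (simp add: ip_simps)
    finally show "ip \<xi> \<zeta> = 0" .
  qed
  thus ?thesis by (simp add: N_def)
qed

lemma resolution_right_limit:
  assumes R: "resolution e E"
  shows "((\<lambda>u. E u \<xi>) \<longlongrightarrow> E t \<xi>) (at_right t)"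
proof -
  note p = resolutionD(2)[OF R] and c = resolutionD(3)[OF R]
  define \<eta> where "\<eta> = e \<xi> - E t \<xi>"
  have "((\<lambda>u. E u \<eta>) \<longlongrightarrow> 0) (at_right t)"
  proof (rule null_net_complement_Inf[where J = "{t<..}" and P = E and Pinf = "E t" and e = e])
    show "E t \<zeta> = \<zeta>" if "\<And>j. j \<in> {t<..} \<Longrightarrow> E j \<zeta> = \<zeta>" for \<zeta>
      by (rule resolutionD(5)[OF R]) (use that in simp)
    show "eventually (\<lambda>u. \<forall>\<xi>. norm (E u \<xi>) \<le> norm \<xi>) (at_right t)"
      by (intro always_eventually allI proj_norm_le p)
    show "((\<lambda>u. E u \<eta>) \<longlongrightarrow> 0) (at_right t)" if j: "j \<in> {t<..}" "E j \<eta> = 0" for j \<eta>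
    proof (rule tendsto_eventually)
      have "eventually (\<lambda>u. u \<in> {t<..<j}) (at_right t)" using j by (intro eventually_at_right_real) simp
      thus "eventually (\<lambda>u. E u \<eta> = 0) (at_right t)"
      proof eventually_elim
        case (elim u)
        thus ?case using resolution_compose(2)[OF R, of u j \<eta>] j(2) by (simp add: blinfun.zero_right)
      qed
    qed
  qed (simp_all add: \<eta>_def p c resolutionD(1)[OF R] blinfun.diff_right projD cornerD)
  hence "((\<lambda>u. E u \<eta> + E t \<xi>) \<longlongrightarrow> 0 + E t \<xi>) (at_right t)" by (intro tendsto_add tendsto_const)
  hence "((\<lambda>u. E u \<eta> + E t \<xi>) \<longlongrightarrow> E t \<xi>) (at_right t)" by simp
  thus ?thesis
  proof (rule Lim_transform_eventually)
    have "eventually (\<lambda>u. u \<in> {t<..<t + 1}) (at_right t)" by (intro eventually_at_right_real) simp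
    thus "eventually (\<lambda>u. E u \<eta> + E t \<xi> = E u \<xi>) (at_right t)"
    proof eventually_elim
      case (elim u)
      thus ?case
        using resolution_compose(1)[OF R, of t u \<xi>] by (simp add: \<eta>_def blinfun.diff_right cornerD[OF c])
    qed
  qed
qed

section \<open>Spectral families\<close>

definition complete_resolution :: "'h::chilbert_space op \<Rightarrow> (real \<Rightarrow> 'h op) \<Rightarrow> bool" where
  "complete_resolution e E \<longleftrightarrow> resolution e E \<and> (\<forall>\<xi>. ((\<lambda>t. E t \<xi>) \<longlongrightarrow> 0) at_bot) \<and>
     (\<forall>\<xi>. ((\<lambda>t. E t \<xi>) \<longlongrightarrow> e \<xi>) at_top)"

definition spectral_measure :: "(real \<Rightarrow> 'h::chilbert_space op) \<Rightarrow> 'h \<Rightarrow> real measure" where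
  "spectral_measure E \<xi> = interval_measure (\<lambda>t. ip (E t \<xi>) \<xi>)"

lemma sets_spectral_measure [simp, measurable_cong]: "sets (spectral_measure E \<xi>) = sets borel"
  and space_spectral_measure [simp]: "space (spectral_measure E \<xi>) = UNIV"
  by (simp_all add: spectral_measure_def)

lemma
  assumes E: "complete_resolution e E"
  shows finite_spectral_measure: "finite_measure (spectral_measure E \<xi>)"
    and measure_spectral_UNIV: "measure (spectral_measure E \<xi>) UNIV = ip (e \<xi>) \<xi>"
    and emeasure_spectral_UNIV: "emeasure (spectral_measure E \<xi>) UNIV = ennreal (ip (e \<xi>) \<xi>)"
    and emeasure_spectral_Iic: "emeasure (spectral_measure E \<xi>) {..t} = ennreal (ip (E t \<xi>) \<xi>)"
    and measure_spectral_Ioc: "a \<le> b \<Longrightarrow> measure (spectral_measure E \<xi>) {a<..b} = increment E a b \<xi>"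
proof -
  have R: "resolution e E" using E by (simp add: complete_resolution_def)
  define f where "f = (\<lambda>t. ip (E t \<xi>) \<xi>)"
  have mono: "f s \<le> f t" if "s \<le> t" for s t
    using increment_nonneg[OF R that, of \<xi>] by (simp add: f_def increment_def)
  have rc: "continuous (at_right t) f" for t
    unfolding continuous_within f_def by (intro ip.tendsto resolution_right_limit[OF R] tendsto_const)
  have bot: "(f \<longlongrightarrow> 0) at_bot"
    using ip.tendsto[OF _ tendsto_const, of "\<lambda>t. E t \<xi>" 0 at_bot \<xi>] E
    by (simp add: f_def complete_resolution_def ip_simps)
  have top: "(f \<longlongrightarrow> ip (e \<xi>) \<xi>) at_top"
    unfolding f_def using E by (intro ip.tendsto tendsto_const) (simp add: complete_resolution_def)
  have nn: "0 \<le> ip (e \<xi>) \<xi>" using proj_psd[OF resolutionD(1)[OF R]] by (simp add: psd_def)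
  have m: "spectral_measure E \<xi> = interval_measure f" by (simp add: spectral_measure_def f_def)
  show U: "emeasure (spectral_measure E \<xi>) UNIV = ennreal (ip (e \<xi>) \<xi>)"
    unfolding m by (rule interval_measure_UNIV[OF mono rc bot top nn])
  thus "measure (spectral_measure E \<xi>) UNIV = ip (e \<xi>) \<xi>" using nn by (simp add: measure_def)
  show "finite_measure (spectral_measure E \<xi>)" using U by (intro finite_measureI) simp
  show "emeasure (spectral_measure E \<xi>) {..t} = ennreal (ip (E t \<xi>) \<xi>)"
    unfolding m using emeasure_interval_measure_Iic[OF mono rc bot, of t] by (simp add: f_def)
  show "measure (spectral_measure E \<xi>) {a<..b} = increment E a b \<xi>" if "a \<le> b"
    unfolding m using measure_interval_measure_Ioc[OF that mono rc] by (simp add: f_def increment_def)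
qed

lemma spectral_integral_lower:
  assumes E: "complete_resolution e E" and int: "has_bochner_integral (spectral_measure E \<xi>) (\<lambda>s. s) c"
    and \<xi>: "e \<xi> = \<xi>" "E t \<xi> = 0"
  shows "t * ip \<xi> \<xi> \<le> c"
proof -
  interpret finite_measure "spectral_measure E \<xi>" by (rule finite_spectral_measure[OF E])
  have ae: "AE s in spectral_measure E \<xi>. t \<le> s"
    by (rule AE_I[of _ _ "{..t}"]) (auto simp: emeasure_spectral_Iic[OF E] \<xi>(2) ip_simps)
  have "t * ip \<xi> \<xi> = integral\<^sup>L (spectral_measure E \<xi>) (\<lambda>_. t)"
    by (simp add: measure_spectral_UNIV[OF E] \<xi>(1))
  also have "\<dots> \<le> integral\<^sup>L (spectral_measure E \<xi>) (\<lambda>s. s)"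
    using int ae by (intro integral_mono_AE) (auto simp: has_bochner_integral_iff)
  also have "\<dots> = c" using int by (simp add: has_bochner_integral_iff)
  finally show ?thesis .
qed

lemma spectral_integral_upper:
  assumes E: "complete_resolution e E" and int: "has_bochner_integral (spectral_measure E \<xi>) (\<lambda>s. s) c"
    and \<xi>: "E t \<xi> = \<xi>"
  shows "c \<le> t * ip \<xi> \<xi>"
proof -
  interpret finite_measure "spectral_measure E \<xi>" by (rule finite_spectral_measure[OF E])
  have R: "resolution e E" using E by (simp add: complete_resolution_def)
  have e\<xi>: "e \<xi> = \<xi>" by (rule corner_range[OF resolutionD(3)[OF R] \<xi>])
  have "emeasure (spectral_measure E \<xi>) (UNIV - {..t}) = 0"
    using emeasure_Diff[of "spectral_measure E \<xi>" "{..t}" UNIV] emeasure_spectral_Iic[OF E, of \<xi> t]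
      emeasure_spectral_UNIV[OF E, of \<xi>] by (simp add: e\<xi> \<xi>)
  hence ae: "AE s in spectral_measure E \<xi>. s \<le> t"
    by (intro AE_I[of _ _ "UNIV - {..t}"]) auto
  have "c = integral\<^sup>L (spectral_measure E \<xi>) (\<lambda>s. s)" using int by (simp add: has_bochner_integral_iff)
  also have "\<dots> \<le> integral\<^sup>L (spectral_measure E \<xi>) (\<lambda>_. t)"
    using int ae by (intro integral_mono_AE) (auto simp: has_bochner_integral_iff)
  also have "\<dots> = t * ip \<xi> \<xi>" by (simp add: measure_spectral_UNIV[OF E] e\<xi>)
  finally show ?thesis .
qed

lemma cuts_complete_resolution:
  assumes h: "hermitian_in e x" and E: "\<And>t. cut e x t (E t)"
  shows "complete_resolution e E"
  unfolding complete_resolution_def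
proof (intro conjI allI)
  show "resolution e E" by (rule resolution_cuts[OF h E])
  fix \<xi>
  show "((\<lambda>t. E t \<xi>) \<longlongrightarrow> 0) at_bot"
  proof (rule tendsto_eventually)
    show "eventually (\<lambda>t. E t \<xi> = 0) at_bot"
      using eventually_gt_at_bot[of "- norm x"] by eventually_elim (simp add: cut_bot[OF E])
  qed
  show "((\<lambda>t. E t \<xi>) \<longlongrightarrow> e \<xi>) at_top"
  proof (rule tendsto_eventually)
    show "eventually (\<lambda>t. E t \<xi> = e \<xi>) at_top"
      using eventually_ge_at_top[of "norm x"]
      by eventually_elim (simp add: cut_top_norm[OF hermitian_inD(1)[OF h] E])
  qed
qed

text \<open>Over \<open>(a, b]\<close> the integral of \<open>t\<close> and the quadratic form of \<open>x\<close> both lie between \<open>a\<close> and \<open>b\<close> times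
  the mass. Both are additive under bisection, so they differ by at most \<open>2\<^sup>-\<^sup>n (b - a)\<close> times the mass
  for every \<open>n\<close>.\<close>

lemma spectral_integral:
  assumes h: "hermitian_in e x" and E: "\<And>t. cut e x t (E t)"
  shows "has_bochner_integral (spectral_measure E \<xi>) (\<lambda>s. s) (ip (x \<xi>) \<xi>)"
proof -
  have C: "complete_resolution e E" by (rule cuts_complete_resolution[OF h E])
  have R: "resolution e E" by (rule resolution_cuts[OF h E])
  define \<mu> where "\<mu> = spectral_measure E \<xi>"
  interpret finite_measure \<mu> unfolding \<mu>_def by (rule finite_spectral_measure[OF C])
  have sets [measurable_cong, simp]: "sets \<mu> = sets borel" by (simp add: \<mu>_def)
  have int: "integrable \<mu> (\<lambda>s. indicat_real {a<..b} s * s)" for a b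
    by (rule integrable_const_bound[where B = "\<bar>a\<bar> + \<bar>b\<bar>"]) (auto simp: indicator_def)
  have intc: "integrable \<mu> (\<lambda>s. indicat_real {a<..b} s * c)" for a b c
    by (rule integrable_const_bound[where B = "\<bar>c\<bar>"]) (auto simp: indicator_def)
  define I where "I = (\<lambda>a b. integral\<^sup>L \<mu> (\<lambda>s. indicat_real {a<..b} s * s))"
  define q where "q = (\<lambda>a b. ip (x (E b \<xi> - E a \<xi>)) \<xi>)"
  have close: "\<bar>I a b - q a b\<bar> \<le> (b - a) / 2 ^ n * increment E a b \<xi>" if "a \<le> b" for a b n
    using that
  proof (induction n arbitrary: a b)
    case 0
    have I1: "a * increment E a b \<xi> \<le> I a b"
    proof -
      have "a * increment E a b \<xi> = integral\<^sup>L \<mu> (\<lambda>s. indicat_real {a<..b} s * a)"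
        using measure_spectral_Ioc[OF C 0, of \<xi>] by (simp add: \<mu>_def)
      also have "\<dots> \<le> I a b" unfolding I_def
        by (intro integral_mono intc int) (auto simp: indicator_def)
      finally show ?thesis .
    qed
    have I2: "I a b \<le> b * increment E a b \<xi>"
    proof -
      have "I a b \<le> integral\<^sup>L \<mu> (\<lambda>s. indicat_real {a<..b} s * b)" unfolding I_def
        by (intro integral_mono intc int) (auto simp: indicator_def)
      also have "\<dots> = b * increment E a b \<xi>"
        using measure_spectral_Ioc[OF C 0, of \<xi>] by (simp add: \<mu>_def)
      finally show ?thesis .
    qed
    define \<eta> where "\<eta> = E b \<xi> - E a \<xi>"
    have \<eta>: "E b \<eta> = \<eta>" "E a \<eta> = 0"
      using resolution_compose[OF R 0] projD[OF resolutionD(2)[OF R]]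
      by (simp_all add: \<eta>_def blinfun.diff_right)
    have e\<eta>: "e \<eta> = \<eta>" by (rule corner_range[OF resolutionD(3)[OF R] \<eta>(1)])
    have sw: "ip \<zeta> \<eta> = ip (E b \<zeta> - E a \<zeta>) \<xi>" for \<zeta>
      using saD[OF projD(1)[OF resolutionD(2)[OF R]]] by (simp add: \<eta>_def ip_simps)
    have inc: "ip \<eta> \<eta> = increment E a b \<xi>"
      using sw[of \<eta>] \<eta> by (simp add: increment_def) (simp add: \<eta>_def ip_simps)
    have q: "q a b = ip (x \<eta>) \<eta>"
      using sw[of "x \<eta>"] \<eta> by (simp add: q_def cutD(3)[OF E] blinfun.zero_right) (simp add: \<eta>_def)
    have "a * ip \<eta> \<eta> \<le> ip (x \<eta>) \<eta>"
      using cutD(5)[OF E e\<eta> \<eta>(2)] by (cases "\<eta> = 0") (auto simp: blinfun.zero_right ip_simps)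
    moreover have "ip (x \<eta>) \<eta> \<le> b * ip \<eta> \<eta>" by (rule cutD(4)[OF E \<eta>(1)])
    ultimately show ?case using I1 I2 by (simp add: q inc abs_le_iff left_diff_distrib)
  next
    case (Suc n)
    define m where "m = (a + b) / 2"
    have m: "a \<le> m" "m \<le> b" using Suc.prems by (auto simp: m_def field_simps)
    have l: "m - a = (b - a) / 2" "b - m = (b - a) / 2" by (auto simp: m_def field_simps)
    have "I a b = I a m + I m b"
    proof -
      have "indicat_real {a<..b} s * s = indicat_real {a<..m} s * s + indicat_real {m<..b} s * s" for s
        using m by (auto simp: indicator_def)
      thus ?thesis unfolding I_def using int by (simp only: Bochner_Integration.integral_add[OF int int])
    qed
    moreover have "q a b = q a m + q m b" by (simp add: q_def blinfun.diff_right ip_simps)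
    moreover have "increment E a b \<xi> = increment E a m \<xi> + increment E m b \<xi>" by (simp add: increment_def)
    moreover have "\<bar>I a m - q a m\<bar> \<le> (b - a) / 2 / 2 ^ n * increment E a m \<xi>"
      using Suc.IH[OF m(1)] unfolding l .
    moreover have "\<bar>I m b - q m b\<bar> \<le> (b - a) / 2 / 2 ^ n * increment E m b \<xi>"
      using Suc.IH[OF m(2)] unfolding l .
    ultimately have "\<bar>I a b - q a b\<bar> \<le> (b - a) / 2 / 2 ^ n * increment E a b \<xi>"
      by (simp only: distrib_left)
    thus ?case by simp
  qed
  define a b where "a = - norm x - 1" and "b = norm x"
  have ab: "a \<le> b" unfolding a_def b_def using norm_ge_zero[of x] by linarith
  have Ea: "E a = 0" by (rule cut_bot[OF E]) (simp add: a_def)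
  have Eb: "E b = e" by (rule cut_top_norm[OF hermitian_inD(1)[OF h] E]) (simp add: b_def)
  have "\<bar>I a b - q a b\<bar> \<le> 0"
  proof (rule LIMSEQ_le_const)
    have "(\<lambda>n. (b - a) * increment E a b \<xi> * (1/2) ^ n) \<longlonglongrightarrow> (b - a) * increment E a b \<xi> * 0"
      by (intro tendsto_mult tendsto_const LIMSEQ_realpow_zero) auto
    thus "(\<lambda>n. (b - a) / 2 ^ n * increment E a b \<xi>) \<longlonglongrightarrow> 0" by (simp add: power_divide)
    show "\<exists>N. \<forall>n\<ge>N. \<bar>I a b - q a b\<bar> \<le> (b - a) / 2 ^ n * increment E a b \<xi>" using close[OF ab] by blast
  qed
  hence "I a b = ip (x \<xi>) \<xi>" by (simp add: q_def Ea Eb hermitian_inD[OF h])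
  hence "has_bochner_integral \<mu> (\<lambda>s. indicat_real {a<..b} s * s) (ip (x \<xi>) \<xi>)"
    using int by (simp add: has_bochner_integral_iff I_def)
  moreover have "AE s in \<mu>. indicat_real {a<..b} s * s = s"
  proof (rule AE_I[of _ _ "{..a} \<union> (UNIV - {..b})"])
    have "emeasure \<mu> {..a} = 0" unfolding \<mu>_def by (simp add: emeasure_spectral_Iic[OF C] Ea ip_simps)
    moreover have "emeasure \<mu> (UNIV - {..b}) = 0"
      using emeasure_Diff[of \<mu> "{..b}" UNIV] emeasure_spectral_Iic[OF C, of \<xi> b] emeasure_spectral_UNIV[OF C, of \<xi>]
      unfolding \<mu>_def by (simp add: Eb)
    ultimately show "emeasure \<mu> ({..a} \<union> (UNIV - {..b})) = 0"
      using emeasure_subadditive[of "{..a}" \<mu> "UNIV - {..b}"] by simp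
  qed (auto simp: indicator_def)
  ultimately have "has_bochner_integral \<mu> (\<lambda>s. s) (ip (x \<xi>) \<xi>)"
    by (subst has_bochner_integral_cong_AE[where g = "\<lambda>s. indicat_real {a<..b} s * s"]) (auto elim: eventually_mono)
  thus ?thesis by (simp add: \<mu>_def)
qed

text \<open>A spectral family of \<open>x\<close> has bounded support, because the integrals bound the quadratic form of \<open>x\<close>
  on the ranges of its projections. Hence it is the family of cuts of some operator \<open>s\<close>. The quadratic form of \<open>s\<close> is
  given by the same integrals as that of \<open>x\<close>, so \<open>s = x\<close>.\<close>

lemma is_spectral_family_iff_cuts:
  assumes h: "hermitian_in e x" and e: "e \<in> bounded_ops" and x: "x \<in> bounded_ops"
  shows "is_spectral_family e x E \<longleftrightarrow> (\<forall>t. cut e x t (E t))"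
proof
  assume "\<forall>t. cut e x t (E t)"
  hence E: "\<And>t. cut e x t (E t)" by blast
  have Eb: "E t \<in> bounded_ops" for t by (rule cut_in_algebra[OF h E sot_algebra_bounded_ops e x])
  have C: "complete_resolution e E" by (rule cuts_complete_resolution[OF h E])
  have R: "resolution e E" by (rule resolution_cuts[OF h E])
  have "op_le (E s) (E t)" if "s \<le> t" for s t
    using op_le_proj_iff[OF Eb cutD(1)[OF E] Eb cutD(1)[OF E]] resolutionD(4)[OF R that] by blast
  moreover have "has_bochner_integral (interval_measure (\<lambda>t. Re (cinner (blinfun_apply (E t) \<xi>) \<xi>)))
      complex_of_real (cinner (blinfun_apply x \<xi>) \<xi>)" for \<xi>
  proof -
    have "has_bochner_integral (spectral_measure E \<xi>) complex_of_real (complex_of_real (ip (x \<xi>) \<xi>))"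
      by (rule has_bochner_integral_of_real[OF spectral_integral[OF h E]])
    thus ?thesis unfolding cinner_sa[OF x hermitian_inD(2)[OF h], symmetric] unfolding spectral_measure_def ip_def .
  qed
  ultimately show "is_spectral_family e x E"
    unfolding is_spectral_family_def limitin_sot_iff is_projection_iff
    using Eb cutD(1)[OF E] resolution_right_limit[OF R] C
    by (auto simp: complete_resolution_def)
next
  assume fam: "is_spectral_family e x E"
  hence Eb: "\<And>t. E t \<in> bounded_ops" and p: "\<And>t. proj (E t)"
    and right: "\<And>t \<xi>. ((\<lambda>u. E u \<xi>) \<longlongrightarrow> E t \<xi>) (at_right t)"
    and bot: "\<And>\<xi>. ((\<lambda>t. E t \<xi>) \<longlongrightarrow> 0) at_bot" and top: "\<And>\<xi>. ((\<lambda>t. E t \<xi>) \<longlongrightarrow> e \<xi>) at_top"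
    and int: "\<And>\<xi>. has_bochner_integral (spectral_measure E \<xi>) complex_of_real (cinner (x \<xi>) \<xi>)"
    by (auto simp: is_spectral_family_def limitin_sot_iff is_projection_iff spectral_measure_def ip_def)
  have mono: "E t \<xi> = \<xi>" if "s \<le> t" "E s \<xi> = \<xi>" for s t \<xi>
    using fam op_le_proj_iff[OF Eb p Eb p] that by (auto simp: is_spectral_family_def)
  have pe: "proj e" by (rule hermitian_inD(1)[OF h])
  have le_e: "e \<xi> = \<xi>" if "E t \<xi> = \<xi>" for t \<xi>
  proof -
    have "((\<lambda>u. E u \<xi>) \<longlongrightarrow> \<xi>) at_top"
      by (rule tendsto_eventually) (rule eventually_mono[OF eventually_ge_at_top[of t] mono[OF _ that]])
    from tendsto_unique[OF _ top this] show ?thesis by simp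
  qed
  have R: "resolution e E" unfolding resolution_def
  proof (intro conjI allI impI)
    show "corner e (E t)" for t
      using proj_order[OF p pe le_e, of t] by (simp add: corner_def)
    show "E t \<xi> = \<xi>" if "\<forall>u>t. E u \<xi> = \<xi>" for t \<xi>
    proof -
      have "((\<lambda>u. E u \<xi>) \<longlongrightarrow> \<xi>) (at_right t)"
        by (rule tendsto_eventually) (use that in \<open>auto simp: eventually_at_filter\<close>)
      from tendsto_unique[OF _ right this] show ?thesis by simp
    qed
  qed (use p pe mono in auto)
  have C: "complete_resolution e E" using R bot top by (simp add: complete_resolution_def)
  have intr: "has_bochner_integral (spectral_measure E \<xi>) (\<lambda>s. s) (ip (x \<xi>) \<xi>)" for \<xi>
    using has_bochner_integral_Re[OF int[of \<xi>]] by (simp add: ip_def)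
  define b where "b = norm x + 1"
  have b0: "0 \<le> b" by (simp add: b_def)
  have bd: "\<bar>ip (x \<xi>) \<xi>\<bar> < b * ip \<xi> \<xi>" if "\<xi> \<noteq> 0" for \<xi>
    using ip_apply_bound[of x \<xi>] ip_self_pos[OF that] by (simp add: b_def algebra_simps)
  have Ebot: "E (- b) = 0"
  proof (rule blinfun_eqI, rule ccontr)
    fix \<xi> assume "E (- b) \<xi> \<noteq> blinfun_apply 0 \<xi>"
    hence "E (- b) \<xi> \<noteq> 0" by simp
    moreover have "ip (x (E (- b) \<xi>)) (E (- b) \<xi>) \<le> - b * ip (E (- b) \<xi>) (E (- b) \<xi>)"
      by (rule spectral_integral_upper[OF C intr]) (simp add: projD[OF p])
    ultimately show False using bd[of "E (- b) \<xi>"] by simp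
  qed
  have Etop: "E b = e"
  proof (rule proj_eqI[OF p pe])
    fix \<xi>
    show "E b \<xi> = \<xi> \<longleftrightarrow> e \<xi> = \<xi>"
    proof
      assume e\<xi>: "e \<xi> = \<xi>"
      define \<eta> where "\<eta> = \<xi> - E b \<xi>"
      have \<eta>: "e \<eta> = \<eta>" "E b \<eta> = 0"
        by (simp_all add: \<eta>_def blinfun.diff_right e\<xi> projD[OF p] cornerD[OF resolutionD(3)[OF R]])
      have "b * ip \<eta> \<eta> \<le> ip (x \<eta>) \<eta>" by (rule spectral_integral_lower[OF C intr \<eta>])
      hence "\<eta> = 0" using bd[of \<eta>] by fastforce
      thus "E b \<xi> = \<xi>" by (simp add: \<eta>_def)
    qed (rule le_e)
  qed
  obtain s where s: "hermitian_in e s" "\<And>t. cut e s t (E t)"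
    using operator_of_resolution[OF R Ebot Etop] b0 by auto
  have "ip (s \<xi>) \<xi> = ip (x \<xi>) \<xi>" for \<xi>
    using spectral_integral[OF s, of \<xi>] intr[of \<xi>] has_bochner_integral_eq by blast
  hence "s = x" by (intro sa_eqI hermitian_inD(2)[OF s(1)] hermitian_inD(2)[OF h])
  thus "\<forall>t. cut e x t (E t)" using s(2) by simp
qed

lemma spectral_family_cut:
  assumes h: "hermitian_in e x" and e: "e \<in> bounded_ops" and x: "x \<in> bounded_ops"
  shows "cut e x t (spectral_family e x t)"
proof -
  obtain E where E: "\<And>t. cut e x t (E t)"
    using cut_exists[OF sot_algebra_bounded_ops e x h] by metis
  have "spectral_family e x = E"
    unfolding spectral_family_def is_spectral_family_iff_cuts[OF assms]
    by (rule the_equality) (use E cut_unique[OF h] in blast)+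
  thus ?thesis using E by simp
qed

section \<open>Infima of projections\<close>

text \<open>The range of \<open>e\<close> takes part in the intersection, so that the infimum of the empty family is \<open>e\<close>.\<close>

definition inf_proj :: "'h::chilbert_space op \<Rightarrow> ('j \<Rightarrow> 'h op) \<Rightarrow> 'j set \<Rightarrow> 'h op" where
  "inf_proj e p J = (THE P. proj P \<and> (\<forall>\<xi>. P \<xi> = \<xi> \<longleftrightarrow> e \<xi> = \<xi> \<and> (\<forall>j\<in>J. p j \<xi> = \<xi>)))"

lemma
  fixes e :: "'h::chilbert_space op"
  assumes e: "proj e"
  shows proj_inf_proj: "proj (inf_proj e p J)"
    and inf_proj_range: "inf_proj e p J \<xi> = \<xi> \<longleftrightarrow> e \<xi> = \<xi> \<and> (\<forall>j\<in>J. p j \<xi> = \<xi>)"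
    and corner_inf_proj: "corner e (inf_proj e p J)"
proof -
  define V where "V = {\<xi>. e \<xi> = \<xi>} \<inter> (\<Inter>j\<in>J. {\<xi>. p j \<xi> = \<xi>})"
  have cs: "closed_subspace {\<xi>. T \<xi> = \<xi>}" for T :: "'h op"
    unfolding closed_subspace_def
    by (auto simp: subspace_def blinfun.bilinear_simps intro!: closed_Collect_eq continuous_intros)
  have "closed_subspace V"
    using cs unfolding V_def closed_subspace_def
    by (intro conjI closed_Int closed_INT subspace_inter subspace_Inter) auto
  from orthogonal_projection_exists[OF this]
  obtain P where P: "proj P" "\<And>\<xi>. P \<xi> = \<xi> \<longleftrightarrow> e \<xi> = \<xi> \<and> (\<forall>j\<in>J. p j \<xi> = \<xi>)"
    by (auto simp: V_def)
  have "inf_proj e p J = P"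
    unfolding inf_proj_def
  proof (rule the_equality)
    show "Q = P" if "proj Q \<and> (\<forall>\<xi>. Q \<xi> = \<xi> \<longleftrightarrow> e \<xi> = \<xi> \<and> (\<forall>j\<in>J. p j \<xi> = \<xi>))" for Q
      by (rule proj_eqI) (use P that in auto)
  qed (use P in blast)
  thus 1: "proj (inf_proj e p J)" and 2: "inf_proj e p J \<xi> = \<xi> \<longleftrightarrow> e \<xi> = \<xi> \<and> (\<forall>j\<in>J. p j \<xi> = \<xi>)" for \<xi>
    using P by auto
  show "corner e (inf_proj e p J)"
    unfolding corner_def using proj_order[OF 1 e] 2 by blast
qed

lemma inf_proj_antimono:
  assumes e: "proj e" and "\<And>j. j \<in> J \<Longrightarrow> j \<in> I"
  shows "inf_proj e p J (inf_proj e p I \<xi>) = inf_proj e p I \<xi>"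
  using projD(2)[OF proj_inf_proj[OF e], of p I \<xi>] assms(2) by (simp add: inf_proj_range[OF e])

text \<open>A finite infimum is the kernel projection of the positive operator \<open>(1 - e) + \<Sum>\<^sub>j (1 - p j)\<close>.\<close>

lemma inf_proj_in_algebra:
  assumes A: "sot_algebra A" and eA: "e \<in> A" and e: "proj e" and J: "finite J"
    and pA: "\<And>j. j \<in> J \<Longrightarrow> p j \<in> A" and p: "\<And>j. j \<in> J \<Longrightarrow> proj (p j)"
  shows "inf_proj e p J \<in> A"
proof -
  define w where "w = (id_blinfun - e) + (\<Sum>j\<in>J. id_blinfun - p j)"
  have c: "proj (id_blinfun - e)" "\<And>j. j \<in> J \<Longrightarrow> proj (id_blinfun - p j)"
    using e p by (auto intro: proj_complement)
  have "w \<in> A" unfolding w_def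
    by (intro sot_algebraD[OF A] sot_algebra_sum[OF A] sot_algebra_diff[OF A] eA pA)
  moreover have "sa w" unfolding w_def by (intro sa_add sa_sum projD(1) c)
  ultimately obtain P where P: "P \<in> A" "proj P" "\<And>\<xi>. P \<xi> = \<xi> \<longleftrightarrow> w \<xi> = 0"
    using kernel_projection[OF A] by blast
  have "inf_proj e p J = P"
  proof (rule proj_eqI[OF proj_inf_proj[OF e] P(2)])
    fix \<xi>
    have sq: "ip (w \<xi>) \<xi> = (norm (\<xi> - e \<xi>))\<^sup>2 + (\<Sum>j\<in>J. (norm (\<xi> - p j \<xi>))\<^sup>2)"
    proof -
      have "ip (w \<xi>) \<xi> = ip ((id_blinfun - e) \<xi>) \<xi> + (\<Sum>j\<in>J. ip ((id_blinfun - p j) \<xi>) \<xi>)"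
        by (simp only: w_def blinfun.add_left blinfun.sum_left ip.add_left ip.sum_left)
      also have "\<dots> = (norm ((id_blinfun - e) \<xi>))\<^sup>2 + (\<Sum>j\<in>J. (norm ((id_blinfun - p j) \<xi>))\<^sup>2)"
        using proj_ip[OF c(1)] proj_ip[OF c(2)] by (intro arg_cong2[where f = "(+)"] sum.cong) auto
      finally show ?thesis by (simp add: blinfun.diff_left)
    qed
    have "w \<xi> = 0 \<longleftrightarrow> e \<xi> = \<xi> \<and> (\<forall>j\<in>J. p j \<xi> = \<xi>)"
    proof
      assume "w \<xi> = 0"
      hence z: "(norm (\<xi> - e \<xi>))\<^sup>2 + (\<Sum>j\<in>J. (norm (\<xi> - p j \<xi>))\<^sup>2) = 0" using sq by (simp add: ip_simps)
      have s: "0 \<le> (\<Sum>j\<in>J. (norm (\<xi> - p j \<xi>))\<^sup>2)" by (rule sum_nonneg) simp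
      have "(norm (\<xi> - e \<xi>))\<^sup>2 = 0" "(\<Sum>j\<in>J. (norm (\<xi> - p j \<xi>))\<^sup>2) = 0"
        using z s zero_le_power2[of "norm (\<xi> - e \<xi>)"] by linarith+
      thus "e \<xi> = \<xi> \<and> (\<forall>j\<in>J. p j \<xi> = \<xi>)" using J by (simp add: sum_nonneg_eq_0_iff)
    next
      assume "e \<xi> = \<xi> \<and> (\<forall>j\<in>J. p j \<xi> = \<xi>)"
      thus "w \<xi> = 0" by (simp add: w_def blinfun.add_left blinfun.sum_left blinfun.diff_left)
    qed
    thus "inf_proj e p J \<xi> = \<xi> \<longleftrightarrow> P \<xi> = \<xi>" by (simp add: P(3) inf_proj_range[OF e])
  qed
  thus ?thesis using P(1) by simp
qed

lemma inf_proj_tendsto: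
  assumes e: "proj e" and p: "\<And>j. j \<in> J \<Longrightarrow> proj (p j)" "\<And>j. j \<in> J \<Longrightarrow> corner e (p j)"
  shows "((\<lambda>F. inf_proj e p F \<xi>) \<longlongrightarrow> inf_proj e p J \<xi>) (finite_subsets_at_top J)"
proof -
  note P = proj_inf_proj[OF e] and c = corner_inf_proj[OF e]
  define \<eta> where "\<eta> = e \<xi> - inf_proj e p J \<xi>"
  have "((\<lambda>F. inf_proj e p F \<eta>) \<longlongrightarrow> 0) (finite_subsets_at_top J)"
  proof (rule null_net_complement_Inf[where J = J and P = p and Pinf = "inf_proj e p J" and e = e])
    show "inf_proj e p J \<zeta> = \<zeta>" if "e \<zeta> = \<zeta>" "\<And>j. j \<in> J \<Longrightarrow> p j \<zeta> = \<zeta>" for \<zeta>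
      using that by (simp add: inf_proj_range[OF e])
    show "eventually (\<lambda>F. \<forall>\<xi>. norm (inf_proj e p F \<xi>) \<le> norm \<xi>) (finite_subsets_at_top J)"
      by (intro always_eventually allI proj_norm_le P)
    show "((\<lambda>F. inf_proj e p F \<eta>) \<longlongrightarrow> 0) (finite_subsets_at_top J)"
      if j: "j \<in> J" "p j \<eta> = 0" for j \<eta>
    proof (rule tendsto_eventually)
      have "eventually (\<lambda>F. j \<in> F) (finite_subsets_at_top J)"
        unfolding eventually_finite_subsets_at_top using j(1) by (intro exI[of _ "{j}"]) auto
      thus "eventually (\<lambda>F. inf_proj e p F \<eta> = 0) (finite_subsets_at_top J)"
      proof eventually_elim
        case (elim F)
        have "inf_proj e p F (p j \<eta>) = inf_proj e p F \<eta>"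
          by (rule proj_order[OF P p(1)[OF j(1)]]) (use elim in \<open>simp add: inf_proj_range[OF e]\<close>)
        thus ?case by (simp add: j(2) blinfun.zero_right)
      qed
    qed
  qed (simp_all add: \<eta>_def P c p e blinfun.diff_right projD cornerD)
  from tendsto_add[OF this tendsto_const[of "inf_proj e p J \<xi>"]]
  have "((\<lambda>F. inf_proj e p F \<eta> + inf_proj e p J \<xi>) \<longlongrightarrow> inf_proj e p J \<xi>) (finite_subsets_at_top J)"
    by simp
  thus ?thesis
  proof (rule Lim_transform_eventually)
    show "eventually (\<lambda>F. inf_proj e p F \<eta> + inf_proj e p J \<xi> = inf_proj e p F \<xi>) (finite_subsets_at_top J)"
    proof (rule eventually_finite_subsets_at_top_weakI)
      fix F assume "F \<subseteq> J"
      hence "inf_proj e p F (inf_proj e p J \<xi>) = inf_proj e p J \<xi>" by (intro inf_proj_antimono[OF e]) auto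
      thus "inf_proj e p F \<eta> + inf_proj e p J \<xi> = inf_proj e p F \<xi>"
        by (simp add: \<eta>_def blinfun.diff_right cornerD[OF c])
    qed
  qed
qed

section \<open>Spectral families and suprema in a von Neumann algebra\<close>

lemma cstar_subalgebra_scaleR:
  assumes "cstar_subalgebra \<M>" "T \<in> \<M>" shows "r *\<^sub>R T \<in> \<M>"
proof -
  have "r *\<^sub>R T = op_scaleC (complex_of_real r) T"
    by (rule blinfun_eqI) (simp add: op_scaleC.rep_eq scaleR_scaleC blinfun.scaleR_left)
  thus ?thesis using assms by (simp add: cstar_subalgebra_def)
qed

lemma algebra_unit_projection:
  assumes M: "cstar_subalgebra \<M>" and u: "algebra_unit \<M> e"
  shows "e \<in> bounded_ops" "proj e"
proof -
  have eM: "e \<in> \<M>" using u by (simp add: algebra_unit_def)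
  have unit: "e (T \<xi>) = T \<xi>" "T (e \<xi>) = T \<xi>" if "T \<in> \<M>" for T \<xi>
    using u that unfolding algebra_unit_def by (metis blinfun_apply_blinfun_compose)+
  show "e \<in> bounded_ops" using M eM by (auto simp: cstar_subalgebra_def)
  obtain f where f: "f \<in> \<M>" "is_adjoint e f" using M eM by (auto simp: cstar_subalgebra_def)
  have adj: "ip (e \<xi>) \<eta> = ip \<xi> (f \<eta>)" for \<xi> \<eta>
    using f(2) by (simp add: is_adjoint_def ip_def)
  \<comment> \<open>\<open>f = e f\<close> for the adjoint \<open>f\<close> of \<open>e\<close>, and \<open>e f\<close> is self-adjoint, so \<open>f = e\<close>\<close>
  have ff: "ip \<xi> (f \<eta>) = ip (f \<xi>) (f \<eta>)" for \<xi> \<eta>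
  proof -
    have "ip (f \<xi>) (f \<eta>) = ip (e (f \<xi>)) \<eta>" by (simp add: adj)
    also have "\<dots> = ip (f \<xi>) \<eta>" by (simp add: unit f)
    finally have "ip (f \<xi>) \<eta> = ip (f \<xi>) (f \<eta>)" for \<xi> \<eta>
      using adj unit f by metis
    thus ?thesis by (metis ip_commute)
  qed
  have "ip (e \<xi>) \<eta> = ip \<xi> (e \<eta>)" for \<xi> \<eta>
    using adj ff ip_commute by metis
  thus "proj e" using unit(1)[OF eM] by (simp add: proj_def sa_def)
qed

lemma hermitian_in_algebra:
  assumes M: "cstar_subalgebra \<M>" and u: "algebra_unit \<M> e" and x: "x \<in> self_adjoint_part \<M>"
  shows "hermitian_in e x" "x \<in> bounded_ops"
proof -
  show xb: "x \<in> bounded_ops" using M x by (auto simp: cstar_subalgebra_def self_adjoint_part_def)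
  have "e o\<^sub>L x = x" "x o\<^sub>L e = x" using u x by (auto simp: algebra_unit_def self_adjoint_part_def)
  hence "corner e x" by (metis blinfun_apply_blinfun_compose corner_def)
  thus "hermitian_in e x"
    using algebra_unit_projection[OF M u] x self_adjoint_iff_sa[OF xb]
    by (simp add: hermitian_in_def self_adjoint_part_def)
qed

text \<open>The unit of \<open>\<M>\<close> may differ from the identity of the whole space. This larger algebra contains both
  \<open>\<M>\<close> and the identity, and its members that live in the corner of \<open>e\<close> are those of \<open>\<M>\<close>.\<close>

definition unital_extension :: "'h::chilbert_space op set \<Rightarrow> 'h op \<Rightarrow> 'h op set" where
  "unital_extension \<M> e = {T \<in> commutant e. T o\<^sub>L e \<in> \<M>}"

lemma subset_unital_extension:
  assumes "algebra_unit \<M> e" "T \<in> \<M>" shows "T \<in> unital_extension \<M> e"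
proof -
  have eq: "e o\<^sub>L T = T" "T o\<^sub>L e = T" using assms by (auto simp: algebra_unit_def)
  have "e (T \<xi>) = T (e \<xi>)" for \<xi>
    using arg_cong[OF eq(1), of "\<lambda>f. blinfun_apply f \<xi>"] arg_cong[OF eq(2), of "\<lambda>f. blinfun_apply f \<xi>"]
    by simp
  thus ?thesis using assms(2) eq(2) by (simp add: unital_extension_def commutant_def)
qed

lemma sot_algebra_unital_extension:
  assumes vN: "von_neumann_algebra \<M>" and u: "algebra_unit \<M> e"
  shows "sot_algebra (unital_extension \<M> e)"
  unfolding sot_algebra_def
proof (intro conjI ballI allI impI)
  have M: "cstar_subalgebra \<M>" and cl: "closedin strong_operator_topology \<M>"
    using vN by (auto simp: von_neumann_algebra_def)
  have eM: "e \<in> \<M>" using u by (simp add: algebra_unit_def)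
  note C = sot_algebra_commutant[of e]
  show "id_blinfun \<in> unital_extension \<M> e"
  proof -
    have "id_blinfun o\<^sub>L e = e" by (rule blinfun_eqI) simp
    thus ?thesis using eM sot_algebraD(1)[OF C] by (simp add: unital_extension_def)
  qed
  fix S T assume S: "S \<in> unital_extension \<M> e" and T: "T \<in> unital_extension \<M> e"
  show "S + T \<in> unital_extension \<M> e"
  proof -
    have "(S + T) o\<^sub>L e = (S o\<^sub>L e) + (T o\<^sub>L e)" by (rule blinfun_eqI) (simp add: blinfun.add_left)
    thus ?thesis using S T M sot_algebraD(2)[OF C] by (simp add: unital_extension_def cstar_subalgebra_def)
  qed
  show "S o\<^sub>L T \<in> unital_extension \<M> e"
  proof -
    have "(S o\<^sub>L T) o\<^sub>L e = (S o\<^sub>L e) o\<^sub>L (T o\<^sub>L e)"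
    proof (rule blinfun_eqI)
      fix \<xi>
      have "e o\<^sub>L (T o\<^sub>L e) = T o\<^sub>L e" using u T by (simp add: unital_extension_def algebra_unit_def)
      hence "e (T (e \<xi>)) = T (e \<xi>)" by (metis blinfun_apply_blinfun_compose)
      thus "((S o\<^sub>L T) o\<^sub>L e) \<xi> = ((S o\<^sub>L e) o\<^sub>L (T o\<^sub>L e)) \<xi>" by simp
    qed
    thus ?thesis using S T M sot_algebraD(4)[OF C] by (simp add: unital_extension_def cstar_subalgebra_def)
  qed
next
  fix c T assume T: "T \<in> unital_extension \<M> e"
  have "(c *\<^sub>R T) o\<^sub>L e = c *\<^sub>R (T o\<^sub>L e)" by (rule blinfun_eqI) (simp add: blinfun.scaleR_left)
  moreover have "c *\<^sub>R (T o\<^sub>L e) \<in> \<M>"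
    by (rule cstar_subalgebra_scaleR) (use T vN in \<open>simp_all add: unital_extension_def von_neumann_algebra_def\<close>)
  moreover have "c *\<^sub>R T \<in> commutant e"
    by (rule sot_algebraD(3)[OF sot_algebra_commutant]) (use T in \<open>simp add: unital_extension_def\<close>)
  ultimately show "c *\<^sub>R T \<in> unital_extension \<M> e" by (simp add: unital_extension_def)
next
  fix f :: "nat \<Rightarrow> 'a op" and T
  assume f: "\<forall>n. f n \<in> unital_extension \<M> e" and lim: "\<forall>\<xi>. (\<lambda>n. blinfun_apply (f n) \<xi>) \<longlonglongrightarrow> blinfun_apply T \<xi>"
  have "limitin strong_operator_topology (\<lambda>n. f n o\<^sub>L e) (T o\<^sub>L e) sequentially"
    using lim by (simp add: limitin_sot_iff)
  hence "T o\<^sub>L e \<in> \<M>"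
    by (rule limitin_closedin) (use vN f in \<open>auto simp: von_neumann_algebra_def unital_extension_def\<close>)
  moreover have "T \<in> commutant e"
    by (rule sot_algebra_limit[OF sot_algebra_commutant, of f]) (use f lim in \<open>auto simp: unital_extension_def\<close>)
  ultimately show "T \<in> unital_extension \<M> e" by (simp add: unital_extension_def)
qed

lemma unital_extension_corner:
  assumes "T \<in> unital_extension \<M> e" "corner e T" shows "T \<in> \<M>"
proof -
  have "T o\<^sub>L e = T" using cornerD(2)[OF assms(2)] by (intro blinfun_eqI) simp
  thus ?thesis using assms(1) by (simp add: unital_extension_def)
qed

definition join_family :: "'h::chilbert_space op \<Rightarrow> 'h op set \<Rightarrow> real \<Rightarrow> 'h op" where
  "join_family e X t = inf_proj e (\<lambda>x. spectral_family e x t) X"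

lemma spectral_le_iff:
  assumes x: "hermitian_in e x" "x \<in> bounded_ops" and y: "hermitian_in e y" "y \<in> bounded_ops"
    and e: "e \<in> bounded_ops"
  shows "spectral_le e x y \<longleftrightarrow>
    (\<forall>t \<xi>. spectral_family e y t \<xi> = \<xi> \<longrightarrow> spectral_family e x t \<xi> = \<xi>)"
proof -
  note cx = spectral_family_cut[OF x(1) e x(2)] and cy = spectral_family_cut[OF y(1) e y(2)]
  note bx = cut_in_algebra[OF x(1) cx sot_algebra_bounded_ops e x(2)]
    and by' = cut_in_algebra[OF y(1) cy sot_algebra_bounded_ops e y(2)]
  show ?thesis
    unfolding spectral_le_def op_le_proj_iff[OF by' cutD(1)[OF cy] bx cutD(1)[OF cx]] by simp
qed

text \<open>The projections \<open>join_family e X t\<close> lie in \<open>\<M>\<close> as strong limits of finite infima, and they form a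
  resolution that vanishes below the spectrum of any member of \<open>X\<close> and equals \<open>e\<close> above that of \<open>b\<close>. The operator with these
  cuts is the supremum because the spectral order compares ranges of cuts.\<close>

lemma spectral_sup_exists:
  assumes vN: "von_neumann_algebra \<M>" and u: "algebra_unit \<M> e"
    and X: "X \<subseteq> self_adjoint_part \<M>" "X \<noteq> {}"
    and b: "b \<in> self_adjoint_part \<M>" "\<forall>x\<in>X. spectral_le e x b"
  shows "\<exists>s. is_spectral_sup \<M> e X s \<and> hermitian_in e s \<and> (\<forall>t. cut e s t (join_family e X t)) \<and>
    (\<forall>x\<in>X. \<forall>\<xi>. norm (s \<xi>) \<le> (norm x + norm b + 1) * norm \<xi>)"
proof -
  have M: "cstar_subalgebra \<M>" and cl: "closedin strong_operator_topology \<M>"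
    using vN by (auto simp: von_neumann_algebra_def)
  have eM: "e \<in> \<M>" using u by (simp add: algebra_unit_def)
  note eb = algebra_unit_projection(1)[OF M u] and pe = algebra_unit_projection(2)[OF M u]
  note A = sot_algebra_unital_extension[OF vN u]
  have hx: "hermitian_in e x" and xb: "x \<in> bounded_ops" if "x \<in> self_adjoint_part \<M>" for x
    using hermitian_in_algebra[OF M u that] by auto
  have cut: "cut e x t (spectral_family e x t)" if "x \<in> self_adjoint_part \<M>" for x t
    by (rule spectral_family_cut[OF hx[OF that] eb xb[OF that]])
  have inA: "spectral_family e x t \<in> unital_extension \<M> e" if "x \<in> self_adjoint_part \<M>" for x t
    by (rule cut_in_algebra[OF hx[OF that] cut[OF that] A])
      (use that eM in \<open>auto intro: subset_unital_extension[OF u] simp: self_adjoint_part_def\<close>)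
  have XM: "x \<in> self_adjoint_part \<M>" if "x \<in> X" for x using X that by blast
  define G where "G = join_family e X"
  have pG: "proj (G t)" and cG: "corner e (G t)"
    and rG: "G t \<xi> = \<xi> \<longleftrightarrow> e \<xi> = \<xi> \<and> (\<forall>x\<in>X. spectral_family e x t \<xi> = \<xi>)" for t \<xi>
    unfolding G_def join_family_def
    by (rule proj_inf_proj[OF pe] corner_inf_proj[OF pe] inf_proj_range[OF pe])+
  have GM: "G t \<in> \<M>" for t
  proof (rule limitin_closedin)
    show "limitin strong_operator_topology (\<lambda>F. inf_proj e (\<lambda>x. spectral_family e x t) F) (G t)
        (finite_subsets_at_top X)"
      unfolding limitin_sot_iff G_def join_family_def
      by (intro allI inf_proj_tendsto[OF pe] cutD(1)[OF cut[OF XM]] cutD(2)[OF cut[OF XM]])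
    show "eventually (\<lambda>F. inf_proj e (\<lambda>x. spectral_family e x t) F \<in> \<M>) (finite_subsets_at_top X)"
    proof (rule eventually_finite_subsets_at_top_weakI)
      fix F assume F: "finite F" "F \<subseteq> X"
      have "inf_proj e (\<lambda>x. spectral_family e x t) F \<in> unital_extension \<M> e"
        using F XM cutD(1)[OF cut] inA
        by (intro inf_proj_in_algebra[OF A subset_unital_extension[OF u eM] pe F(1)]) auto
      thus "inf_proj e (\<lambda>x. spectral_family e x t) F \<in> \<M>"
        by (rule unital_extension_corner) (rule corner_inf_proj[OF pe])
    qed
  qed (use cl in auto)
  have R: "resolution e G"
    unfolding resolution_def
  proof (intro conjI allI impI)
    show "G t \<xi> = \<xi>" if "s \<le> t" "G s \<xi> = \<xi>" for s t \<xi>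
      using that cut_mono[OF hx cut cut \<open>s \<le> t\<close>] XM by (auto simp: rG)
    show "G t \<xi> = \<xi>" if G: "\<forall>u>t. G u \<xi> = \<xi>" for t \<xi>
    proof -
      have "G (t + 1) \<xi> = \<xi>" using G by simp
      hence "e \<xi> = \<xi>" by (simp add: rG)
      moreover have "spectral_family e x t \<xi> = \<xi>" if "x \<in> X" for x
        by (rule cut_right_continuous[OF hx[OF XM[OF that]] cut[OF XM[OF that]] cut[OF XM[OF that]]])
          (use G that in \<open>simp add: rG\<close>)
      ultimately show ?thesis by (simp add: rG)
    qed
  qed (use pe pG cG in auto)
  have bot: "G t = 0" if x: "x \<in> X" and t: "t < - norm x" for x t
  proof (rule blinfun_eqI)
    fix \<xi>
    have "G t (G t \<xi>) = G t \<xi>" by (rule projD[OF pG])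
    hence "spectral_family e x t (G t \<xi>) = G t \<xi>" using x rG by blast
    moreover have "spectral_family e x t = 0" by (rule cut_bot[OF cut[OF XM[OF x]] t])
    ultimately show "G t \<xi> = blinfun_apply 0 \<xi>" by simp
  qed
  have le_b: "spectral_family e x t \<xi> = \<xi>" if "x \<in> X" "spectral_family e b t \<xi> = \<xi>" for x t \<xi>
    using b that spectral_le_iff[OF hx xb hx xb eb] XM by blast
  have top: "G t = e" if "norm b \<le> t" for t
  proof (rule proj_eqI[OF pG pe])
    have "spectral_family e b t = e" by (rule cut_top_norm[OF pe cut[OF b(1)] that])
    thus "G t \<xi> = \<xi> \<longleftrightarrow> e \<xi> = \<xi>" for \<xi> using le_b[of _ t \<xi>] by (auto simp: rG)
  qed
  obtain x0 where x0: "x0 \<in> X" using X(2) by blast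
  have "- norm x0 - 1 \<le> norm b" using norm_ge_zero[of x0] norm_ge_zero[of b] by linarith
  then obtain s where s: "hermitian_in e s" "\<And>t. cut e s t (G t)"
      "\<And>A. sot_algebra A \<Longrightarrow> \<forall>t. G t \<in> A \<Longrightarrow> s \<in> A"
    using operator_of_resolution[OF R bot[OF x0] top[OF order_refl], of "- norm x0 - 1"] by auto
  have sM: "s \<in> \<M>"
    by (rule unital_extension_corner[OF s(3)[OF A] hermitian_inD(3)[OF s(1)]])
      (simp add: subset_unital_extension[OF u GM])
  have sb: "s \<in> bounded_ops" using M sM by (auto simp: cstar_subalgebra_def)
  have ssa: "s \<in> self_adjoint_part \<M>"
    using sM self_adjoint_iff_sa[OF sb] hermitian_inD(2)[OF s(1)] by (simp add: self_adjoint_part_def)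
  have fam: "spectral_family e s t = G t" for t by (rule cut_unique[OF s(1) cut[OF ssa] s(2)])
  have "is_spectral_sup \<M> e X s"
    unfolding is_spectral_sup_def
  proof (intro conjI ballI impI ssa)
    show "spectral_le e x s" if "x \<in> X" for x
      using that XM spectral_le_iff[OF hx xb s(1) sb eb] by (simp add: fam rG)
    show "spectral_le e s y" if y: "y \<in> self_adjoint_part \<M>" "\<forall>x\<in>X. spectral_le e x y" for y
      unfolding spectral_le_iff[OF s(1) sb hx[OF y(1)] xb[OF y(1)] eb] fam rG
      using y spectral_le_iff[OF hx xb hx[OF y(1)] xb[OF y(1)] eb] XM
        corner_range[OF cutD(2)[OF cut[OF y(1)]]] by blast
  qed
  moreover have "norm (s \<xi>) \<le> (norm x + norm b + 1) * norm \<xi>" if x: "x \<in> X" for x \<xi>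
  proof (rule hermitian_in_norm_le[OF s(1)])
    define K where "K = norm x + norm b + 1"
    have K: "0 \<le> K" "- K < - norm x" "norm b \<le> K"
      using norm_ge_zero[of x] norm_ge_zero[of b] unfolding K_def by linarith+
    show "0 \<le> norm x + norm b + 1" using K(1) unfolding K_def .
    fix \<eta> assume e\<eta>: "e \<eta> = \<eta>"
    have "ip (s \<eta>) \<eta> \<le> K * ip \<eta> \<eta>" by (rule cutD(4)[OF s(2)]) (simp add: top[OF K(3)] e\<eta>)
    moreover have "- K * ip \<eta> \<eta> \<le> ip (s \<eta>) \<eta>"
      using cutD(5)[OF s(2) e\<eta>, of "- K"] by (cases "\<eta> = 0") (auto simp: bot[OF x K(2)] ip_simps)
    ultimately show "\<bar>ip (s \<eta>) \<eta>\<bar> \<le> (norm x + norm b + 1) * ip \<eta> \<eta>"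
      unfolding K_def[symmetric] by linarith
  qed
  ultimately show ?thesis using s(1,2) unfolding G_def by blast
qed

section \<open>Limits of power sums\<close>

text \<open>Chebyshev's inequality for the \<open>n\<close>-th moment of the spectral measure of \<open>T\<close> at \<open>\<xi>\<close>.\<close>

lemma cut_tail:
  assumes h: "hermitian_in e T" and T: "psd T" and P: "cut e T t P" and "0 \<le> t" and "n > 0"
    and \<xi>: "e \<xi> = \<xi>"
  shows "t ^ n * (norm (\<xi> - P \<xi>))\<^sup>2 \<le> ip (op_power T n \<xi>) \<xi>"
proof -
  define \<eta> \<zeta> where "\<eta> = \<xi> - P \<xi>" and "\<zeta> = P \<xi>"
  define W where "W = op_power T n"
  have W: "psd W" unfolding W_def by (rule psd_power[OF T])
  have comm: "P (W \<zeta>) = W (P \<zeta>)" for \<zeta>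
    unfolding W_def by (rule op_power_commutes) (rule cutD(3)[OF P])
  have \<eta>: "e \<eta> = \<eta>" "P \<eta> = 0"
    by (simp_all add: \<eta>_def blinfun.diff_right \<xi> projD[OF cutD(1)[OF P]] cornerD[OF cutD(2)[OF P]])
  have P\<zeta>: "P \<zeta> = \<zeta>" by (simp add: \<zeta>_def projD[OF cutD(1)[OF P]])
  have 1: "ip (W \<eta>) \<zeta> = 0"
    using saD[OF projD(1)[OF cutD(1)[OF P]], of "W \<eta>" \<zeta>] comm[of \<eta>] by (simp add: P\<zeta> \<eta> blinfun.zero_right ip_simps)
  have 2: "ip (W \<zeta>) \<eta> = 0"
    using saD[OF projD(1)[OF cutD(1)[OF P]], of "W \<zeta>" \<eta>] comm[of \<zeta>] by (simp add: P\<zeta> \<eta> ip_simps)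
  have "t ^ n * ip \<eta> \<eta> \<le> ip (W \<eta>) \<eta>"
    unfolding W_def using cut_power_lower[OF h T P \<open>0 \<le> t\<close> \<eta> _ \<open>n > 0\<close>]
    by (cases "\<eta> = 0") (auto simp: ip_simps)
  also have "\<dots> \<le> ip (W \<eta>) \<eta> + ip (W \<zeta>) \<zeta>" using W by (simp add: psd_def)
  also have "\<dots> = ip (W (\<eta> + \<zeta>)) (\<eta> + \<zeta>)" by (simp add: blinfun.add_right ip_simps 1 2)
  also have "\<eta> + \<zeta> = \<xi>" by (simp add: \<eta>_def \<zeta>_def)
  finally show ?thesis by (simp add: \<eta>_def W_def ip_self)
qed

lemma op_power_norm_le:
  fixes T :: "'h::chilbert_space op"
  shows "norm (op_power T n \<xi>) \<le> norm T ^ n * norm \<xi>"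
proof (induction n)
  case (Suc n)
  have "norm (T (op_power T n \<xi>)) \<le> norm T * norm (op_power T n \<xi>)" by (rule norm_blinfun)
  also have "\<dots> \<le> norm T * (norm T ^ n * norm \<xi>)" by (intro mult_left_mono Suc norm_ge_zero)
  finally show ?case by (simp add: mult.assoc)
qed simp

text \<open>\<open>T e\<close> is a positive root of the same operator as \<open>T\<close>.\<close>

lemma corner_root:
  fixes T :: "'h::chilbert_space op"
  assumes e: "proj e" and T: "psd T" and n: "n > 0" and comm: "\<And>\<xi>. e (T \<xi>) = T (e \<xi>)"
    and S: "corner e (op_power T n)"
  shows "corner e T"
proof -
  define T' where "T' = T o\<^sub>L e"
  have saT: "sa T" using T by (simp add: psd_def)
  have "psd T'"
  proof -
    have "ip (T' \<xi>) \<xi> = ip (T (e \<xi>)) (e \<xi>)" for \<xi>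
      using saD[OF projD(1)[OF e], of "T (e \<xi>)" \<xi>] by (simp add: T'_def comm projD[OF e])
    moreover have "sa T'" unfolding T'_def by (rule sa_compose) (simp_all add: saT projD e comm)
    ultimately show ?thesis using T by (simp add: psd_def)
  qed
  moreover have "op_power T' n = op_power T n"
  proof (rule blinfun_eqI)
    fix \<xi>
    have eT': "e (op_power T' m \<xi>) = op_power T m (e \<xi>)" for m
    proof (induction m)
      case (Suc m)
      have "e (op_power T' (Suc m) \<xi>) = T (e (e (op_power T' m \<xi>)))" by (simp add: T'_def comm)
      also have "\<dots> = T (e (op_power T' m \<xi>))" by (simp only: projD(2)[OF e])
      finally show ?case by (simp only: Suc op_power_Suc blinfun_apply_blinfun_compose)
    qed simp
    obtain m where m: "n = Suc m" using n gr0_implies_Suc by blast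
    have "op_power T' n \<xi> = op_power T n (e \<xi>)" unfolding m by (simp add: T'_def flip: eT')
    thus "op_power T' n \<xi> = op_power T n \<xi>" by (simp add: cornerD[OF S])
  qed
  ultimately have "T' = T" by (intro psd_root_unique[OF _ T n])
  hence "T (e \<xi>) = T \<xi>" for \<xi> by (metis T'_def blinfun_apply_blinfun_compose)
  thus ?thesis using comm by (simp add: corner_def)
qed

text \<open>As for the \<open>\<ell>\<^sup>n\<close> norms of a vector, the largest spectral value wins. Let \<open>T\<close> be the \<open>n\<close>-th root and let
  \<open>0 \<le> \<alpha> < \<beta>\<close>. Estimated with \<open>cut_tail\<close> for \<open>n\<close>-th powers, the component above \<open>\<beta>\<close> with respect to \<open>T\<close> of a vector in
  the range of \<open>P \<alpha>\<close>, and the component above \<open>\<beta>\<close> with respect to \<open>a x\<close> of a vector in the range of the cut of \<open>T\<close> at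
  \<open>\<alpha>\<close>, are of order \<open>(\<alpha> / \<beta>)\<^bsup>n/2\<^esup>\<close>. The second estimate passes by duality to the cut of \<open>T\<close> on the complement of
  the range of \<open>P \<beta>\<close>.\<close>

lemma power_sum_root_tendsto:
  fixes a :: "'j \<Rightarrow> 'h::chilbert_space op"
  assumes e: "e \<in> bounded_ops" and F: "finite F" "F \<noteq> {}"
    and a: "\<And>x. x \<in> F \<Longrightarrow> hermitian_in e (a x)" "\<And>x. x \<in> F \<Longrightarrow> psd (a x)" "\<And>x. x \<in> F \<Longrightarrow> a x \<in> bounded_ops"
    and E: "\<And>x t. x \<in> F \<Longrightarrow> cut e (a x) t (E x t)"
    and c: "hermitian_in e c" "\<And>t. cut e c t (P t)"
    and P: "\<And>t \<xi>. P t \<xi> = \<xi> \<longleftrightarrow> e \<xi> = \<xi> \<and> (\<forall>x\<in>F. E x t \<xi> = \<xi>)"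
  shows "(\<lambda>n. op_root n (\<Sum>x\<in>F. op_power (a x) n) \<xi>) \<longlonglongrightarrow> c \<xi>"
proof -
  have pe: "proj e" by (rule hermitian_inD(1)[OF c(1)])
  define k where "k = real (card F)"
  have k1: "1 \<le> k" using F by (simp add: k_def Suc_le_eq card_gt_0_iff)
  define S where "S = (\<lambda>n. \<Sum>x\<in>F. op_power (a x) n)"
  define T where "T = (\<lambda>n. op_root n (S n))"
  have S_ip: "ip (S n \<xi>) \<xi> = (\<Sum>x\<in>F. ip (op_power (a x) n \<xi>) \<xi>)" for n \<xi>
    by (simp add: S_def blinfun.sum_left ip.sum_left)
  have apsd: "psd (op_power (a x) n)" if "x \<in> F" for x n by (rule psd_power[OF a(2)[OF that]])
  have S_psd: "psd (S n)" for n
  proof -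
    have "sa (S n)" unfolding S_def by (rule sa_sum) (use apsd in \<open>simp add: psd_def\<close>)
    moreover have "0 \<le> ip (S n \<xi>) \<xi>" for \<xi>
      unfolding S_ip by (rule sum_nonneg) (use apsd in \<open>simp add: psd_def\<close>)
    ultimately show ?thesis by (simp add: psd_def)
  qed
  have S_b: "S n \<in> bounded_ops" for n
    unfolding S_def by (intro sot_algebra_sum sot_algebra_power sot_algebra_bounded_ops a(3))
  have S_c: "corner e (S n)" if "n > 0" for n
  proof -
    have "corner e (op_power (a x) n)" if "x \<in> F" for x
      by (rule corner_power[OF hermitian_inD(3)[OF a(1)[OF that]] \<open>n > 0\<close>])
    thus ?thesis by (simp add: corner_def S_def blinfun.sum_left blinfun.sum_right)
  qed
  have part: "ip (op_power (a x) n \<xi>) \<xi> \<le> ip (S n \<xi>) \<xi>" if "x \<in> F" for x n \<xi>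
    unfolding S_ip by (rule member_le_sum[OF that _ F(1)]) (use apsd in \<open>simp add: psd_def\<close>)
  have T: "psd (T n)" "op_power (T n) n = S n" if "n > 0" for n
    unfolding T_def by (rule op_root_psd[OF S_psd S_b that])+
  have hT: "hermitian_in e (T n)" if n: "n > 0" for n
  proof -
    have "T n \<in> commutant e" unfolding T_def
      by (rule op_root_psd(3)[OF S_psd S_b n sot_algebra_commutant])
        (use S_c[OF n] in \<open>simp add: commutant_def corner_def\<close>)
    hence "corner e (T n)"
      by (intro corner_root[OF pe T(1)[OF n] n]) (use S_c[OF n] in \<open>auto simp: commutant_def T(2)[OF n]\<close>)
    thus ?thesis using pe T(1)[OF n] by (simp add: hermitian_in_def psd_def)
  qed
  obtain Q where Q: "\<And>n t. n > 0 \<Longrightarrow> cut e (T n) t (Q n t)"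
  proof -
    have "\<exists>P. n > 0 \<longrightarrow> cut e (T n) t P" for n t
      using some_cut_exists[OF hT] by blast
    thus ?thesis using that by metis
  qed
  define K where "K = (\<Sum>x\<in>F. norm (a x))"
  have K0: "0 \<le> K" unfolding K_def by (rule sum_nonneg) simp
  have S_le: "ip (S n \<xi>) \<xi> \<le> k * K ^ n * ip \<xi> \<xi>" for n \<xi>
  proof -
    have "ip (op_power (a x) n \<xi>) \<xi> \<le> K ^ n * ip \<xi> \<xi>" if x: "x \<in> F" for x
    proof -
      have "norm (a x) \<le> K" unfolding K_def by (rule member_le_sum[OF x _ F(1)]) simp
      hence "norm (a x) ^ n * norm \<xi> \<le> K ^ n * norm \<xi>" by (intro mult_right_mono power_mono) auto
      hence "norm (op_power (a x) n \<xi>) * norm \<xi> \<le> (K ^ n * norm \<xi>) * norm \<xi>"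
        using op_power_norm_le[of "a x" n \<xi>] by (intro mult_right_mono) auto
      thus ?thesis using ip_cauchy_schwarz[of "op_power (a x) n \<xi>" \<xi>] by (simp add: ip_self power2_eq_square)
    qed
    hence "ip (S n \<xi>) \<xi> \<le> (\<Sum>x\<in>F. K ^ n * ip \<xi> \<xi>)" unfolding S_ip by (rule sum_mono)
    thus ?thesis by (simp add: k_def)
  qed
  have T_norm: "norm (T n \<xi>) \<le> k * K * norm \<xi>" if n: "n > 0" for n \<xi>
  proof (rule hermitian_in_norm_le[OF hT[OF n]])
    show kK: "0 \<le> k * K" using k1 K0 by simp
    fix \<eta> assume e\<eta>: "e \<eta> = \<eta>"
    define \<zeta> where "\<zeta> = \<eta> - Q n (k * K) \<eta>"
    note q = cutD(1,2)[OF Q[OF n]]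
    have \<zeta>: "e \<zeta> = \<zeta>" "Q n (k * K) \<zeta> = 0"
      by (simp_all add: \<zeta>_def blinfun.diff_right e\<eta> projD[OF q(1)] cornerD[OF q(2)])
    have "\<zeta> = 0"
    proof (rule ccontr)
      assume nz: "\<zeta> \<noteq> 0"
      have "(k * K) ^ n * ip \<zeta> \<zeta> < ip (S n \<zeta>) \<zeta>"
        using cut_power_lower[OF hT[OF n] T(1)[OF n] Q[OF n] kK \<zeta> nz n] by (simp add: T(2)[OF n])
      also have "\<dots> \<le> k * K ^ n * ip \<zeta> \<zeta>" by (rule S_le)
      also have "\<dots> \<le> k ^ n * K ^ n * ip \<zeta> \<zeta>"
        using K0 self_le_power[OF k1 n] by (intro mult_right_mono ip_self_nonneg) auto
      finally show False by (simp add: power_mult_distrib)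
    qed
    hence "Q n (k * K) \<eta> = \<eta>" by (simp add: \<zeta>_def)
    hence "ip (T n \<eta>) \<eta> \<le> k * K * ip \<eta> \<eta>" by (rule cutD(4)[OF Q[OF n]])
    thus "\<bar>ip (T n \<eta>) \<eta>\<bar> \<le> k * K * ip \<eta> \<eta>" using T(1)[OF n] by (simp add: psd_def)
  qed
  have ratio: "(\<lambda>n. C * (\<alpha> / \<beta>) ^ n) \<longlonglongrightarrow> 0" if "0 \<le> \<alpha>" "\<alpha> < \<beta>" for \<alpha> \<beta> C :: real
  proof -
    have "(\<lambda>n. (\<alpha> / \<beta>) ^ n) \<longlonglongrightarrow> 0" using that by (intro LIMSEQ_realpow_zero) auto
    from tendsto_mult[OF tendsto_const[of C] this] show ?thesis by simp
  qed
  have ev0: "eventually (\<lambda>n::nat. n > 0) sequentially" by (rule eventually_gt_at_top)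
  have null: "v \<longlonglongrightarrow> 0"
    if "0 \<le> \<alpha>" "\<alpha> < \<beta>" "\<And>n. n > 0 \<Longrightarrow> (norm (v n))\<^sup>2 \<le> C * (\<alpha> / \<beta>) ^ n"
    for \<alpha> \<beta> C and v :: "nat \<Rightarrow> 'h"
  proof -
    have "(\<lambda>n. (norm (v n))\<^sup>2) \<longlonglongrightarrow> 0"
    proof (rule tendsto_sandwich[OF _ _ tendsto_const ratio[OF that(1,2), of C]])
      show "eventually (\<lambda>n. (norm (v n))\<^sup>2 \<le> C * (\<alpha> / \<beta>) ^ n) sequentially"
        by (rule eventually_mono[OF ev0 that(3)])
    qed simp
    from tendsto_real_sqrt[OF this] have "(\<lambda>n. norm (v n)) \<longlonglongrightarrow> 0" by simp
    thus ?thesis by (rule tendsto_norm_zero_cancel)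
  qed
  have "(\<lambda>n. T n \<xi>) \<longlonglongrightarrow> c \<xi>"
  proof (rule cut_convergence[OF c, where Q = Q and K = "k * K"])
    show "eventually (\<lambda>n. hermitian_in e (T n) \<and> (\<forall>t. cut e (T n) t (Q n t)) \<and>
        (\<forall>\<xi>. norm (T n \<xi>) \<le> k * K * norm \<xi>)) sequentially"
      using ev0 by eventually_elim (use hT Q T_norm in blast)
  next
    fix \<alpha> \<beta> \<xi> assume ab: "\<alpha> < \<beta>" and \<xi>: "P \<alpha> \<xi> = \<xi>"
    have e\<xi>: "e \<xi> = \<xi>" and E\<xi>: "\<And>x. x \<in> F \<Longrightarrow> E x \<alpha> \<xi> = \<xi>" using \<xi> P by auto
    show "(\<lambda>n. Q n \<beta> \<xi>) \<longlonglongrightarrow> \<xi>"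
    proof (cases "\<alpha> < 0")
      case True
      obtain x where x: "x \<in> F" using F by blast
      have "E x \<alpha> = 0" by (rule psd_cut_negative[OF a(2)[OF x] E[OF x] True])
      hence "\<xi> = 0" using E\<xi>[OF x] by simp
      thus ?thesis by (simp add: blinfun.zero_right)
    next
      case False
      hence a0: "0 \<le> \<alpha>" "0 < \<beta>" using ab by auto
      have bound: "(norm (\<xi> - Q n \<beta> \<xi>))\<^sup>2 \<le> (k * ip \<xi> \<xi>) * (\<alpha> / \<beta>) ^ n" if n: "n > 0" for n
      proof -
        have "\<beta> ^ n * (norm (\<xi> - Q n \<beta> \<xi>))\<^sup>2 \<le> ip (S n \<xi>) \<xi>"
          using cut_tail[OF hT[OF n] T(1)[OF n] Q[OF n] _ n e\<xi>, of \<beta>] a0 by (simp add: T(2)[OF n])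
        also have "\<dots> \<le> (\<Sum>x\<in>F. \<alpha> ^ n * ip \<xi> \<xi>)"
          unfolding S_ip by (intro sum_mono cut_power_upper[OF a(1,2) E] a0 E\<xi>) auto
        also have "\<dots> = k * ip \<xi> \<xi> * \<alpha> ^ n" by (simp add: k_def)
        finally show ?thesis using a0 by (simp add: power_divide field_simps)
      qed
      have "(\<lambda>n. \<xi> - Q n \<beta> \<xi>) \<longlonglongrightarrow> 0" by (rule null[OF a0(1) ab bound])
      from tendsto_diff[OF tendsto_const[of \<xi>] this] show ?thesis by simp
    qed
  next
    fix \<alpha> \<beta> \<xi> assume ab: "\<alpha> < \<beta>" and \<xi>: "e \<xi> = \<xi>" "P \<beta> \<xi> = 0"
    show "(\<lambda>n. Q n \<alpha> \<xi>) \<longlonglongrightarrow> 0"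
    proof (cases "\<alpha> < 0")
      case True
      have "eventually (\<lambda>n. Q n \<alpha> \<xi> = 0) sequentially"
        using ev0 by eventually_elim (simp add: psd_cut_negative[OF T(1) Q True])
      thus ?thesis by (rule tendsto_eventually)
    next
      case False
      hence a0: "0 \<le> \<alpha>" "0 < \<beta>" using ab by auto
      show ?thesis
      proof (rule null_net_complement_Inf[where J = F and P = "\<lambda>x. E x \<beta>" and Pinf = "P \<beta>" and e = e])
        show "eventually (\<lambda>n. \<forall>\<xi>. norm (Q n \<alpha> \<xi>) \<le> norm \<xi>) sequentially"
          using ev0 by eventually_elim (use proj_norm_le[OF cutD(1)[OF Q]] in blast)
        show "(\<lambda>n. Q n \<alpha> \<eta>) \<longlonglongrightarrow> 0" if x: "x \<in> F" and \<eta>: "E x \<beta> \<eta> = 0" for x \<eta>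
        proof (rule null[OF a0(1) ab])
          fix n :: nat assume n: "n > 0"
          define v where "v = Q n \<alpha> \<eta>"
          define u where "u = v - E x \<beta> v"
          note q = cutD(1,2)[OF Q[OF n]]
          have Qv: "Q n \<alpha> v = v" by (simp add: v_def projD[OF q(1)])
          have ev: "e v = v" by (rule corner_range[OF q(2) Qv])
          have "\<beta> ^ n * (norm u)\<^sup>2 \<le> ip (op_power (a x) n v) v"
            unfolding u_def by (rule cut_tail[OF a(1,2)[OF x] E[OF x] _ n ev]) (use a0 in simp)
          also have "\<dots> \<le> ip (op_power (T n) n v) v" unfolding T(2)[OF n] by (rule part[OF x])
          also have "\<dots> \<le> \<alpha> ^ n * ip v v" by (rule cut_power_upper[OF hT[OF n] T(1)[OF n] Q[OF n] a0(1) Qv])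
          finally have u: "(norm u)\<^sup>2 \<le> (\<alpha> / \<beta>) ^ n * (norm v)\<^sup>2"
            using a0 by (simp add: ip_self power_divide field_simps)
          have "(norm v)\<^sup>2 = ip v \<eta>"
            using saD[OF projD(1)[OF q(1)], of \<alpha> v \<eta>] Qv by (simp add: v_def[symmetric] ip_self)
          also have "\<dots> = ip u \<eta>"
            using saD[OF projD(1)[OF cutD(1)[OF E[OF x]]], of \<beta> v \<eta>] by (simp add: u_def ip_simps \<eta>)
          also have "\<dots> \<le> norm u * norm \<eta>" using ip_cauchy_schwarz[of u \<eta>] by linarith
          finally have "((norm v)\<^sup>2)\<^sup>2 \<le> (norm u * norm \<eta>)\<^sup>2" by (rule power_mono) simp
          also have "\<dots> \<le> (\<alpha> / \<beta>) ^ n * (norm v)\<^sup>2 * (norm \<eta>)\<^sup>2"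
            unfolding power_mult_distrib by (intro mult_right_mono u) simp
          finally have *: "(norm v)\<^sup>2 * (norm v)\<^sup>2 \<le> (norm \<eta>)\<^sup>2 * (\<alpha> / \<beta>) ^ n * (norm v)\<^sup>2"
            by (simp add: power2_eq_square mult_ac)
          show "(norm (Q n \<alpha> \<eta>))\<^sup>2 \<le> (norm \<eta>)\<^sup>2 * (\<alpha> / \<beta>) ^ n"
          proof (cases "v = 0")
            case True
            thus ?thesis using a0 by (simp add: v_def[symmetric])
          next
            case False
            have "(norm v)\<^sup>2 \<le> (norm \<eta>)\<^sup>2 * (\<alpha> / \<beta>) ^ n"
              by (rule mult_right_le_imp_le[OF *]) (use False in simp)
            thus ?thesis by (simp add: v_def)
          qed
        qed
      qed (use pe cutD(1,2)[OF c(2)] cutD(1,2)[OF E] P \<xi> in auto)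
    qed
  qed
  thus ?thesis by (simp add: T_def S_def)
qed

lemma cut_shift:
  assumes P: "cut e x t P"
  shows "cut e (x - d *\<^sub>R e) (t - d) P"
  unfolding cut_def
proof (intro conjI allI impI)
  note c = cornerD[OF cutD(2)[OF P]]
  show "P ((x - d *\<^sub>R e) \<xi>) = (x - d *\<^sub>R e) (P \<xi>)" for \<xi>
    by (simp add: blinfun.bilinear_simps cutD(3)[OF P] c)
  show "ip ((x - d *\<^sub>R e) \<xi>) \<xi> \<le> (t - d) * ip \<xi> \<xi>" if "P \<xi> = \<xi>" for \<xi>
    using cutD(4)[OF P that] corner_range[OF cutD(2)[OF P] that]
    by (simp add: blinfun.bilinear_simps ip_simps left_diff_distrib)
  show "(t - d) * ip \<xi> \<xi> < ip ((x - d *\<^sub>R e) \<xi>) \<xi>" if "e \<xi> = \<xi>" "P \<xi> = 0" "\<xi> \<noteq> 0" for \<xi>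
    using cutD(5)[OF P that] that by (simp add: blinfun.bilinear_simps ip_simps left_diff_distrib)
qed (rule cutD(1,2)[OF P])+

lemma hermitian_in_shift: "hermitian_in e x \<Longrightarrow> hermitian_in e (x - d *\<^sub>R e)"
  by (auto simp: hermitian_in_def corner_def proj_def blinfun.bilinear_simps intro: sa_diff sa_scaleR)

theorem corollary2p6:
  fixes \<M> M :: "'h::chilbert_space op set"
    and one :: "'h op"
    and \<delta> :: "'h op set \<Rightarrow> real"
  assumes "von_neumann_algebra \<M>"
    and "algebra_unit \<M> one"
    and "M \<subseteq> self_adjoint_part \<M>"
    and "M \<noteq> {}"
    and "\<exists>b\<in>self_adjoint_part \<M>. \<forall>x\<in>M. spectral_le one x b"
    and "\<And>F. finite F \<Longrightarrow> F \<noteq> {} \<Longrightarrow> F \<subseteq> M \<Longrightarrow> ereal (\<delta> F) \<le> (MIN x\<in>F. spectral_lower one x)"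
  shows "\<exists>s A.
    is_spectral_sup \<M> one M s \<and>
    (\<forall>F. finite F \<and> F \<noteq> {} \<and> F \<subseteq> M \<longrightarrow>
       limitin strong_operator_topology
         (\<lambda>n. op_root n (\<Sum>x\<in>F. op_power (x - \<delta> F *\<^sub>R one) n)) (A F) sequentially) \<and>
    limitin strong_operator_topology
      (\<lambda>F. \<delta> F *\<^sub>R one + A F) s (finite_subsets_at_top M)"
proof -
  note vN = assms(1) and u = assms(2)
  have C: "cstar_subalgebra \<M>" using vN by (simp add: von_neumann_algebra_def)
  note eb = algebra_unit_projection(1)[OF C u] and pe = algebra_unit_projection(2)[OF C u]
  obtain b where b: "b \<in> self_adjoint_part \<M>" "\<forall>x\<in>M. spectral_le one x b" using assms(5) by blast
  obtain x0 where x0: "x0 \<in> M" using assms(4) by blast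
  have hx: "hermitian_in one x" and xb: "x \<in> bounded_ops" if "x \<in> M" for x
    using hermitian_in_algebra[OF C u] assms(3) that by auto
  have cut: "cut one x t (spectral_family one x t)" if "x \<in> M" for x t
    by (rule spectral_family_cut[OF hx[OF that] eb xb[OF that]])
  define sup where "sup = (\<lambda>X s. is_spectral_sup \<M> one X s \<and> hermitian_in one s \<and>
    (\<forall>t. cut one s t (join_family one X t)) \<and>
    (\<forall>x\<in>X. \<forall>\<xi>. norm (s \<xi>) \<le> (norm x + norm b + 1) * norm \<xi>))"
  have "\<exists>s. sup X s" if X: "X \<subseteq> M" "X \<noteq> {}" for X
  proof -
    have "X \<subseteq> self_adjoint_part \<M>" "\<forall>x\<in>X. spectral_le one x b" using X assms(3) b(2) by auto
    thus ?thesis unfolding sup_def using spectral_sup_exists[OF vN u _ X(2) b(1)] by blast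
  qed
  then obtain s where sup: "\<And>X. X \<subseteq> M \<Longrightarrow> X \<noteq> {} \<Longrightarrow> sup X (s X)" by metis
  have s: "\<And>X. X \<subseteq> M \<Longrightarrow> X \<noteq> {} \<Longrightarrow> is_spectral_sup \<M> one X (s X)"
      "\<And>X. X \<subseteq> M \<Longrightarrow> X \<noteq> {} \<Longrightarrow> hermitian_in one (s X)"
      "\<And>X t. X \<subseteq> M \<Longrightarrow> X \<noteq> {} \<Longrightarrow> cut one (s X) t (join_family one X t)"
      "\<And>X x \<xi>. X \<subseteq> M \<Longrightarrow> x \<in> X \<Longrightarrow> norm (s X \<xi>) \<le> (norm x + norm b + 1) * norm \<xi>"
    using sup unfolding sup_def by blast+
  have roots: "(\<lambda>n. op_root n (\<Sum>x\<in>F. op_power (x - \<delta> F *\<^sub>R one) n) \<xi>) \<longlonglongrightarrow> (s F - \<delta> F *\<^sub>R one) \<xi>"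
    if F: "finite F" "F \<noteq> {}" "F \<subseteq> M" for F \<xi>
  proof (rule power_sum_root_tendsto[OF eb F(1,2), where E = "\<lambda>x t. spectral_family one x (t + \<delta> F)"
        and P = "\<lambda>t. join_family one F (t + \<delta> F)"])
    fix x assume x: "x \<in> F"
    hence xM: "x \<in> M" using F by blast
    show h: "hermitian_in one (x - \<delta> F *\<^sub>R one)" by (rule hermitian_in_shift[OF hx[OF xM]])
    show c: "cut one (x - \<delta> F *\<^sub>R one) t (spectral_family one x (t + \<delta> F))" for t
      using cut_shift[OF cut[OF xM], of "\<delta> F" "t + \<delta> F"] by simp
    show "x - \<delta> F *\<^sub>R one \<in> bounded_ops"
      by (intro sot_algebra_diff[OF sot_algebra_bounded_ops] sot_algebraD(3)[OF sot_algebra_bounded_ops] xb xM eb)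
    have "ereal (\<delta> F) \<le> (MIN x\<in>F. spectral_lower one x)" by (rule assms(6)[OF F])
    also have "\<dots> \<le> spectral_lower one x" using F x by (intro Min_le) auto
    finally have lower: "ereal (\<delta> F) \<le> spectral_lower one x" .
    have low: "\<delta> F \<le> t" if "spectral_family one x t \<noteq> 0" for t
    proof -
      have "spectral_lower one x \<le> ereal t" unfolding spectral_lower_def using that by (intro Inf_lower) auto
      with lower have "ereal (\<delta> F) \<le> ereal t" by (rule order_trans)
      thus ?thesis by simp
    qed
    show "psd (x - \<delta> F *\<^sub>R one)"
    proof (rule psd_if_cuts_vanish[OF h])
      fix t :: real assume "t < 0"
      hence "spectral_family one x (t + \<delta> F) = 0" using low[of "t + \<delta> F"] by force
      thus "cut one (x - \<delta> F *\<^sub>R one) t 0" using c[of t] by simp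
    qed
  next
    show "hermitian_in one (s F - \<delta> F *\<^sub>R one)" by (rule hermitian_in_shift[OF s(2)[OF F(3,2)]])
    show "cut one (s F - \<delta> F *\<^sub>R one) t (join_family one F (t + \<delta> F))" for t
      using cut_shift[OF s(3)[OF F(3,2)], of "\<delta> F" "t + \<delta> F"] by simp
    show "join_family one F (t + \<delta> F) \<xi> = \<xi> \<longleftrightarrow>
        one \<xi> = \<xi> \<and> (\<forall>x\<in>F. spectral_family one x (t + \<delta> F) \<xi> = \<xi>)" for t \<xi>
      unfolding join_family_def by (rule inf_proj_range[OF pe])
  qed
  have ev: "eventually (\<lambda>F. F \<subseteq> M \<and> x0 \<in> F) (finite_subsets_at_top M)"
    unfolding eventually_finite_subsets_at_top using x0 by (intro exI[of _ "{x0}"]) auto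
  have net: "((\<lambda>F. s F \<xi>) \<longlongrightarrow> s M \<xi>) (finite_subsets_at_top M)" for \<xi>
  proof (rule cut_convergence[OF s(2)[OF order_refl assms(4)] s(3)[OF order_refl assms(4)],
        where Q = "\<lambda>F. join_family one F" and K = "norm x0 + norm b + 1"])
    show "eventually (\<lambda>F. hermitian_in one (s F) \<and> (\<forall>t. cut one (s F) t (join_family one F t)) \<and>
        (\<forall>\<xi>. norm (s F \<xi>) \<le> (norm x0 + norm b + 1) * norm \<xi>)) (finite_subsets_at_top M)"
      using ev
    proof eventually_elim
      case (elim F)
      hence F: "F \<subseteq> M" "F \<noteq> {}" "x0 \<in> F" by auto
      show ?case by (intro conjI allI s(2,3)[OF F(1,2)] s(4)[OF F(1,3)])
    qed
  next
    fix \<alpha> \<beta> :: real and \<xi> assume ab: "\<alpha> < \<beta>"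
    note p = proj_inf_proj[OF pe] and r = inf_proj_range[OF pe]
    have mono: "join_family one F \<beta> \<xi> = \<xi>" if "F \<subseteq> M" "join_family one F \<alpha> \<xi> = \<xi>" for F \<xi>
      using that cut_mono[OF hx cut cut less_imp_le[OF ab]] unfolding join_family_def r by blast
    show "((\<lambda>F. join_family one F \<beta> \<xi>) \<longlongrightarrow> \<xi>) (finite_subsets_at_top M)" if "join_family one M \<alpha> \<xi> = \<xi>"
    proof (rule tendsto_eventually)
      have "join_family one M \<beta> \<xi> = \<xi>" by (rule mono[OF order_refl that])
      thus "eventually (\<lambda>F. join_family one F \<beta> \<xi> = \<xi>) (finite_subsets_at_top M)"
        unfolding join_family_def r by (intro eventually_finite_subsets_at_top_weakI) auto
    qed
    show "((\<lambda>F. join_family one F \<alpha> \<xi>) \<longlongrightarrow> 0) (finite_subsets_at_top M)" if "join_family one M \<beta> \<xi> = 0"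
    proof (rule Lim_null_comparison)
      show "((\<lambda>F. norm (join_family one F \<beta> \<xi>)) \<longlongrightarrow> 0) (finite_subsets_at_top M)"
      proof -
        have "((\<lambda>F. join_family one F \<beta> \<xi>) \<longlongrightarrow> join_family one M \<beta> \<xi>) (finite_subsets_at_top M)"
          unfolding join_family_def by (intro inf_proj_tendsto[OF pe] cutD(1)[OF cut] cutD(2)[OF cut])
        from tendsto_norm[OF this] show ?thesis using that by simp
      qed
      show "eventually (\<lambda>F. norm (join_family one F \<alpha> \<xi>) \<le> norm (join_family one F \<beta> \<xi>)) (finite_subsets_at_top M)"
      proof (rule eventually_finite_subsets_at_top_weakI)
        fix F assume F: "F \<subseteq> M"
        have "join_family one F \<alpha> (join_family one F \<beta> \<xi>) = join_family one F \<alpha> \<xi>"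
          by (rule proj_order[OF _ _ mono[OF F]]) (simp_all add: join_family_def p)
        thus "norm (join_family one F \<alpha> \<xi>) \<le> norm (join_family one F \<beta> \<xi>)"
          using proj_norm_le[OF p, of "\<lambda>x. spectral_family one x \<alpha>" F "join_family one F \<beta> \<xi>"]
          by (simp add: join_family_def)
      qed
    qed
  qed
  show ?thesis
  proof (intro exI[of _ "s M"] exI[of _ "\<lambda>F. s F - \<delta> F *\<^sub>R one"] conjI allI impI)
    show "is_spectral_sup \<M> one M (s M)" by (rule s(1)[OF order_refl assms(4)])
    show "limitin strong_operator_topology
        (\<lambda>n. op_root n (\<Sum>x\<in>F. op_power (x - \<delta> F *\<^sub>R one) n)) (s F - \<delta> F *\<^sub>R one) sequentially"
      if "finite F \<and> F \<noteq> {} \<and> F \<subseteq> M" for F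
      unfolding limitin_sot_iff using roots that by blast
    show "limitin strong_operator_topology (\<lambda>F. \<delta> F *\<^sub>R one + (s F - \<delta> F *\<^sub>R one)) (s M)
        (finite_subsets_at_top M)"
      using net by (simp add: limitin_sot_iff)
  qed
qed

end
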